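(* Let $k\ge2$, $\boldsymbol{\alpha}=(\alpha_1,\dots,\alpha_k)\in(0,+\infty)^k$, $\beta\in(0,+\infty)$, $\alpha_0=\sum_{i=1}^k\alpha_i$. Let $\mathbf{X}_n=(X_{1n},\dots,X_{kn})$, $n\in[N]$, be a random sample from the Multivariate Gamma distribution $\mathcal{MG}_k(\boldsymbol{\alpha},\beta)$, and let $\mathbf{W}_n:=\Delta\mathbf{X}_n/X_{kn}$, $n\in[N]$, be the corresponding Dirichlet $\mathcal{D}_k(\boldsymbol{\alpha})$ sample. Let $\tilde{\boldsymbol{\alpha}}=g_D(\overline{h_D(\mathbf{W})})$ be a moment-type estimator of $\boldsymbol{\alpha}$ for the family $\mathcal{D}_k(\boldsymbol{\alpha})$, computed from the sample $\mathbf{W}_n$, $n\in[N]$, with functions $h_D$ (valued in $\mathbb{R}^m$) and $g_D:\mathbb{R}^m\to\mathbb{R}^k$, where $\mathbb{E}(\|h_D(\mathbf{W})\|^2)<\infty$ for $\mathbf{W}\sim\mathcal{D}_k(\boldsymbol{\alpha})$ and $g_D$ is continuously differentiable at $e_{h_D}(\boldsymbol{\alpha})$. Then the estimator $\tilde{\boldsymbol{\theta}}=(\tilde{\boldsymbol{\alpha}},\tilde\beta)$, where $$\tilde\beta=\frac{\overline{X_k}}{\sum_{i=1}^k\tilde\alpha_i},$$ is a moment-type estimator of $(\boldsymbol{\alpha},\beta)$ with asymptotic variance-covariance matrix $\mathbf{G}\mathbf{V}\mathbf{G}^\top$, where $$\mathbf{G}=\begin{bmatrix}\mathbf{G}_D&\mathbf{O}_{k\times1}\\-\beta\alpha_0^{-1}\mathbf{1}_{1\times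 k}\mathbf{G}_D&\alpha_0^{-1}\end{bmatrix},\qquad\mathbf{V}=\begin{bmatrix}\mathbf{V}_D&\mathbf{O}_{m\times1}\\\mathbf{O}_{1\times m}&\alpha_0\beta^2\end{bmatrix},$$ and $\mathbf{G}_D=\nabla g_D(e_{h_D}(\boldsymbol{\alpha}))$ (the $k\times m$ Jacobian matrix), $\mathbf{V}_D=v_{h_D}(\boldsymbol{\alpha})$ (the $m\times m$ variance-covariance matrix of $h_D(\mathbf{W})$) are the corresponding matrices for $\tilde{\boldsymbol{\alpha}}$.
   Context: Notation: $[k]=\{1,\dots,k\}$; a random sample is an i.i.d. sample; a bar denotes the sample mean over $n\in[N]$, e.g. $\overline{X_k}=\frac1N\sum_n X_{kn}$, $\overline{h_D(\mathbf{W})}=\frac1N\sum_n h_D(\mathbf{W}_n)$. $\mathbf{1}_{a\times b}$ and $\mathbf{O}_{a\times b}$ are the all-ones and zero matrices. $\Delta\mathbf{x}:=(x_1,x_2-x_1,\dots,x_k-x_{k-1})$. $e_h(\boldsymbol{\theta})=\mathbb{E}_{\boldsymbol{\theta}}(h(\mathbf{X}))$ and $v_h(\boldsymbol{\theta})=\mathbb{V}_{\boldsymbol{\theta}}(h(\mathbf{X}))$ (variance-covariance matrix). Multivariate Gamma distribution: $\mathbf{X}\sim\mathcal{MG}_k(\boldsymbol{\alpha},\beta)$ has Lebesgue density on $\mathbb{R}^k$ $f(\mathbf{x};\boldsymbol{\alpha},\beta)=\frac{1}{\beta^{\alpha_0}\prod_{i=1}^k\Gamma(\alpha_i)}e^{-x_k/\beta}x_1^{\alpha_1-1}\prod_{i=2}^k(x_i-x_{i-1})^{\alpha_i-1}$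 on $\{\mathbf{x}\in(0,+\infty)^k:x_1<x_2<\dots<x_k\}$. Dirichlet distribution: $\mathbf{W}\sim\mathcal{D}_k(\boldsymbol{\alpha})$ has density, with respect to Lebesgue measure on $\mathbb{R}^{k-1}$ (using the first $k-1$ coordinates), $f(\mathbf{w};\boldsymbol{\alpha})=\frac{\Gamma(\alpha_0)}{\prod_{i=1}^k\Gamma(\alpha_i)}\prod_{i=1}^k w_i^{\alpha_i-1}$ on the open simplex $\{\mathbf{w}\in(0,1)^k:\sum_i w_i=1\}$. It is well known that if $\mathbf{X}\sim\mathcal{MG}_k(\boldsymbol{\alpha},\beta)$ then $\Delta\mathbf{X}/X_k\sim\mathcal{D}_k(\boldsymbol{\alpha})$. Moment-type estimator: for a parametric family with support $\mathbf{S}\subset\mathbb{R}^k$ and parameter space $\boldsymbol{\Theta}\subset\mathbb{R}^d$, let $h:\mathbf{S}\to\mathbb{R}^m$ be such that $e_h:\boldsymbol{\Theta}\to\mathbb{R}^m$ is injective, and let $g:\mathbb{R}^m\to\mathbb{R}^d$ satisfy $g|_{e_h(\boldsymbol{\Theta})}=e_h^{-1}$. The estimator $\tilde{\boldsymbol{\theta}}_N=g(\overline{h(\mathbf{X})})$ is called a moment-type estimator of $\boldsymbol{\theta}$ (with functions $h,g$); it exists as long as $\tilde{\boldsymbol{\theta}}_N\in\boldsymbol{\Theta}$. A function $g$ given by a formula is understood to be defined arbitrarily where the formula is undefined. The parameter spaces are $(0,+\infty)^k$ for $\mathcal{D}_k(\boldsymbol{\alpha})$ and $(0,+\infty)^{k+1}$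 for $\mathcal{MG}_k(\boldsymbol{\alpha},\beta)$. An estimator $\tilde{\boldsymbol{\theta}}_N$ that exists with probability tending to 1 as $N\to\infty$ has asymptotic variance-covariance matrix $\boldsymbol{\Sigma}$ if $\sqrt{N}(\tilde{\boldsymbol{\theta}}_N-\boldsymbol{\theta})$ converges in law, under $\boldsymbol{\theta}$, to the centered normal distribution with covariance matrix $\boldsymbol{\Sigma}$ as $N\to\infty$. *)

theory Defs
  imports "HOL-Probability.Probability"
begin

text \<open>
  A finite linearly ordered index type \<open>'k\<close> plays the role of the ordered index set
  $\{1,\dots,k\}$, with $k$ = \<open>CARD('k)\<close>. The indices 1, k and i - 1 are the following.
\<close>

definition first_ix :: "'k::{finite,linorder}" where
  "first_ix = Min UNIV"

definition last_ix :: "'k::{finite,linorder}" where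
  "last_ix = Max UNIV"

definition pred_ix :: "'k::{finite,linorder} \<Rightarrow> 'k" where
  "pred_ix i = Max {j. j < i}"

definition delta :: "real ^ 'k::{finite,linorder} \<Rightarrow> real ^ 'k::{finite,linorder}" where
  "delta x = (\<chi> i. if i = first_ix then x $ i else x $ i - x $ pred_ix i)"

definition pos_orthant :: "(real ^ 'd) set" where
  "pos_orthant = {x. \<forall>i. 0 < x $ i}"


subsection \<open>The two families of distributions\<close>

definition mgamma_density :: "real ^ 'k::{finite,linorder} \<Rightarrow> real \<Rightarrow> real ^ 'k::{finite,linorder} \<Rightarrow> real" where
  "mgamma_density \<alpha> \<beta> x =
     (if (\<forall>i. 0 < x $ i) \<and> (\<forall>i j. i < j \<longrightarrow> x $ i < x $ j)
      then 1 / (\<beta> powr (\<Sum>i\<in>UNIV. \<alpha> $ i) * (\<Prod>i\<in>UNIV. Gamma (\<alpha> $ i)))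
           * exp (- (x $ last_ix) / \<beta>) * x $ first_ix powr (\<alpha> $ first_ix - 1)
           * (\<Prod>i\<in>UNIV - {first_ix}. (x $ i - x $ pred_ix i) powr (\<alpha> $ i - 1))
      else 0)"

definition mgamma :: "real ^ 'k::{finite,linorder} \<Rightarrow> real \<Rightarrow> (real ^ 'k::{finite,linorder}) measure" where
  "mgamma \<alpha> \<beta> = density lborel (\<lambda>x. ennreal (mgamma_density \<alpha> \<beta> x))"

definition dirichlet_density :: "real ^ 'k::{finite,linorder} \<Rightarrow> real ^ 'k::{finite,linorder} \<Rightarrow> real" where
  "dirichlet_density \<alpha> w =
     (if (\<forall>i. 0 < w $ i \<and> w $ i < 1) \<and> (\<Sum>i\<in>UNIV. w $ i) = 1
      then Gamma (\<Sum>i\<in>UNIV. \<alpha> $ i) / (\<Prod>i\<in>UNIV. Gamma (\<alpha> $ i))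
           * (\<Prod>i\<in>UNIV. w $ i powr (\<alpha> $ i - 1))
      else 0)"

text \<open>
  The density of the Dirichlet distribution is taken with respect to Lebesgue measure in the
  first k - 1 coordinates; the last coordinate is then determined by the sum being 1.
\<close>

definition complete_coords :: "('k::{finite,linorder} \<Rightarrow> real) \<Rightarrow> real ^ 'k::{finite,linorder}" where
  "complete_coords u = (\<chi> i. if i = last_ix then 1 - (\<Sum>j\<in>{..<last_ix}. u j) else u i)"

definition dirichlet :: "real ^ 'k::{finite,linorder} \<Rightarrow> (real ^ 'k::{finite,linorder}) measure" where
  "dirichlet \<alpha> =
     distr (density (PiM {..<last_ix} (\<lambda>_. lborel))
                    (\<lambda>u. ennreal (dirichlet_density \<alpha> (complete_coords u))))
           borel complete_coords"

text \<open>
  A point $(\alpha,\beta)$ of $\mathbb{R}^{k+1}$ is a vector indexed by the sum type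
  \<open>'k + 1\<close>, whose second summand is the one-element type \<open>1\<close>.
\<close>

definition snoc_vec :: "real ^ 'k \<Rightarrow> real \<Rightarrow> real ^ ('k + 1)" where
  "snoc_vec a b = (\<chi> i. case i of Inl j \<Rightarrow> a $ j | Inr _ \<Rightarrow> b)"

definition mgamma_family :: "real ^ ('k::{finite,linorder} + 1) \<Rightarrow> (real ^ 'k::{finite,linorder}) measure" where
  "mgamma_family \<theta> = mgamma (\<chi> i. \<theta> $ Inl i) (\<theta> $ Inr 1)"


subsection \<open>Samples and moment-type estimators\<close>

definition random_sample :: "'w measure \<Rightarrow> (nat \<Rightarrow> 'w \<Rightarrow> real ^ 'k) \<Rightarrow> (real ^ 'k) measure \<Rightarrow> bool" where
  "random_sample M X D \<longleftrightarrow>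
     prob_space M \<and> prob_space.indep_vars M (\<lambda>_. borel) X {1..} \<and>
     (\<forall>n\<ge>1. distr M borel (X n) = D)"

definition sample_mean :: "nat \<Rightarrow> (nat \<Rightarrow> 'v::real_vector) \<Rightarrow> 'v" where
  "sample_mean N y = (1 / real N) *\<^sub>R (\<Sum>n=1..N. y n)"

definition moment_map ::
  "('p \<Rightarrow> (real ^ 'k) measure) \<Rightarrow> (real ^ 'k \<Rightarrow> real ^ 'm) \<Rightarrow> 'p \<Rightarrow> real ^ 'm" where
  "moment_map P h \<theta> = (\<integral>x. h x \<partial>P \<theta>)"

definition cov_matrix :: "(real ^ 'k) measure \<Rightarrow> (real ^ 'k \<Rightarrow> real ^ 'm) \<Rightarrow> real ^ 'm ^ 'm" where
  "cov_matrix D h =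
     (\<chi> i j. \<integral>x. (h x $ i - (\<integral>y. h y $ i \<partial>D)) * (h x $ j - (\<integral>y. h y $ j \<partial>D)) \<partial>D)"

text \<open>
  \<open>h\<close> is a total Borel function; only its restriction to the support of the family matters,
  since the support is a Borel set of full measure. Measurability of \<open>h\<close> and \<open>g\<close> is the usual
  implicit requirement that a statistic be a random variable. The estimator with value \<open>T N\<close>
  at sample size \<open>N\<close> exists at those outcomes where this value lies in \<open>\<Theta>\<close>.
\<close>

definition moment_type_estimator ::
  "(real ^ 'd) set \<Rightarrow> (real ^ 'd \<Rightarrow> (real ^ 'k) measure) \<Rightarrow>
   (real ^ 'k \<Rightarrow> real ^ 'm) \<Rightarrow> (real ^ 'm \<Rightarrow> real ^ 'd) \<Rightarrow>
   (nat \<Rightarrow> 'w \<Rightarrow> real ^ 'k) \<Rightarrow> (nat \<Rightarrow> 'w \<Rightarrow> real ^ 'd) \<Rightarrow> bool" where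
  "moment_type_estimator \<Theta> P h g X T \<longleftrightarrow>
     h \<in> borel_measurable borel \<and> g \<in> borel_measurable borel \<and>
     (\<forall>\<theta>\<in>\<Theta>. integrable (P \<theta>) h) \<and>
     inj_on (moment_map P h) \<Theta> \<and>
     (\<forall>\<theta>\<in>\<Theta>. g (moment_map P h \<theta>) = \<theta>) \<and>
     (\<forall>N \<omega>. T N \<omega> = g (sample_mean N (\<lambda>n. h (X n \<omega>))))"


subsection \<open>Asymptotic variance-covariance matrix\<close>

definition normal_law :: "real \<Rightarrow> real \<Rightarrow> real measure" where
  "normal_law \<mu> \<sigma> =
     (if \<sigma> = 0 then return borel \<mu> else density lborel (\<lambda>x. ennreal (normal_density \<mu> \<sigma> x)))"

text \<open>
  Possibly degenerate multivariate normal law: every linear functional is normal, where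
  Dirac measures count as normal laws of variance 0.
\<close>

definition centered_normal :: "(real ^ 'd) measure \<Rightarrow> real ^ 'd ^ 'd \<Rightarrow> bool" where
  "centered_normal L \<Sigma> \<longleftrightarrow>
     prob_space L \<and> sets L = sets borel \<and>
     (\<forall>t. \<exists>\<mu> \<sigma>. 0 \<le> \<sigma> \<and> distr L borel (\<lambda>x. t \<bullet> x) = normal_law \<mu> \<sigma>) \<and>
     (\<integral>x. x \<partial>L) = 0 \<and> cov_matrix L (\<lambda>x. x) = \<Sigma>"

definition converges_in_law ::
  "'w measure \<Rightarrow> (nat \<Rightarrow> 'w \<Rightarrow> real ^ 'd) \<Rightarrow> (real ^ 'd) measure \<Rightarrow> bool" where
  "converges_in_law M Y L \<longleftrightarrow>
     (\<forall>N. Y N \<in> borel_measurable M) \<and>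
     (\<forall>f :: real ^ 'd \<Rightarrow> real. continuous_on UNIV f \<and> bounded (range f) \<longrightarrow>
        (\<lambda>N. \<integral>\<omega>. f (Y N \<omega>) \<partial>M) \<longlonglongrightarrow> (\<integral>x. f x \<partial>L))"

definition has_asymptotic_cov ::
  "'w measure \<Rightarrow> (real ^ 'd) set \<Rightarrow> (nat \<Rightarrow> 'w \<Rightarrow> real ^ 'd) \<Rightarrow> real ^ 'd \<Rightarrow> real ^ 'd ^ 'd \<Rightarrow> bool" where
  "has_asymptotic_cov M \<Theta> T \<theta> \<Sigma> \<longleftrightarrow>
     (\<lambda>N. measure M {\<omega> \<in> space M. T N \<omega> \<in> \<Theta>}) \<longlonglongrightarrow> 1 \<and>
     (\<exists>L. centered_normal L \<Sigma> \<and>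
          converges_in_law M (\<lambda>N \<omega>. sqrt (real N) *\<^sub>R (T N \<omega> - \<theta>)) L)"


subsection \<open>Differentiability and block matrices\<close>

definition continuously_differentiable_at :: "(real ^ 'm \<Rightarrow> real ^ 'd) \<Rightarrow> real ^ 'm \<Rightarrow> bool" where
  "continuously_differentiable_at g y \<longleftrightarrow>
     (\<exists>U. open U \<and> y \<in> U \<and> (\<forall>x\<in>U. g differentiable (at x))) \<and>
     isCont (\<lambda>x. jacobian g (at x)) y"

definition block_matrix ::
  "real ^ 'a ^ 'c \<Rightarrow> real ^ 'b ^ 'c \<Rightarrow> real ^ 'a ^ 'd \<Rightarrow> real ^ 'b ^ 'd \<Rightarrow>
   real ^ ('a + 'b) ^ ('c + 'd)" where
  "block_matrix A B C D =
     (\<chi> i j. case i of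
        Inl p \<Rightarrow> (case j of Inl q \<Rightarrow> A $ p $ q | Inr q \<Rightarrow> B $ p $ q)
      | Inr p \<Rightarrow> (case j of Inl q \<Rightarrow> C $ p $ q | Inr q \<Rightarrow> D $ p $ q))"

end

theory Submission
  imports Defs
begin

text \<open>
  Two facts make the theorem true.

  The first is the beta-gamma algebra. Under the multivariate Gamma law the increments
  \<open>delta X\<close> are independent gamma variables with shapes \<open>\<alpha> $ i\<close> and common scale \<open>\<beta>\<close>, because the
  density is a product of gamma densities in the increments (\<open>mgamma_density_eq_prod\<close>) and the
  increment map preserves Lebesgue measure (\<open>nn_integral_lborel_delta\<close>). In the coordinates
  \<open>(w, s)\<close> = (proportions, total) this product factorizes into the Dirichlet density of \<open>w\<close> and
  the gamma density of \<open>s\<close> with shape \<open>\<alpha>\<^sub>0\<close> (\<open>nn_integral_mgamma_proportions_total\<close>). So the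
  total is independent of the proportions, and the augmented statistic
  \<open>h x = (h\<^sub>D (proportions x), x $ last_ix)\<close> has mean \<open>(e, \<alpha>\<^sub>0 * \<beta>)\<close>, where \<open>e\<close> is the Dirichlet
  mean of \<open>h\<^sub>D\<close>, and the block diagonal covariance matrix \<open>V\<close> (\<open>augmented_statistic_cov\<close>). The
  mean is inverted by \<open>g (y, z) = (g\<^sub>D y, z / sum of the coordinates of g\<^sub>D y)\<close>, and applying
  this \<open>g\<close> to the sample mean of \<open>h\<close> gives exactly the estimator in question; the quotient rule
  yields its Jacobian matrix \<open>G\<close> (\<open>augmented_inverse_has_derivative\<close>).

  The second is the multivariate delta method (\<open>delta_method\<close>), which turns a moment-type
  estimator with square integrable statistic and differentiable inverse into an asymptotically
  normal one with covariance matrix \<open>G ** V ** transpose G\<close>. The one-dimensional central limit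
  theorem gives the limit of the expectation of \<open>cos (t \<bullet> Y N + b)\<close> for every \<open>t\<close> and \<open>b\<close>, and
  second moments give tightness. These two properties imply convergence in law
  (\<open>converges_in_lawI\<close>): a bounded continuous function is uniformly close, on any given ball, to
  a trigonometric polynomial whose bound on the whole space is hardly larger
  (\<open>trig_polynomial_approximation\<close>). The limit law itself is a linear image of independent
  standard normal variables, obtained from a factorization \<open>B ** transpose B\<close> of the covariance
  matrix (\<open>positive_semidefinite_gram\<close>).
\<close>

section \<open>Gamma laws and Lebesgue measure in several coordinates\<close>

definition gamma_density :: "real \<Rightarrow> real \<Rightarrow> real \<Rightarrow> real" where
  "gamma_density a b t = (if 0 < t then t powr (a - 1) * exp (- t / b) / (b powr a * Gamma a) else 0)"

lemma gamma_density_nonneg: "a > 0 \<Longrightarrow> 0 \<le> gamma_density a b t"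
  by (auto simp: gamma_density_def intro!: divide_nonneg_nonneg mult_nonneg_nonneg Gamma_real_nonneg)

lemma gamma_density_measurable [measurable]: "gamma_density a b \<in> borel_measurable borel"
  unfolding gamma_density_def by measurable

lemma nn_integral_gamma_density:
  assumes "a > 0" "b > 0"
  shows "(\<integral>\<^sup>+t. ennreal (gamma_density a b t) \<partial>lborel) = 1"
proof -
  have G: "Gamma a > 0" using assms by (simp add: Gamma_real_pos)
  have *: "gamma_density a b (b * t) = (1 / (b * Gamma a)) * (indicator {0..} t * t powr (a - 1) / exp t)" for t
  proof (cases "t > 0")
    case True
    then show ?thesis using assms G
      by (simp add: gamma_density_def powr_mult powr_diff exp_minus field_simps)
  next
    case False
    then show ?thesis using assms
      by (cases "t = 0") (auto simp: gamma_density_def zero_less_mult_iff)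
  qed
  have "(\<integral>\<^sup>+t. ennreal (gamma_density a b t) \<partial>lborel)
      = ennreal b * (\<integral>\<^sup>+t. ennreal (gamma_density a b (b * t)) \<partial>lborel)"
    using assms by (subst nn_integral_real_affine[where c = b and t = 0]) auto
  also have "(\<integral>\<^sup>+t. ennreal (gamma_density a b (b * t)) \<partial>lborel)
      = ennreal (1 / (b * Gamma a)) * ennreal (Gamma a)"
    unfolding * using assms G
    by (subst ennreal_mult) (auto simp: nn_integral_cmult Gamma_conv_nn_integral_real)
  also have "ennreal b * \<dots> = 1"
    using assms less_imp_neq[OF G, symmetric]
    by (simp add: ennreal_mult[symmetric] ennreal_1[symmetric] del: ennreal_1)
  finally show ?thesis .
qed

text \<open>
  Multiplication by the variable raises the shape by one, so the moments of a gamma law are multiples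
  of the total masses of gamma laws of larger shape.
\<close>

lemma mult_gamma_density:
  assumes "a > 0" "b > 0"
  shows "t * gamma_density a b t = a * b * gamma_density (a + 1) b t"
proof (cases "t > 0")
  case True
  moreover have "Gamma (a + 1) = a * Gamma a"
    using assms by (intro Gamma_plus1) (auto simp: nonpos_Ints_def)
  ultimately show ?thesis using assms Gamma_real_pos[of a]
    by (simp add: gamma_density_def powr_diff powr_add field_simps)
qed (auto simp: gamma_density_def)

definition gamma_law :: "real \<Rightarrow> real \<Rightarrow> real measure" where
  "gamma_law a b = density lborel (\<lambda>t. ennreal (gamma_density a b t))"

lemma prob_space_gamma_law: "a > 0 \<Longrightarrow> b > 0 \<Longrightarrow> prob_space (gamma_law a b)"
  by (intro prob_spaceI) (simp add: gamma_law_def emeasure_density nn_integral_gamma_density)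

lemma integral_gamma_density:
  assumes "a > 0" "b > 0"
  shows "integrable lborel (gamma_density a b)" "(\<integral>t. gamma_density a b t \<partial>lborel) = 1"
  using nn_integral_gamma_density[OF assms] assms
  by (auto simp: integrable_iff_bounded gamma_density_nonneg integral_eq_nn_integral)

lemma gamma_law_moments:
  assumes "a > 0" "b > 0"
  shows "integrable (gamma_law a b) (\<lambda>t. t)" "(\<integral>t. t \<partial>gamma_law a b) = a * b"
    and "integrable (gamma_law a b) (\<lambda>t. t\<^sup>2)" "(\<integral>t. t\<^sup>2 \<partial>gamma_law a b) = a * (a + 1) * b\<^sup>2"
proof -
  have 1: "gamma_density a b t * t = a * b * gamma_density (a + 1) b t" for t
    using mult_gamma_density[OF assms, of t] by (simp add: mult.commute)
  have 2: "gamma_density a b t * t\<^sup>2 = a * (a + 1) * b\<^sup>2 * gamma_density (a + 2) b t" for t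
  proof -
    have "gamma_density a b t * t\<^sup>2 = (gamma_density a b t * t) * t"
      by (simp add: power2_eq_square)
    also have "\<dots> = a * b * (t * gamma_density (a + 1) b t)"
      unfolding 1 by (simp add: mult_ac)
    also have "t * gamma_density (a + 1) b t = (a + 1) * b * gamma_density (a + 2) b t"
      using mult_gamma_density[of "a + 1" b t] assms by (simp add: add.assoc)
    finally show ?thesis by (simp add: power2_eq_square mult_ac)
  qed
  note I = integral_gamma_density
  show "integrable (gamma_law a b) (\<lambda>t. t)" "(\<integral>t. t \<partial>gamma_law a b) = a * b"
    using assms I[of "a + 1" b]
    by (simp_all add: gamma_law_def integrable_density integral_density gamma_density_nonneg 1)
  show "integrable (gamma_law a b) (\<lambda>t. t\<^sup>2)" "(\<integral>t. t\<^sup>2 \<partial>gamma_law a b) = a * (a + 1) * b\<^sup>2"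
    using assms I[of "a + 2" b]
    by (simp_all add: gamma_law_def integrable_density integral_density gamma_density_nonneg 2)
qed

lemma measurable_vec_nth [measurable (raw)]:
  fixes f :: "'a \<Rightarrow> real ^ 'n"
  assumes "f \<in> borel_measurable M"
  shows "(\<lambda>x. f x $ i) \<in> borel_measurable M"
  using measurable_compose[OF assms, of "\<lambda>x. x $ i" borel]
  by (simp add: borel_measurable_continuous_onI continuous_on_component)

lemma measurable_vec_lambda:
  fixes f :: "'n::finite \<Rightarrow> 'a \<Rightarrow> real"
  assumes "\<And>i. f i \<in> borel_measurable M"
  shows "(\<lambda>x. \<chi> i. f i x) \<in> borel_measurable M"
  using assms by (subst borel_measurable_euclidean_space) (auto simp: Basis_vec_def inner_axis)

lemma measurable_vec_of_PiM [measurable]: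
  "(\<lambda>f. \<chi> i. f i) \<in> borel_measurable (PiM (UNIV :: 'n::finite set) (\<lambda>_. lborel :: real measure))"
  by (rule measurable_vec_lambda) simp

lemma lborel_vec_eq_PiM:
  "(lborel :: (real ^ 'n) measure) = distr (PiM (UNIV :: 'n set) (\<lambda>_. lborel)) borel (\<lambda>f. \<chi> i. f i)"
proof (rule lborel_eqI)
  interpret product_sigma_finite "\<lambda>_::'n. lborel :: real measure" ..
  fix l u :: "real ^ 'n"
  assume lu: "\<And>b. b \<in> Basis \<Longrightarrow> l \<bullet> b \<le> u \<bullet> b"
  then have lu': "l $ i \<le> u $ i" for i
    by (metis axis_in_Basis_iff inner_axis real_inner_1_right inner_commute Basis_real_def singletonI)
  have *: "(\<lambda>f. \<chi> i. f i) -` box l u \<inter> space (PiM (UNIV :: 'n set) (\<lambda>_. lborel)) = (\<Pi>\<^sub>E i\<in>UNIV. {l $ i <..< u $ i})"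
    by (auto simp: space_PiM mem_box_cart PiE_iff)
  have "emeasure (distr (PiM (UNIV :: 'n set) (\<lambda>_. lborel)) borel (\<lambda>f. \<chi> i. f i)) (box l u) = (\<Prod>i\<in>UNIV. ennreal (u $ i - l $ i))"
    by (simp add: emeasure_distr * emeasure_PiM lu')
  also have "\<dots> = (\<Prod>i\<in>UNIV. ennreal ((u - l) \<bullet> axis i 1))"
    by (simp add: inner_axis)
  also have "\<dots> = (\<Prod>b\<in>Basis. ennreal ((u - l) \<bullet> b))"
  proof -
    have B: "(Basis :: (real ^ 'n) set) = range (\<lambda>i. axis i 1)" by (auto simp: Basis_vec_def)
    show ?thesis unfolding B
      by (subst prod.reindex) (auto simp: inj_on_def axis_eq_axis)
  qed
  also have "\<dots> = ennreal (\<Prod>b\<in>Basis. (u - l) \<bullet> b)"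
    using lu by (intro prod_ennreal) (simp add: inner_diff_left)
  finally show "emeasure (distr (PiM (UNIV :: 'n set) (\<lambda>_. lborel)) borel (\<lambda>f. \<chi> i. f i)) (box l u) = (\<Prod>b\<in>Basis. (u - l) \<bullet> b)" .
qed simp

lemma nn_integral_lborel_vec:
  assumes [measurable]: "f \<in> borel_measurable (borel :: (real ^ 'n) measure)"
  shows "(\<integral>\<^sup>+x. f x \<partial>lborel) = (\<integral>\<^sup>+y. f (\<chi> i. y i) \<partial>PiM (UNIV :: 'n set) (\<lambda>_. lborel))"
  by (subst lborel_vec_eq_PiM) (simp add: nn_integral_distr)

text \<open>
  While the coordinate \<open>i\<close> alone is integrated, the shift \<open>c x\<close> stays constant, so Tonelli's
  theorem reduces the claim to translation invariance of one-dimensional Lebesgue measure.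
\<close>

lemma nn_integral_PiM_shear:
  fixes f :: "('i \<Rightarrow> real) \<Rightarrow> ennreal" and c :: "('i \<Rightarrow> real) \<Rightarrow> real"
  assumes fin: "finite J" and i: "i \<in> J"
    and f [measurable]: "f \<in> borel_measurable (PiM J (\<lambda>_. lborel))"
    and c [measurable]: "c \<in> borel_measurable (PiM J (\<lambda>_. lborel))"
    and ci: "\<And>x y. c (x(i := y)) = c x"
  shows "(\<integral>\<^sup>+x. f x \<partial>PiM J (\<lambda>_. lborel)) = (\<integral>\<^sup>+x. f (x(i := x i + c x)) \<partial>PiM J (\<lambda>_. lborel))"
proof -
  interpret product_sigma_finite "\<lambda>_::'i. lborel :: real measure" ..
  let ?K = "J - {i}"
  have J: "insert i ?K = J" using i by auto
  have fK: "finite ?K" "i \<notin> ?K" using fin by auto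
  have upd: "(\<lambda>x. x(i := x i + c x)) \<in> measurable (PiM J (\<lambda>_. lborel)) (PiM J (\<lambda>_. lborel :: real measure))"
  proof (rule measurable_PiM_single')
    fix j assume j: "j \<in> J"
    have "(\<lambda>x. (x(i := x i + c x)) j) = (if j = i then \<lambda>x. x i + c x else (\<lambda>x. x j))"
      by (auto simp: fun_eq_iff)
    then show "(\<lambda>x. (x(i := x i + c x)) j) \<in> PiM J (\<lambda>_. lborel) \<rightarrow>\<^sub>M lborel"
      using j i by (auto intro!: borel_measurable_add c)
  next
    show "(\<lambda>x. x(i := x i + c x)) \<in> space (PiM J (\<lambda>_. lborel)) \<rightarrow> (\<Pi>\<^sub>E j\<in>J. space lborel)"
      using i by (auto simp: space_PiM PiE_iff extensional_def)
  qed
  have f2: "(\<lambda>x. f (x(i := x i + c x))) \<in> borel_measurable (PiM J (\<lambda>_. lborel))"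
    using measurable_compose[OF upd f] .
  have "(\<integral>\<^sup>+x. f (x(i := x i + c x)) \<partial>PiM J (\<lambda>_. lborel))
      = (\<integral>\<^sup>+x. \<integral>\<^sup>+y. f (x(i := y + c x)) \<partial>lborel \<partial>PiM ?K (\<lambda>_. lborel))"
    using product_nn_integral_insert[OF fK, of "\<lambda>x. f (x(i := x i + c x))", unfolded J, OF f2]
    by (simp add: ci)
  also have "\<dots> = (\<integral>\<^sup>+x. \<integral>\<^sup>+y. f (x(i := y)) \<partial>lborel \<partial>PiM ?K (\<lambda>_. lborel))"
  proof (rule nn_integral_cong)
    fix x assume x: "x \<in> space (PiM ?K (\<lambda>_. lborel :: real measure))"
    have "(\<lambda>y. x(i := y)) \<in> measurable borel (PiM J (\<lambda>_. lborel :: real measure))"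
      using measurable_component_update[OF x fK(2)] J by simp
    from measurable_compose[OF this f]
    have "(\<lambda>y. f (x(i := y))) \<in> borel_measurable borel" .
    from nn_integral_real_affine[OF this, of 1 "c x"]
    show "(\<integral>\<^sup>+y. f (x(i := y + c x)) \<partial>lborel) = (\<integral>\<^sup>+y. f (x(i := y)) \<partial>lborel)"
      by (simp add: add.commute)
  qed
  also have "\<dots> = (\<integral>\<^sup>+x. f x \<partial>PiM J (\<lambda>_. lborel))"
    using product_nn_integral_insert[OF fK, of f, unfolded J, OF f] by simp
  finally show ?thesis ..
qed

lemma nn_integral_PiM_scale:
  fixes f :: "('i \<Rightarrow> real) \<Rightarrow> ennreal"
  assumes fin: "finite I" and s: "s > 0"
    and f [measurable]: "f \<in> borel_measurable (PiM I (\<lambda>_. lborel))"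
  shows "(\<integral>\<^sup>+x. f x \<partial>PiM I (\<lambda>_. lborel))
       = ennreal (s ^ card I) * (\<integral>\<^sup>+x. f (\<lambda>i\<in>I. s * x i) \<partial>PiM I (\<lambda>_. lborel))"
proof -
  interpret product_sigma_finite "\<lambda>_::'i. lborel :: real measure" ..
  interpret finite_product_sigma_finite "\<lambda>_::'i. lborel :: real measure" I by standard fact
  let ?P = "PiM I (\<lambda>_. lborel :: real measure)"
  let ?S = "\<lambda>x. \<lambda>i\<in>I. s * x i"
  have [measurable]: "?S \<in> measurable ?P ?P"
    by (rule measurable_restrict) auto
  have "density (distr ?P ?P ?S) (\<lambda>_. ennreal (s ^ card I)) = ?P"
  proof (rule PiM_eqI)
    fix A :: "'i \<Rightarrow> real set" assume A: "\<And>i. i \<in> I \<Longrightarrow> A i \<in> sets lborel"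
    have A': "A i \<in> sets borel" if "i \<in> I" for i using A[OF that] by simp
    have [measurable]: "Pi\<^sub>E I A \<in> sets ?P" using A by (intro sets_PiM_I_finite fin) auto
    have m: "(\<lambda>t. s * t) -` A i \<in> sets borel" if "i \<in> I" for i
      using measurable_sets[of "\<lambda>t. s * t" borel borel "A i"] A'[OF that] by simp
    have pre: "?S -` Pi\<^sub>E I A \<inter> space ?P = (\<Pi>\<^sub>E i\<in>I. (\<lambda>t. s * t) -` A i)"
      by (auto simp: space_PiM PiE_iff extensional_def)
    have one: "emeasure lborel (A i) = ennreal s * emeasure lborel ((\<lambda>t. s * t) -` A i)" if "i \<in> I" for i
      using nn_integral_real_affine[of "indicator (A i)" s 0] A'[OF that] m[OF that] s
      by (simp add: indicator_vimage[symmetric] o_def nn_integral_indicator flip: vimage_def)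
    have "emeasure (density (distr ?P ?P ?S) (\<lambda>_. ennreal (s ^ card I))) (Pi\<^sub>E I A)
        = ennreal (s ^ card I) * emeasure (distr ?P ?P ?S) (Pi\<^sub>E I A)"
      by (simp add: emeasure_density_const)
    also have "\<dots> = ennreal (s ^ card I) * (\<Prod>i\<in>I. emeasure lborel ((\<lambda>t. s * t) -` A i))"
      using m by (simp add: emeasure_distr pre emeasure_PiM fin)
    also have "\<dots> = (\<Prod>i\<in>I. emeasure lborel (A i))"
      using s by (simp add: one prod.distrib ennreal_power)
    finally show "emeasure (density (distr ?P ?P ?S) (\<lambda>_. ennreal (s ^ card I))) (Pi\<^sub>E I A)
      = (\<Prod>i\<in>I. emeasure lborel (A i))" .
  qed (use fin in auto)
  then have "(\<integral>\<^sup>+x. f x \<partial>?P) = (\<integral>\<^sup>+x. f x \<partial>density (distr ?P ?P ?S) (\<lambda>_. ennreal (s ^ card I)))"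
    by simp
  also have "\<dots> = ennreal (s ^ card I) * (\<integral>\<^sup>+x. f (?S x) \<partial>?P)"
    by (simp add: nn_integral_density nn_integral_cmult nn_integral_distr)
  finally show ?thesis .
qed

section \<open>Increments of a multivariate Gamma vector\<close>

lemma first_ix_le [simp]: "first_ix \<le> (i :: 'k::{finite,linorder})"
  by (simp add: first_ix_def)

lemma le_last_ix [simp]: "(i :: 'k::{finite,linorder}) \<le> last_ix"
  by (simp add: last_ix_def)

lemma UNIV_eq_insert_last: "(UNIV :: 'k::{finite,linorder} set) = insert last_ix {..<last_ix}"
  using le_last_ix by (auto simp: le_less)

lemma pred_ix_less:
  assumes "i \<noteq> (first_ix :: 'k::{finite,linorder})"
  shows "pred_ix i < i"
proof -
  have "first_ix \<in> {j. j < i}" using assms first_ix_le[of i] by (auto simp: le_less)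
  then have "Max {j. j < i} \<in> {j. j < i}" by (intro Max_in) auto
  then show ?thesis by (simp add: pred_ix_def)
qed

lemma less_iff_le_pred_ix:
  assumes "i \<noteq> (first_ix :: 'k::{finite,linorder})"
  shows "j < i \<longleftrightarrow> j \<le> pred_ix i"
proof
  show "j \<le> pred_ix i" if "j < i" using that unfolding pred_ix_def by (intro Max_ge) auto
qed (use pred_ix_less[OF assms] in auto)

lemma sum_delta_atMost: "(\<Sum>j\<in>{..i}. delta x $ j) = x $ (i :: 'k::{finite,linorder})"
proof (induction i rule: measure_induct_rule[of "\<lambda>i. card {..<i}"])
  case (less i)
  show ?case
  proof (cases "i = first_ix")
    case True
    have "{..i} = {i}" using True by (auto intro: antisym)
    then show ?thesis using True by (simp add: delta_def)
  next
    case False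
    have "card {..<pred_ix i} < card {..<i}"
      using pred_ix_less[OF False] by (intro psubset_card_mono) auto
    moreover have "{..i} = insert i {..pred_ix i}"
      using less_iff_le_pred_ix[OF False] by (intro set_eqI) (metis atMost_iff insert_iff le_less)
    ultimately show ?thesis using less.IH[of "pred_ix i"] pred_ix_less[OF False] False
      by (simp add: delta_def)
  qed
qed

lemma sum_delta: "(\<Sum>j\<in>UNIV. delta x $ j) = x $ (last_ix :: 'k::{finite,linorder})"
proof -
  have "UNIV = {..last_ix :: 'k}" by auto
  then show ?thesis using sum_delta_atMost[of x last_ix] by simp
qed

lemma delta_pos_iff:
  fixes x :: "real ^ 'k::{finite,linorder}"
  shows "(\<forall>i. 0 < delta x $ i) \<longleftrightarrow> (\<forall>i. 0 < x $ i) \<and> (\<forall>i j. i < j \<longrightarrow> x $ i < x $ j)"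
proof safe
  fix i j :: 'k assume pos: "\<forall>i. 0 < delta x $ i"
  show "0 < x $ i" using pos by (subst sum_delta_atMost[symmetric]) (intro sum_pos, auto)
  assume ij: "i < j"
  have "(\<Sum>l\<in>{..i}. delta x $ l) < (\<Sum>l\<in>{..j}. delta x $ l)"
    using ij pos by (intro sum_strict_mono2[where b = j]) (auto intro: less_imp_le)
  then show "x $ i < x $ j" by (simp add: sum_delta_atMost)
next
  fix i assume "\<forall>i. 0 < x $ i" "\<forall>i j. i < j \<longrightarrow> x $ i < x $ j"
  then show "0 < delta x $ i" using pred_ix_less[of i] by (auto simp: delta_def)
qed

lemma delta_measurable [measurable]: "delta \<in> borel_measurable borel"
  unfolding delta_def by (rule measurable_vec_lambda) measurable

text \<open>
  The increments sum to the last coordinate, so the exponential factor of the density splits over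
  them, and the support is described by the positivity of all increments.
\<close>

lemma mgamma_density_eq_prod:
  fixes \<alpha> :: "real ^ 'k::{finite,linorder}"
  assumes "\<alpha> \<in> pos_orthant" "\<beta> > 0"
  shows "mgamma_density \<alpha> \<beta> x = (\<Prod>i\<in>UNIV. gamma_density (\<alpha> $ i) \<beta> (delta x $ i))"
proof (cases "\<forall>i. 0 < delta x $ i")
  case False
  then obtain i where "\<not> 0 < delta x $ i" by auto
  then have "(\<Prod>i\<in>UNIV. gamma_density (\<alpha> $ i) \<beta> (delta x $ i)) = 0"
    by (intro prod_zero) (auto simp: gamma_density_def)
  then show ?thesis using False unfolding delta_pos_iff mgamma_density_def by auto
next
  case True
  have f: "x $ first_ix = delta x $ first_ix" by (simp add: delta_def)
  have d: "(\<Prod>i\<in>UNIV - {first_ix}. (x $ i - x $ pred_ix i) powr (\<alpha> $ i - 1))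
      = (\<Prod>i\<in>UNIV - {first_ix}. delta x $ i powr (\<alpha> $ i - 1))"
    by (intro prod.cong) (auto simp: delta_def)
  have p: "delta x $ first_ix powr (\<alpha> $ first_ix - 1) * (\<Prod>i\<in>UNIV - {first_ix}. delta x $ i powr (\<alpha> $ i - 1))
      = (\<Prod>i\<in>UNIV. delta x $ i powr (\<alpha> $ i - 1))"
    by (subst prod.remove[of UNIV first_ix]) auto
  have e: "exp (- (x $ last_ix) / \<beta>) = (\<Prod>i\<in>UNIV. exp (- delta x $ i / \<beta>))"
    unfolding sum_delta[symmetric]
    by (simp flip: exp_sum sum_divide_distrib add: sum_negf)
  have b: "\<beta> powr (\<Sum>i\<in>UNIV. \<alpha> $ i) = (\<Prod>i\<in>UNIV. \<beta> powr (\<alpha> $ i))"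
    using assms by (simp add: powr_sum)
  have "mgamma_density \<alpha> \<beta> x = 1 / (\<beta> powr (\<Sum>i\<in>UNIV. \<alpha> $ i) * (\<Prod>i\<in>UNIV. Gamma (\<alpha> $ i)))
           * exp (- (x $ last_ix) / \<beta>) * (x $ first_ix powr (\<alpha> $ first_ix - 1)
           * (\<Prod>i\<in>UNIV - {first_ix}. (x $ i - x $ pred_ix i) powr (\<alpha> $ i - 1)))"
    using True unfolding delta_pos_iff mgamma_density_def by simp
  also have "\<dots> = (\<Prod>i\<in>UNIV. gamma_density (\<alpha> $ i) \<beta> (delta x $ i))"
    using True unfolding d f p e b
    by (simp add: gamma_density_def prod.distrib prod_dividef)
  finally show ?thesis .
qed

text \<open>
  The increment map applied only at the indices in \<open>A\<close>: it interpolates between the identity and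
  \<^const>\<open>delta\<close>, and each further index adds one shear.
\<close>

definition partial_delta :: "'k::{finite,linorder} set \<Rightarrow> ('k \<Rightarrow> real) \<Rightarrow> 'k \<Rightarrow> real" where
  "partial_delta A x = (\<lambda>i. if i \<in> A \<and> i \<noteq> first_ix then x i - x (pred_ix i) else x i)"

text \<open>
  The increment map is a composition of shears. The indices are inserted in decreasing order, so
  each new difference subtracts a coordinate that the earlier shears have left unchanged.
\<close>

lemma nn_integral_lborel_delta:
  fixes f :: "real ^ 'k::{finite,linorder} \<Rightarrow> ennreal"
  assumes [measurable]: "f \<in> borel_measurable borel"
  shows "(\<integral>\<^sup>+x. f (delta x) \<partial>lborel) = (\<integral>\<^sup>+x. f x \<partial>lborel)"
proof -
  let ?P = "PiM UNIV (\<lambda>_::'k. lborel :: real measure)"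
  have partial_delta_measurable [measurable]: "partial_delta A \<in> measurable ?P ?P" for A
  proof (rule measurable_PiM_single')
    fix i :: 'k
    have "(\<lambda>x. partial_delta A x i) = (if i \<in> A \<and> i \<noteq> first_ix then (\<lambda>x. x i - x (pred_ix i)) else (\<lambda>x. x i))"
      by (auto simp: partial_delta_def)
    then show "(\<lambda>x. partial_delta A x i) \<in> ?P \<rightarrow>\<^sub>M lborel" by auto
  qed (auto simp: space_PiM)
  have "(\<integral>\<^sup>+x. F (partial_delta A x) \<partial>?P) = (\<integral>\<^sup>+x. F x \<partial>?P)"
    if "F \<in> borel_measurable ?P" for F and A :: "'k set"
    using finite[of A] that
  proof (induction A arbitrary: F rule: finite_linorder_min_induct)
    case empty
    then show ?case by (simp add: partial_delta_def[abs_def])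
  next
    case (insert b A)
    note insert.prems [measurable]
    show ?case
    proof (cases "b = first_ix")
      case True
      then have "partial_delta (insert b A) = partial_delta A" by (auto simp: partial_delta_def fun_eq_iff)
      then show ?thesis using insert.IH[OF insert.prems] by simp
    next
      case False
      have nA: "b \<notin> A" "pred_ix b \<notin> A" and pb: "pred_ix b \<noteq> b"
        using insert.hyps pred_ix_less[OF False] by auto
      have step: "partial_delta (insert b A) x = (partial_delta A x)(b := partial_delta A x b + - partial_delta A x (pred_ix b))" for x
        using nA pb False by (auto simp: partial_delta_def fun_eq_iff)
      have upd [measurable]: "(\<lambda>x. x(b := x b + - x (pred_ix b))) \<in> measurable ?P ?P"
      proof (rule measurable_PiM_single')
        fix i :: 'k
        have "(\<lambda>x. (x(b := x b + - x (pred_ix b))) i) = (if i = b then (\<lambda>x. x b + - x (pred_ix b)) else (\<lambda>x. x i :: real))"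
          by (auto simp: fun_eq_iff)
        then show "(\<lambda>x. (x(b := x b + - x (pred_ix b))) i) \<in> ?P \<rightarrow>\<^sub>M lborel" by auto
      qed (auto simp: space_PiM)
      have "(\<integral>\<^sup>+x. F (partial_delta (insert b A) x) \<partial>?P) = (\<integral>\<^sup>+x. F (x(b := x b + - x (pred_ix b))) \<partial>?P)"
        unfolding step
        by (rule insert.IH[of "\<lambda>x. F (x(b := x b + - x (pred_ix b)))"]) measurable
      also have "\<dots> = (\<integral>\<^sup>+x. F x \<partial>?P)"
        by (rule nn_integral_PiM_shear[symmetric, where c = "\<lambda>x. - x (pred_ix b)"]) (use pb in auto)
      finally show ?thesis .
    qed
  qed
  from this[of "\<lambda>x. f (\<chi> i. x i)" UNIV]
  have "(\<integral>\<^sup>+x. f (\<chi> i. partial_delta UNIV x i) \<partial>?P) = (\<integral>\<^sup>+x. f (\<chi> i. x i) \<partial>?P)"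
    by simp
  moreover have "delta (\<chi> i. x i) = (\<chi> i. partial_delta UNIV x i)" for x :: "'k \<Rightarrow> real"
    by (simp add: delta_def partial_delta_def vec_eq_iff)
  ultimately show ?thesis
    by (simp add: nn_integral_lborel_vec)
qed

lemma sum_pos_orthant_pos:
  fixes \<alpha> :: "real ^ 'n"
  assumes "\<alpha> \<in> pos_orthant"
  shows "0 < (\<Sum>i\<in>UNIV. \<alpha> $ i)"
  using assms by (intro sum_pos) (auto simp: pos_orthant_def)

section \<open>Joint law of the proportions and the total\<close>

lemma mgamma_density_measurable [measurable]:
  fixes \<alpha> :: "real ^ 'k::{finite,linorder}"
  assumes "\<alpha> \<in> pos_orthant" "\<beta> > 0"
  shows "mgamma_density \<alpha> \<beta> \<in> borel_measurable borel"
  unfolding mgamma_density_eq_prod[OF assms, abs_def] by measurable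

lemma complete_coords_measurable [measurable]:
  "(complete_coords :: _ \<Rightarrow> real ^ 'k::{finite,linorder})
     \<in> borel_measurable (PiM {..<last_ix} (\<lambda>_. lborel :: real measure))"
  unfolding complete_coords_def
proof (rule measurable_vec_lambda)
  fix i :: 'k
  show "(\<lambda>u. if i = last_ix then 1 - (\<Sum>j\<in>{..<last_ix}. u j) else u i)
    \<in> borel_measurable (PiM {..<last_ix} (\<lambda>_. lborel :: real measure))"
  proof (cases "i = last_ix")
    case False
    then have "i \<in> {..<last_ix}" using le_last_ix[of i] by (simp add: le_less)
    then show ?thesis using False by simp
  qed simp
qed

lemma dirichlet_density_measurable [measurable]:
  "dirichlet_density \<alpha> \<in> borel_measurable borel"
  unfolding dirichlet_density_def by measurable

lemma sets_dirichlet [simp, measurable_cong]: "sets (dirichlet \<alpha>) = sets borel"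
  by (simp add: dirichlet_def)

lemma space_dirichlet [simp]: "space (dirichlet \<alpha>) = UNIV"
  by (simp add: dirichlet_def)

lemma sets_mgamma [simp, measurable_cong]: "sets (mgamma \<alpha> \<beta>) = sets borel"
  by (simp add: mgamma_def)

lemma space_mgamma [simp]: "space (mgamma \<alpha> \<beta>) = UNIV"
  by (simp add: mgamma_def)

lemma nn_integral_dirichlet:
  fixes f :: "real ^ 'k::{finite,linorder} \<Rightarrow> ennreal"
  assumes [measurable]: "f \<in> borel_measurable borel"
  shows "(\<integral>\<^sup>+w. f w \<partial>dirichlet \<alpha>) = (\<integral>\<^sup>+u. ennreal (dirichlet_density \<alpha> (complete_coords u)) * f (complete_coords u)
            \<partial>PiM {..<last_ix} (\<lambda>_. lborel))"
  by (simp add: dirichlet_def nn_integral_distr nn_integral_density)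

lemma nn_integral_mgamma_delta:
  fixes f :: "real ^ 'k::{finite,linorder} \<Rightarrow> ennreal"
  assumes \<alpha>: "\<alpha> \<in> pos_orthant" and \<beta>: "\<beta> > 0" and [measurable]: "f \<in> borel_measurable borel"
  shows "(\<integral>\<^sup>+x. f (delta x) \<partial>mgamma \<alpha> \<beta>)
       = (\<integral>\<^sup>+y. ennreal (\<Prod>i\<in>UNIV. gamma_density (\<alpha> $ i) \<beta> (y $ i)) * f y \<partial>lborel)"
proof -
  note mgamma_density_measurable[OF \<alpha> \<beta>, measurable]
  have "(\<integral>\<^sup>+x. f (delta x) \<partial>mgamma \<alpha> \<beta>) = (\<integral>\<^sup>+x. ennreal (mgamma_density \<alpha> \<beta> x) * f (delta x) \<partial>lborel)"
    by (simp add: mgamma_def nn_integral_density)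
  also have "\<dots> = (\<integral>\<^sup>+y. ennreal (\<Prod>i\<in>UNIV. gamma_density (\<alpha> $ i) \<beta> (y $ i)) * f y \<partial>lborel)"
    unfolding mgamma_density_eq_prod[OF \<alpha> \<beta>]
    by (rule nn_integral_lborel_delta[of "\<lambda>y. ennreal (\<Prod>i\<in>UNIV. gamma_density (\<alpha> $ i) \<beta> (y $ i)) * f y"]) measurable
  finally show ?thesis .
qed

lemma prob_space_mgamma:
  fixes \<alpha> :: "real ^ 'k::{finite,linorder}"
  assumes \<alpha>: "\<alpha> \<in> pos_orthant" and \<beta>: "\<beta> > 0"
  shows "prob_space (mgamma \<alpha> \<beta>)"
proof (rule prob_spaceI)
  interpret product_sigma_finite "\<lambda>_::'k. lborel :: real measure" ..
  have pos: "\<alpha> $ i > 0" for i using \<alpha> by (simp add: pos_orthant_def)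
  have "emeasure (mgamma \<alpha> \<beta>) (space (mgamma \<alpha> \<beta>)) = (\<integral>\<^sup>+x. 1 \<partial>mgamma \<alpha> \<beta>)"
    by simp
  also have "\<dots> = (\<integral>\<^sup>+y. ennreal (\<Prod>i\<in>UNIV. gamma_density (\<alpha> $ i) \<beta> (y $ i)) \<partial>lborel)"
    using nn_integral_mgamma_delta[OF \<alpha> \<beta>, of "\<lambda>_. 1"] by simp
  also have "\<dots> = (\<integral>\<^sup>+y. (\<Prod>i\<in>UNIV. ennreal (gamma_density (\<alpha> $ i) \<beta> (y i))) \<partial>PiM UNIV (\<lambda>_. lborel))"
    by (subst nn_integral_lborel_vec) (simp_all add: prod_ennreal gamma_density_nonneg pos)
  also have "\<dots> = 1"
    by (subst product_nn_integral_prod) (simp_all add: nn_integral_gamma_density pos \<beta>)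
  finally show "emeasure (mgamma \<alpha> \<beta>) (space (mgamma \<alpha> \<beta>)) = 1" .
qed

text \<open>
  The left-hand side is the joint density of the increments at \<open>s *\<^sub>R w\<close>, multiplied by the Jacobian
  of \<open>u \<mapsto> s *\<^sub>R u\<close> in the first \<open>CARD('k) - 1\<close> coordinates. The powers of \<open>s\<close> collect to the one in
  the gamma density of the total, and the exponential depends on \<open>w\<close> only through its sum 1. That no
  term involves both variables is the reason for the independence of proportions and total.
\<close>

lemma gamma_product_factorization:
  fixes \<alpha> w :: "real ^ 'k::{finite,linorder}"
  assumes card: "CARD('k) \<ge> 2" and \<alpha>: "\<alpha> \<in> pos_orthant" and \<beta>: "\<beta> > 0"
    and s: "s > 0" and w: "(\<Sum>i\<in>UNIV. w $ i) = 1"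
  shows "s ^ (CARD('k) - 1) * (\<Prod>i\<in>UNIV. gamma_density (\<alpha> $ i) \<beta> (s * w $ i))
       = gamma_density (\<Sum>i\<in>UNIV. \<alpha> $ i) \<beta> s * dirichlet_density \<alpha> w"
proof (cases "\<forall>i. 0 < w $ i")
  case False
  then obtain i where "\<not> 0 < w $ i" by auto
  then have "(\<Prod>i\<in>UNIV. gamma_density (\<alpha> $ i) \<beta> (s * w $ i)) = 0"
    using s by (intro prod_zero bexI[of _ i]) (auto simp: gamma_density_def zero_less_mult_iff)
  then show ?thesis using False by (auto simp: dirichlet_density_def)
next
  case True
  let ?a = "\<Sum>i\<in>UNIV. \<alpha> $ i"
  have a: "?a > 0" by (rule sum_pos_orthant_pos[OF \<alpha>])
  (* With a single index the only point of the simplex would be w = 1, which lies outside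
     the support of the Dirichlet density; a second index leaves room below 1. *)
  have lt1: "w $ i < 1" for i
  proof -
    have "UNIV - {i} \<noteq> {}"
    proof
      assume "UNIV - {i} = {}"
      then have "(UNIV :: 'k set) = {i}" by auto
      then have "CARD('k) = 1" by (metis card_1_singleton_iff One_nat_def)
      then show False using card by simp
    qed
    then have "(\<Sum>j\<in>UNIV - {i}. w $ j) > 0" using True by (intro sum_pos) auto
    then show ?thesis using w by (simp add: sum.remove[of UNIV i])
  qed
  have sw: "gamma_density (\<alpha> $ i) \<beta> (s * w $ i)
     = (s powr (\<alpha> $ i - 1) * exp (- (s * w $ i) / \<beta>) / \<beta> powr (\<alpha> $ i)) * (w $ i powr (\<alpha> $ i - 1) / Gamma (\<alpha> $ i))" for i
    using s True[rule_format, of i] by (simp add: gamma_density_def powr_mult less_imp_le)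
  have 1: "(\<Prod>i\<in>UNIV. s powr (\<alpha> $ i - 1)) = s powr (?a - CARD('k))"
    using s by (simp add: powr_sum[symmetric] sum_subtractf)
  have 2: "(\<Prod>i\<in>UNIV. \<beta> powr (\<alpha> $ i)) = \<beta> powr ?a"
    using \<beta> by (simp add: powr_sum)
  have 3: "(\<Prod>i\<in>UNIV. exp (- (s * w $ i) / \<beta>)) = exp (- s / \<beta>)"
    by (simp add: exp_sum[symmetric] sum_negf sum_divide_distrib[symmetric] sum_distrib_left[symmetric] w)
  have 4: "s ^ (CARD('k) - 1) * s powr (?a - CARD('k)) = s powr (?a - 1)"
    using s card by (simp add: powr_realpow[symmetric] powr_add[symmetric] of_nat_diff)
  have "s ^ (CARD('k) - 1) * (\<Prod>i\<in>UNIV. gamma_density (\<alpha> $ i) \<beta> (s * w $ i))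
      = (s ^ (CARD('k) - 1) * s powr (?a - CARD('k))) * exp (- s / \<beta>) / \<beta> powr ?a
        * ((\<Prod>i\<in>UNIV. w $ i powr (\<alpha> $ i - 1)) / (\<Prod>i\<in>UNIV. Gamma (\<alpha> $ i)))"
    unfolding sw prod.distrib prod_dividef 1 2 3 by simp
  also have "\<dots> = gamma_density ?a \<beta> s * dirichlet_density \<alpha> w"
    unfolding 4 using s True lt1 w less_imp_neq[OF Gamma_real_pos[OF a]]
    by (simp add: gamma_density_def dirichlet_density_def)
  finally show ?thesis .
qed

text \<open>
  The change of variables from increments to (proportions, total) is made in two steps: a shear
  replaces the last increment by the total \<open>s\<close>, and then, for each fixed \<open>s > 0\<close>, the remaining
  coordinates are scaled by \<open>s\<close>.
\<close>

lemma nn_integral_mgamma_proportions_total: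
  fixes \<alpha> :: "real ^ 'k::{finite,linorder}" and \<phi> :: "real ^ 'k::{finite,linorder} \<Rightarrow> real \<Rightarrow> ennreal"
  assumes card: "CARD('k) \<ge> 2" and \<alpha>: "\<alpha> \<in> pos_orthant" and \<beta>: "\<beta> > 0"
    and \<phi> [measurable]: "case_prod \<phi> \<in> borel_measurable (borel \<Otimes>\<^sub>M borel)"
  shows "(\<integral>\<^sup>+x. \<phi> ((1 / x $ last_ix) *\<^sub>R delta x) (x $ last_ix) \<partial>mgamma \<alpha> \<beta>)
       = (\<integral>\<^sup>+s. ennreal (gamma_density (\<Sum>i\<in>UNIV. \<alpha> $ i) \<beta> s) * (\<integral>\<^sup>+w. \<phi> w s \<partial>dirichlet \<alpha>) \<partial>lborel)"
proof -
  interpret product_sigma_finite "\<lambda>_::'k. lborel :: real measure" ..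
  let ?a = "\<Sum>i\<in>UNIV. \<alpha> $ i" and ?I = "{..<last_ix :: 'k}"
  let ?P = "PiM UNIV (\<lambda>_::'k. lborel :: real measure)"
  define g where "g y = (\<Prod>i\<in>UNIV. gamma_density (\<alpha> $ i) \<beta> (y $ i))" for y :: "real ^ 'k::{finite,linorder}"
  define F where "F y = ennreal (g y) * \<phi> ((1 / (\<Sum>i\<in>UNIV. y $ i)) *\<^sub>R y) (\<Sum>i\<in>UNIV. y $ i)" for y :: "real ^ 'k::{finite,linorder}"
  define H where "H x = F (\<chi> i. (x(last_ix := x last_ix + - (\<Sum>j\<in>?I. x j))) i)" for x :: "'k \<Rightarrow> real"
  have a: "?a > 0" by (rule sum_pos_orthant_pos[OF \<alpha>])
  have [measurable]: "g \<in> borel_measurable borel" unfolding g_def by measurable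
  have [measurable]: "F \<in> borel_measurable borel" unfolding F_def by measurable
  have Hm [measurable]: "H \<in> borel_measurable ?P"
  proof -
    have "(\<lambda>x. \<chi> i. (x(last_ix := x last_ix + - (\<Sum>j\<in>?I. x j))) i) \<in> borel_measurable ?P"
      by (rule measurable_vec_lambda) (simp add: fun_upd_def)
    then show ?thesis unfolding H_def by measurable
  qed
  have Fm [measurable]: "(\<lambda>x. F (\<chi> i. x i)) \<in> borel_measurable ?P"
    by measurable
  have "(\<integral>\<^sup>+x. \<phi> ((1 / x $ last_ix) *\<^sub>R delta x) (x $ last_ix) \<partial>mgamma \<alpha> \<beta>)
      = (\<integral>\<^sup>+y. F y \<partial>lborel)"
    using nn_integral_mgamma_delta[OF \<alpha> \<beta>, of "\<lambda>y. \<phi> ((1 / (\<Sum>i\<in>UNIV. y $ i)) *\<^sub>R y) (\<Sum>i\<in>UNIV. y $ i)"]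
    by (simp add: sum_delta F_def g_def)
  also have "\<dots> = (\<integral>\<^sup>+y. F (\<chi> i. y i) \<partial>?P)"
    by (rule nn_integral_lborel_vec) measurable
  also have "\<dots> = (\<integral>\<^sup>+x. H x \<partial>?P)"
    unfolding H_def
    by (rule nn_integral_PiM_shear[where c = "\<lambda>x. - (\<Sum>j\<in>?I. x j)"]) (auto intro!: sum.cong)
  also have "\<dots> = (\<integral>\<^sup>+s. \<integral>\<^sup>+x. H (x(last_ix := s)) \<partial>PiM ?I (\<lambda>_. lborel) \<partial>lborel)"
    using product_nn_integral_insert_rev[of ?I last_ix H, folded UNIV_eq_insert_last] by simp
  also have "\<dots> = (\<integral>\<^sup>+s. ennreal (gamma_density ?a \<beta> s) * (\<integral>\<^sup>+w. \<phi> w s \<partial>dirichlet \<alpha>) \<partial>lborel)"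
  proof (rule nn_integral_cong)
    fix s :: real
    have Hs: "H (x(last_ix := s)) = F (\<chi> i. (x(last_ix := s - (\<Sum>j\<in>?I. x j))) i)" for x
      unfolding H_def by (auto intro!: arg_cong[where f = F] sum.cong simp: vec_eq_iff)
    have tot: "(\<Sum>i\<in>UNIV. (x(last_ix := s - (\<Sum>j\<in>?I. x j))) i) = s" for x
      by (subst UNIV_eq_insert_last) (auto simp: sum.insert intro!: sum.cong)
    show "(\<integral>\<^sup>+x. H (x(last_ix := s)) \<partial>PiM ?I (\<lambda>_. lborel))
       = ennreal (gamma_density ?a \<beta> s) * (\<integral>\<^sup>+w. \<phi> w s \<partial>dirichlet \<alpha>)"
    proof (cases "s > 0")
      case False
      have "H (x(last_ix := s)) = 0" for x
      proof -
        let ?y = "\<chi> i. (x(last_ix := s - (\<Sum>j\<in>?I. x j))) i"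
        have "\<exists>i. \<not> 0 < ?y $ i"
        proof (rule ccontr)
          assume "\<not> ?thesis"
          then have "(\<Sum>i\<in>UNIV. ?y $ i) > 0" by (intro sum_pos) auto
          then show False using False tot[of x] by simp
        qed
        then obtain i where "\<not> 0 < ?y $ i" ..
        then have "g ?y = 0" unfolding g_def
          by (intro prod_zero bexI[of _ i]) (simp_all add: gamma_density_def)
        then show ?thesis unfolding Hs F_def by (simp only: ennreal_0 mult_zero_left)
      qed
      then show ?thesis using False by (simp add: gamma_density_def)
    next
      case True
      have Hsm: "(\<lambda>x. H (x(last_ix := s))) \<in> borel_measurable (PiM ?I (\<lambda>_. lborel))"
      proof -
        have "(\<lambda>x. x(last_ix := s)) \<in> measurable (PiM ?I (\<lambda>_. lborel)) (PiM (insert last_ix ?I) (\<lambda>_. lborel :: real measure))"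
          by (rule measurable_fun_upd[where J = ?I]) auto
        from measurable_compose[OF this[folded UNIV_eq_insert_last] Hm] show ?thesis .
      qed
      have cI: "card ?I = CARD('k) - 1"
        using card_insert_disjoint[of ?I last_ix] by (simp add: UNIV_eq_insert_last[symmetric])
      have pt: "ennreal (s ^ card ?I) * H ((\<lambda>i\<in>?I. s * u i)(last_ix := s))
          = ennreal (gamma_density ?a \<beta> s) * (ennreal (dirichlet_density \<alpha> (complete_coords u)) * \<phi> (complete_coords u) s)" for u
      proof -
        let ?w = "complete_coords u :: real ^ 'k::{finite,linorder}"
        have w1: "(\<Sum>i\<in>UNIV. ?w $ i) = 1"
          by (subst UNIV_eq_insert_last) (auto simp: complete_coords_def intro!: sum.cong)
        have "(\<chi> i. ((\<lambda>i\<in>?I. s * u i)(last_ix := s - (\<Sum>j\<in>?I. (\<lambda>i\<in>?I. s * u i) j))) i) = s *\<^sub>R ?w"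
          using le_last_ix by (auto simp: vec_eq_iff complete_coords_def sum_distrib_left algebra_simps le_less)
        then have "H ((\<lambda>i\<in>?I. s * u i)(last_ix := s)) = F (s *\<^sub>R ?w)"
          unfolding Hs by (rule arg_cong)
        also have "\<dots> = ennreal (\<Prod>i\<in>UNIV. gamma_density (\<alpha> $ i) \<beta> (s * ?w $ i)) * \<phi> ?w s"
          using True w1 by (simp add: F_def g_def sum_distrib_left[symmetric])
        finally have "ennreal (s ^ card ?I) * H ((\<lambda>i\<in>?I. s * u i)(last_ix := s))
           = ennreal (s ^ (CARD('k) - 1) * (\<Prod>i\<in>UNIV. gamma_density (\<alpha> $ i) \<beta> (s * ?w $ i))) * \<phi> ?w s"
          using True by (simp add: cI ennreal_mult' mult.assoc)
        also have "\<dots> = ennreal (gamma_density ?a \<beta> s) * (ennreal (dirichlet_density \<alpha> ?w) * \<phi> ?w s)"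
          unfolding gamma_product_factorization[OF card \<alpha> \<beta> True w1]
          using a by (simp add: ennreal_mult' gamma_density_nonneg mult.assoc)
        finally show ?thesis .
      qed
      have "(\<integral>\<^sup>+x. H (x(last_ix := s)) \<partial>PiM ?I (\<lambda>_. lborel))
          = ennreal (s ^ card ?I) * (\<integral>\<^sup>+u. H ((\<lambda>i\<in>?I. s * u i)(last_ix := s)) \<partial>PiM ?I (\<lambda>_. lborel))"
        by (rule nn_integral_PiM_scale[OF _ True Hsm]) simp
      also have "\<dots> = (\<integral>\<^sup>+u. ennreal (s ^ card ?I) * H ((\<lambda>i\<in>?I. s * u i)(last_ix := s)) \<partial>PiM ?I (\<lambda>_. lborel))"
      proof (rule nn_integral_cmult[symmetric])
        have "(\<lambda>u. \<lambda>i\<in>?I. s * u i) \<in> measurable (PiM ?I (\<lambda>_. lborel)) (PiM ?I (\<lambda>_. lborel :: real measure))"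
          by (rule measurable_restrict) auto
        from measurable_compose[OF this Hsm]
        show "(\<lambda>u. H ((\<lambda>i\<in>?I. s * u i)(last_ix := s))) \<in> borel_measurable (PiM ?I (\<lambda>_. lborel))" .
      qed
      also have "\<dots> = ennreal (gamma_density ?a \<beta> s) * (\<integral>\<^sup>+w. \<phi> w s \<partial>dirichlet \<alpha>)"
        unfolding pt by (simp add: nn_integral_cmult nn_integral_dirichlet)
      finally show ?thesis .
    qed
  qed
  finally show ?thesis .
qed

definition proportions :: "real ^ 'k::{finite,linorder} \<Rightarrow> real ^ 'k::{finite,linorder}" where
  "proportions x = (1 / x $ last_ix) *\<^sub>R delta x"

lemma proportions_measurable [measurable]: "proportions \<in> borel_measurable borel"
  unfolding proportions_def by measurable

lemma sets_gamma_law [simp, measurable_cong]: "sets (gamma_law a b) = sets borel"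
  by (simp add: gamma_law_def)

lemma space_gamma_law [simp]: "space (gamma_law a b) = UNIV"
  by (simp add: gamma_law_def)

lemma emeasure_distr_indicator:
  assumes "f \<in> measurable M N" "A \<in> sets N"
  shows "emeasure (distr M N f) A = (\<integral>\<^sup>+x. indicator A (f x) \<partial>M)"
  using nn_integral_distr[OF assms(1), of "indicator A"] assms by simp

text \<open>
  The total mass of the Dirichlet density is read off from the factorization: together with the
  gamma law of the total, which has mass 1, it gives the mass 1 of the multivariate Gamma law.
\<close>

lemma prob_space_dirichlet:
  fixes \<alpha> :: "real ^ 'k::{finite,linorder}"
  assumes card: "CARD('k) \<ge> 2" and \<alpha>: "\<alpha> \<in> pos_orthant"
  shows "prob_space (dirichlet \<alpha>)"
proof (rule prob_spaceI)
  have 1: "(1 :: real) > 0" by simp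
  let ?a = "\<Sum>i\<in>UNIV. \<alpha> $ i"
  interpret prob_space "mgamma \<alpha> 1" by (rule prob_space_mgamma[OF \<alpha> 1])
  have "1 = (\<integral>\<^sup>+x. 1 \<partial>mgamma \<alpha> 1)" using emeasure_space_1 by simp
  also have "\<dots> = (\<integral>\<^sup>+s. ennreal (gamma_density ?a 1 s) * emeasure (dirichlet \<alpha>) UNIV \<partial>lborel)"
    using nn_integral_mgamma_proportions_total[OF card \<alpha> 1, of "\<lambda>_ _. 1"] by simp
  also have "\<dots> = emeasure (dirichlet \<alpha>) UNIV"
    using sum_pos_orthant_pos[OF \<alpha>] by (simp add: nn_integral_multc nn_integral_gamma_density)
  finally show "emeasure (dirichlet \<alpha>) (space (dirichlet \<alpha>)) = 1" by simp
qed

context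
  fixes \<alpha> :: "real ^ 'k::{finite,linorder}" and \<beta> \<alpha>\<^sub>0 :: real
  assumes card: "CARD('k) \<ge> 2" and \<alpha>: "\<alpha> \<in> pos_orthant" and \<beta>: "\<beta> > 0"
    and \<alpha>\<^sub>0: "\<alpha>\<^sub>0 = (\<Sum>i\<in>UNIV. \<alpha> $ i)"
begin

lemma distr_mgamma_proportions: "distr (mgamma \<alpha> \<beta>) borel proportions = dirichlet \<alpha>"
proof (rule measure_eqI)
  fix A assume "A \<in> sets (distr (mgamma \<alpha> \<beta>) borel proportions)"
  then have [measurable]: "A \<in> sets borel" by simp
  have "emeasure (distr (mgamma \<alpha> \<beta>) borel proportions) A = (\<integral>\<^sup>+x. indicator A (proportions x) \<partial>mgamma \<alpha> \<beta>)"
    by (rule emeasure_distr_indicator) simp_all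
  also have "\<dots> = (\<integral>\<^sup>+s. ennreal (gamma_density \<alpha>\<^sub>0 \<beta> s) * emeasure (dirichlet \<alpha>) A \<partial>lborel)"
    using nn_integral_mgamma_proportions_total[OF card \<alpha> \<beta>, of "\<lambda>w s. indicator A w"]
    by (simp add: \<alpha>\<^sub>0 proportions_def)
  also have "\<dots> = emeasure (dirichlet \<alpha>) A"
    using sum_pos_orthant_pos[OF \<alpha>, folded \<alpha>\<^sub>0] \<beta> by (simp add: nn_integral_multc nn_integral_gamma_density)
  finally show "emeasure (distr (mgamma \<alpha> \<beta>) borel proportions) A = emeasure (dirichlet \<alpha>) A" .
qed simp

lemma distr_mgamma_total: "distr (mgamma \<alpha> \<beta>) borel (\<lambda>x. x $ last_ix) = gamma_law \<alpha>\<^sub>0 \<beta>"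
proof (rule measure_eqI)
  interpret D: prob_space "dirichlet \<alpha>" by (rule prob_space_dirichlet[OF card \<alpha>])
  fix A assume "A \<in> sets (distr (mgamma \<alpha> \<beta>) borel (\<lambda>x. x $ last_ix))"
  then have [measurable]: "A \<in> sets borel" by simp
  have "emeasure (distr (mgamma \<alpha> \<beta>) borel (\<lambda>x. x $ last_ix)) A = (\<integral>\<^sup>+x. indicator A (x $ last_ix) \<partial>mgamma \<alpha> \<beta>)"
    by (rule emeasure_distr_indicator) simp_all
  also have "\<dots> = (\<integral>\<^sup>+s. ennreal (gamma_density \<alpha>\<^sub>0 \<beta> s) * indicator A s \<partial>lborel)"
    using nn_integral_mgamma_proportions_total[OF card \<alpha> \<beta>, of "\<lambda>w s. indicator A s"] D.emeasure_space_1
    by (simp add: \<alpha>\<^sub>0)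
  also have "\<dots> = emeasure (gamma_law \<alpha>\<^sub>0 \<beta>) A"
    by (simp add: gamma_law_def emeasure_density)
  finally show "emeasure (distr (mgamma \<alpha> \<beta>) borel (\<lambda>x. x $ last_ix)) A = emeasure (gamma_law \<alpha>\<^sub>0 \<beta>) A" .
qed simp

text \<open>
  The real functional \<open>u\<close> is there because \<^const>\<open>prob_space.indep_var\<close> relates two random
  variables with values in one and the same type.
\<close>

lemma indep_proportions_total:
  fixes u :: "real ^ 'k::{finite,linorder} \<Rightarrow> real"
  assumes u [measurable]: "u \<in> borel_measurable borel"
  shows "prob_space.indep_var (mgamma \<alpha> \<beta>) borel (\<lambda>x. u (proportions x)) borel (\<lambda>x. x $ last_ix)"
proof -
  interpret prob_space "mgamma \<alpha> \<beta>" by (rule prob_space_mgamma[OF \<alpha> \<beta>])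
  interpret D: prob_space "dirichlet \<alpha>" by (rule prob_space_dirichlet[OF card \<alpha>])
  interpret T: prob_space "gamma_law \<alpha>\<^sub>0 \<beta>" by (rule prob_space_gamma_law[OF sum_pos_orthant_pos[OF \<alpha>, folded \<alpha>\<^sub>0] \<beta>])
  interpret DT: pair_sigma_finite "dirichlet \<alpha>" "gamma_law \<alpha>\<^sub>0 \<beta>" ..
  let ?J = "distr (mgamma \<alpha> \<beta>) (borel \<Otimes>\<^sub>M borel) (\<lambda>x. (proportions x, x $ last_ix))"
  have joint: "dirichlet \<alpha> \<Otimes>\<^sub>M gamma_law \<alpha>\<^sub>0 \<beta> = ?J"
  proof (rule measure_eqI)
    show s: "sets (dirichlet \<alpha> \<Otimes>\<^sub>M gamma_law \<alpha>\<^sub>0 \<beta>) = sets ?J"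
      by (simp cong: sets_pair_measure_cong)
    fix A assume "A \<in> sets (dirichlet \<alpha> \<Otimes>\<^sub>M gamma_law \<alpha>\<^sub>0 \<beta>)"
    then have A: "A \<in> sets (borel \<Otimes>\<^sub>M borel)" unfolding s by simp
    have A2 [measurable]: "A \<in> sets (dirichlet \<alpha> \<Otimes>\<^sub>M gamma_law \<alpha>\<^sub>0 \<beta>)" by fact
    have ph: "(\<lambda>(w, s). indicator A (w, s) :: ennreal) \<in> borel_measurable (borel \<Otimes>\<^sub>M borel)"
      using A by simp
    have "emeasure ?J A = (\<integral>\<^sup>+x. indicator A (proportions x, x $ last_ix) \<partial>mgamma \<alpha> \<beta>)"
      using A by (intro emeasure_distr_indicator) simp_all
    also have "\<dots> = (\<integral>\<^sup>+s. ennreal (gamma_density \<alpha>\<^sub>0 \<beta> s) * (\<integral>\<^sup>+w. indicator A (w, s) \<partial>dirichlet \<alpha>) \<partial>lborel)"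
      using nn_integral_mgamma_proportions_total[OF card \<alpha> \<beta> ph]
      by (simp add: \<alpha>\<^sub>0 proportions_def)
    also have "\<dots> = (\<integral>\<^sup>+s. (\<integral>\<^sup>+w. indicator A (w, s) \<partial>dirichlet \<alpha>) \<partial>gamma_law \<alpha>\<^sub>0 \<beta>)"
      unfolding gamma_law_def
    proof (rule nn_integral_density[symmetric])
      show "(\<lambda>s. \<integral>\<^sup>+w. indicator A (w, s) \<partial>dirichlet \<alpha>) \<in> borel_measurable lborel"
        using D.borel_measurable_nn_integral_fst[of "\<lambda>(s, w). indicator A (w, s)" lborel] A
        by simp
    qed simp
    also have "\<dots> = emeasure (dirichlet \<alpha> \<Otimes>\<^sub>M gamma_law \<alpha>\<^sub>0 \<beta>) A"
      using DT.nn_integral_snd[of "indicator A"] A2 by simp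
    finally show "emeasure (dirichlet \<alpha> \<Otimes>\<^sub>M gamma_law \<alpha>\<^sub>0 \<beta>) A = emeasure ?J A" by simp
  qed
  have "distr (mgamma \<alpha> \<beta>) borel (\<lambda>x. u (proportions x)) = distr (dirichlet \<alpha>) borel u"
    unfolding distr_mgamma_proportions[symmetric] by (subst distr_distr) (simp_all add: o_def)
  then have "distr (mgamma \<alpha> \<beta>) borel (\<lambda>x. u (proportions x)) \<Otimes>\<^sub>M distr (mgamma \<alpha> \<beta>) borel (\<lambda>x. x $ last_ix)
     = distr (dirichlet \<alpha>) borel u \<Otimes>\<^sub>M distr (gamma_law \<alpha>\<^sub>0 \<beta>) borel (\<lambda>s. s)"
    using distr_id2[of borel "gamma_law \<alpha>\<^sub>0 \<beta>"] by (simp add: distr_mgamma_total)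
  also have "\<dots> = distr ?J (borel \<Otimes>\<^sub>M borel) (\<lambda>(w, s). (u w, s))"
    using distr_id2[of borel "gamma_law \<alpha>\<^sub>0 \<beta>"] T.sigma_finite_measure_axioms
    by (subst pair_measure_distr) (simp_all add: joint)
  also have "\<dots> = distr (mgamma \<alpha> \<beta>) (borel \<Otimes>\<^sub>M borel) (\<lambda>x. (u (proportions x), x $ last_ix))"
    by (subst distr_distr) (simp_all add: o_def)
  finally show ?thesis
    by (simp add: indep_var_distribution_eq)
qed

lemma integral_proportions:
  fixes f :: "real ^ 'k::{finite,linorder} \<Rightarrow> 'b::{banach,second_countable_topology}"
  assumes [measurable]: "f \<in> borel_measurable borel"
  shows "integrable (mgamma \<alpha> \<beta>) (\<lambda>x. f (proportions x)) \<longleftrightarrow> integrable (dirichlet \<alpha>) f"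
    and "(\<integral>x. f (proportions x) \<partial>mgamma \<alpha> \<beta>) = integral\<^sup>L (dirichlet \<alpha>) f"
proof -
  have m: "proportions \<in> measurable (mgamma \<alpha> \<beta>) borel" by measurable
  show "integrable (mgamma \<alpha> \<beta>) (\<lambda>x. f (proportions x)) \<longleftrightarrow> integrable (dirichlet \<alpha>) f"
    unfolding distr_mgamma_proportions[symmetric]
    by (rule integrable_distr_eq[OF m assms, symmetric])
  show "(\<integral>x. f (proportions x) \<partial>mgamma \<alpha> \<beta>) = integral\<^sup>L (dirichlet \<alpha>) f"
    unfolding distr_mgamma_proportions[symmetric]
    by (rule integral_distr[OF m assms, symmetric])
qed

lemma total_moments:
  shows "integrable (mgamma \<alpha> \<beta>) (\<lambda>x. x $ last_ix)" "(\<integral>x. x $ last_ix \<partial>mgamma \<alpha> \<beta>) = \<alpha>\<^sub>0 * \<beta>"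
    and "integrable (mgamma \<alpha> \<beta>) (\<lambda>x. (x $ last_ix)\<^sup>2)"
    and "(\<integral>x. (x $ last_ix - \<alpha>\<^sub>0 * \<beta>)\<^sup>2 \<partial>mgamma \<alpha> \<beta>) = \<alpha>\<^sub>0 * \<beta>\<^sup>2"
proof -
  interpret prob_space "mgamma \<alpha> \<beta>" by (rule prob_space_mgamma[OF \<alpha> \<beta>])
  have m: "(\<lambda>x. x $ last_ix) \<in> measurable (mgamma \<alpha> \<beta>) borel" by measurable
  note d = distr_mgamma_total
  note mom = gamma_law_moments[OF sum_pos_orthant_pos[OF \<alpha>, folded \<alpha>\<^sub>0] \<beta>]
  have m': "(\<lambda>x::real. x) \<in> borel_measurable borel" "(\<lambda>x::real. x\<^sup>2) \<in> borel_measurable borel" by measurable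
  note I = integrable_distr_eq[OF m m'(1), unfolded d] integrable_distr_eq[OF m m'(2), unfolded d]
    integral_distr[OF m m'(1), unfolded d] integral_distr[OF m m'(2), unfolded d]
  show i1: "integrable (mgamma \<alpha> \<beta>) (\<lambda>x. x $ last_ix)" using mom(1) I(1) by blast
  show e1: "(\<integral>x. x $ last_ix \<partial>mgamma \<alpha> \<beta>) = \<alpha>\<^sub>0 * \<beta>" using mom(2) I(3) by metis
  show i2: "integrable (mgamma \<alpha> \<beta>) (\<lambda>x. (x $ last_ix)\<^sup>2)" using mom(3) I(2) by blast
  have e2: "(\<integral>x. (x $ last_ix)\<^sup>2 \<partial>mgamma \<alpha> \<beta>) = \<alpha>\<^sub>0 * (\<alpha>\<^sub>0 + 1) * \<beta>\<^sup>2" using mom(4) I(4) by metis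
  show "(\<integral>x. (x $ last_ix - \<alpha>\<^sub>0 * \<beta>)\<^sup>2 \<partial>mgamma \<alpha> \<beta>) = \<alpha>\<^sub>0 * \<beta>\<^sup>2"
    using variance_eq[OF i1 i2] unfolding e1 e2 by (simp add: power2_eq_square algebra_simps)
qed

end

section \<open>Normal laws with a prescribed covariance matrix\<close>

lemma quadratic_form_insert:
  fixes Q :: "'a \<Rightarrow> 'a \<Rightarrow> real"
  assumes "finite I" "a \<notin> I" and sym: "\<And>j. j \<in> I \<Longrightarrow> Q j a = Q a j"
  shows "(\<Sum>i\<in>insert a I. \<Sum>j\<in>insert a I. x i * x j * Q i j)
    = (x a)\<^sup>2 * Q a a + 2 * x a * (\<Sum>j\<in>I. x j * Q a j) + (\<Sum>i\<in>I. \<Sum>j\<in>I. x i * x j * Q i j)"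
proof -
  have "(\<Sum>i\<in>I. x i * x a * Q i a) = x a * (\<Sum>j\<in>I. x j * Q a j)"
    unfolding sum_distrib_left by (intro sum.cong) (simp_all add: sym)
  moreover have "(\<Sum>j\<in>I. x a * x j * Q a j) = x a * (\<Sum>j\<in>I. x j * Q a j)"
    by (simp add: sum_distrib_left mult.assoc)
  ultimately show ?thesis using assms
    by (simp add: sum.distrib power2_eq_square)
qed

text \<open>
  Cholesky factorization by symmetric Gaussian elimination. The pivot \<open>q = Q a a\<close> splits off a rank-one
  form; what remains is the Schur complement \<open>Q'\<close>, whose value is the minimum of the original form
  over the coordinate at \<open>a\<close> and hence nonnegative. A zero pivot forces its whole row to vanish, and
  then the same formulas remain correct with division by zero yielding zero.
\<close>

lemma positive_semidefinite_gram:
  fixes Q :: "'a \<Rightarrow> 'a \<Rightarrow> real"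
  assumes "finite I" and "\<And>i j. i \<in> I \<Longrightarrow> j \<in> I \<Longrightarrow> Q i j = Q j i"
    and "\<And>x. 0 \<le> (\<Sum>i\<in>I. \<Sum>j\<in>I. x i * x j * Q i j)"
  shows "\<exists>B. \<forall>i\<in>I. \<forall>j\<in>I. Q i j = (\<Sum>l\<in>I. B i l * B j l)"
  using assms
proof (induction I arbitrary: Q rule: finite_induct)
  case empty
  then show ?case by simp
next
  case (insert a I)
  define q where "q = Q a a"
  define Q' where "Q' i j = Q i j - Q a i * Q a j / q" for i j
  have sym: "Q j a = Q a j" if "j \<in> I" for j using insert.prems(1) that by auto
  have form: "0 \<le> t\<^sup>2 * q + 2 * t * (\<Sum>j\<in>I. x j * Q a j) + (\<Sum>i\<in>I. \<Sum>j\<in>I. x i * x j * Q i j)" for t x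
  proof -
    have "0 \<le> (\<Sum>i\<in>insert a I. \<Sum>j\<in>insert a I. (x(a := t)) i * (x(a := t)) j * Q i j)"
      by (rule insert.prems(2))
    also have "\<dots> = t\<^sup>2 * q + 2 * t * (\<Sum>j\<in>I. (x(a := t)) j * Q a j) + (\<Sum>i\<in>I. \<Sum>j\<in>I. (x(a := t)) i * (x(a := t)) j * Q i j)"
      using quadratic_form_insert[where Q = Q and a = a and I = I and x = "x(a := t)", OF insert.hyps sym] by (simp add: q_def)
    also have "(\<Sum>j\<in>I. (x(a := t)) j * Q a j) = (\<Sum>j\<in>I. x j * Q a j)"
      using insert.hyps by (intro sum.cong refl) auto
    also have "(\<Sum>i\<in>I. \<Sum>j\<in>I. (x(a := t)) i * (x(a := t)) j * Q i j) = (\<Sum>i\<in>I. \<Sum>j\<in>I. x i * x j * Q i j)"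
      using insert.hyps by (intro sum.cong refl) auto
    finally show ?thesis .
  qed
  have q0: "q \<ge> 0" using form[of 1 "\<lambda>_. 0"] by simp
  have zero: "Q a j = 0" if "q = 0" "j \<in> I" for j
  proof (rule ccontr)
    assume b: "Q a j \<noteq> 0"
    (* With a zero pivot the form is affine in the coordinate at a; at this t it would be -1. *)
    define t where "t = - (Q j j + 1) / (2 * Q a j)"
    have s1: "(\<Sum>i\<in>I. (if i = j then 1 else 0) * Q a i) = Q a j"
      using insert.hyps that by (simp add: if_distrib[of "\<lambda>x. x * _"] cong: if_cong)
    have s2: "(\<Sum>i\<in>I. \<Sum>k\<in>I. (if i = j then 1 else 0) * (if k = j then 1 else 0) * Q i k) = Q j j"
    proof -
      have "(\<Sum>i\<in>I. \<Sum>k\<in>I. (if i = j then 1 else 0) * (if k = j then 1 else 0) * Q i k)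
        = (\<Sum>i\<in>I. if i = j then (\<Sum>k\<in>I. if k = j then Q i k else 0) else 0)"
        by (intro sum.cong refl) (auto intro!: sum.cong)
      then show ?thesis using insert.hyps that by simp
    qed
    have "0 \<le> 2 * t * Q a j + Q j j"
      using form[of t "\<lambda>i. if i = j then 1 else 0"] \<open>q = 0\<close> unfolding s1 s2 by simp
    moreover have "2 * t * Q a j = - (Q j j + 1)" using b by (simp add: t_def)
    ultimately show False by simp
  qed
  have "\<exists>B. \<forall>i\<in>I. \<forall>j\<in>I. Q' i j = (\<Sum>l\<in>I. B i l * B j l)"
  proof (rule insert.IH)
    show "Q' i j = Q' j i" if "i \<in> I" "j \<in> I" for i j
      using insert.prems(1)[of i j] that by (simp add: Q'_def)
    fix x :: "'a \<Rightarrow> real"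
    let ?s = "\<Sum>j\<in>I. x j * Q a j"
    have pt: "x i * x j * Q' i j = x i * x j * Q i j - (x i * Q a i) * (x j * Q a j) / q" for i j
      by (simp add: Q'_def right_diff_distrib)
    have "(\<Sum>i\<in>I. \<Sum>j\<in>I. x i * x j * Q' i j)
        = (\<Sum>i\<in>I. \<Sum>j\<in>I. x i * x j * Q i j) - (\<Sum>i\<in>I. \<Sum>j\<in>I. (x i * Q a i) * (x j * Q a j)) / q"
      unfolding pt sum_subtractf sum_divide_distrib ..
    also have "(\<Sum>i\<in>I. \<Sum>j\<in>I. (x i * Q a i) * (x j * Q a j)) = ?s * ?s"
      by (simp add: sum_product)
    finally have *: "(\<Sum>i\<in>I. \<Sum>j\<in>I. x i * x j * Q' i j) = (\<Sum>i\<in>I. \<Sum>j\<in>I. x i * x j * Q i j) - ?s * ?s / q" .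
    show "0 \<le> (\<Sum>i\<in>I. \<Sum>j\<in>I. x i * x j * Q' i j)"
    proof (cases "q = 0")
      case True
      then show ?thesis unfolding * using form[of 0 x] by simp
    next
      case False
      (* - ?s / q is the coordinate at a that minimizes the form. *)
      then have "(- ?s / q)\<^sup>2 * q + 2 * (- ?s / q) * ?s = - (?s * ?s / q)"
        by (simp add: power2_eq_square field_simps)
      then show ?thesis unfolding * using form[of "- ?s / q" x] by linarith
    qed
  qed
  then obtain B where B: "\<forall>i\<in>I. \<forall>j\<in>I. Q' i j = (\<Sum>l\<in>I. B i l * B j l)" by blast
  define C where "C i l = (if l = a then Q a i / sqrt q else if i = a then 0 else B i l)" for i l
  have aa: "Q a i / sqrt q * (Q a j / sqrt q) = Q a i * Q a j / q" for i j
    using q0 by simp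
  have qq: "Q a a * Q a j / q = Q a j" if "j \<in> insert a I" for j
    using that zero by (cases "q = 0") (auto simp: q_def)
  have "Q i j = (\<Sum>l\<in>insert a I. C i l * C j l)" if ij: "i \<in> insert a I" "j \<in> insert a I" for i j
  proof -
    have "(\<Sum>l\<in>insert a I. C i l * C j l) = Q a i * Q a j / q + (\<Sum>l\<in>I. C i l * C j l)"
      using insert.hyps aa by (simp add: C_def)
    also have "(\<Sum>l\<in>I. C i l * C j l) = (\<Sum>l\<in>I. if i = a \<or> j = a then 0 else B i l * B j l)"
      using insert.hyps by (intro sum.cong) (auto simp: C_def)
    also have "Q a i * Q a j / q + \<dots> = Q i j"
    proof (cases "i = a \<or> j = a")
      case True
      then have "(\<Sum>l\<in>I. if i = a \<or> j = a then 0 else B i l * B j l) = 0" by simp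
      moreover have "Q a i * Q a j / q = Q i j"
        using True
      proof
        assume "i = a"
        then show ?thesis using qq[OF ij(2)] by simp
      next
        assume j: "j = a"
        have "Q a i = Q i a" using sym ij(1) by (cases "i = a") auto
        then show ?thesis using qq[OF ij(1)] j by (simp add: mult.commute)
      qed
      ultimately show ?thesis by simp
    next
      case False
      then have "i \<in> I" "j \<in> I" using ij by auto
      then have "(\<Sum>l\<in>I. B i l * B j l) = Q' i j" using B by simp
      then show ?thesis using False by (simp add: Q'_def)
    qed
    finally show ?thesis ..
  qed
  then show ?case by blast
qed

lemma prob_space_std_normal: "prob_space std_normal_distribution"
  by (simp add: prob_space_normal_density)

lemma normal_law_eq_distr:
  assumes "\<sigma> \<ge> 0"
  shows "normal_law 0 \<sigma> = distr std_normal_distribution borel (\<lambda>x. \<sigma> * x)"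
proof -
  interpret prob_space std_normal_distribution by (rule prob_space_std_normal)
  show ?thesis
  proof (cases "\<sigma> = 0")
    case True
    have "distr std_normal_distribution borel (\<lambda>x. 0 :: real) = return borel 0"
      by (rule distr_const) auto
    then show ?thesis using True by (simp add: normal_law_def)
  next
    case False
    have "distributed std_normal_distribution lborel (\<lambda>x. x) (normal_density 0 1)"
      unfolding distributed_def using distr_id2[of lborel std_normal_distribution] by simp
    from normal_density_affine[OF this, of \<sigma> 0] have "distributed std_normal_distribution lborel (\<lambda>x. \<sigma> * x) (normal_density 0 \<sigma>)"
      using False assms by simp
    then have "distr std_normal_distribution lborel (\<lambda>x. \<sigma> * x) = density lborel (normal_density 0 \<sigma>)"
      by (simp add: distributed_def)
    moreover have "distr std_normal_distribution lborel (\<lambda>x. \<sigma> * x) = distr std_normal_distribution borel (\<lambda>x. \<sigma> * x)"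
      by (intro distr_cong) auto
    ultimately show ?thesis using False by (simp add: normal_law_def)
  qed
qed

lemma normal_law_moments:
  assumes "\<sigma> \<ge> 0"
  shows "integrable (normal_law 0 \<sigma>) (\<lambda>x. x)" "(\<integral>x. x \<partial>normal_law 0 \<sigma>) = 0"
    and "integrable (normal_law 0 \<sigma>) (\<lambda>x. x\<^sup>2)" "(\<integral>x. x\<^sup>2 \<partial>normal_law 0 \<sigma>) = \<sigma>\<^sup>2"
proof -
  let ?S = std_normal_distribution
  have i1: "integrable ?S (\<lambda>x. x)" using integrable_std_normal_distribution_moment[of 1] by simp
  have e1: "(\<integral>x. x \<partial>?S) = 0" using integral_std_normal_distribution_moment_odd[of 1] by simp
  have i2: "integrable ?S (\<lambda>x. x\<^sup>2)" by (rule integrable_std_normal_distribution_moment)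
  have e2: "(\<integral>x. x\<^sup>2 \<partial>?S) = 1" using std_normal_distribution_even_moments(1)[of 1] by (simp add: fact_numeral)
  have [measurable]: "(\<lambda>x. \<sigma> * x) \<in> measurable ?S borel" by simp
  note eq = normal_law_eq_distr[OF assms]
  have D: "integrable (normal_law 0 \<sigma>) f \<longleftrightarrow> integrable ?S (\<lambda>x. f (\<sigma> * x))"
    "integral\<^sup>L (normal_law 0 \<sigma>) f = (\<integral>x. f (\<sigma> * x) \<partial>?S)"
    if "f \<in> borel_measurable borel" for f :: "real \<Rightarrow> real"
    unfolding eq using that by (auto intro!: integrable_distr_eq integral_distr)
  have sq: "(\<sigma> * x)\<^sup>2 = \<sigma>\<^sup>2 * x\<^sup>2" for x by (rule power_mult_distrib)
  have m: "(\<lambda>x::real. x) \<in> borel_measurable borel" "(\<lambda>x::real. x\<^sup>2) \<in> borel_measurable borel"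
    by measurable
  show "integrable (normal_law 0 \<sigma>) (\<lambda>x. x)" "integrable (normal_law 0 \<sigma>) (\<lambda>x. x\<^sup>2)"
    unfolding D(1)[OF m(1)] D(1)[OF m(2)] sq by (intro integrable_mult_right i1 i2)+
  show "(\<integral>x. x \<partial>normal_law 0 \<sigma>) = 0" "(\<integral>x. x\<^sup>2 \<partial>normal_law 0 \<sigma>) = \<sigma>\<^sup>2"
    unfolding D(2)[OF m(1)] D(2)[OF m(2)] sq integral_mult_right_zero e1 e2 by simp_all
qed

text \<open>
  The convolution formula for normal densities concerns positive standard deviations. So the
  indices with zero coefficient are discarded; if none is left, the sum is the constant 0 and its law
  is the degenerate normal law.
\<close>

lemma distr_std_normal_linear_combination:
  fixes c :: "'n::finite \<Rightarrow> real"
  shows "distr (PiM UNIV (\<lambda>_::'n. std_normal_distribution)) borel (\<lambda>y. \<Sum>l\<in>UNIV. c l * y l)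
       = normal_law 0 (sqrt (\<Sum>l\<in>UNIV. (c l)\<^sup>2))"
proof -
  let ?N = "\<lambda>_::'n. std_normal_distribution"
  let ?P = "PiM UNIV ?N"
  interpret S: prob_space std_normal_distribution by (rule prob_space_std_normal)
  interpret product_prob_space ?N UNIV ..
  interpret P: prob_space ?P by (rule prob_space_PiM) (rule prob_space_std_normal)
  define K where "K = {l. c l \<noteq> 0}"
  have restr: "(\<Sum>l\<in>UNIV. g l) = (\<Sum>l\<in>K. g l)" if "\<And>l. c l = 0 \<Longrightarrow> g l = 0" for g :: "'n \<Rightarrow> real"
    by (rule sum.mono_neutral_right) (auto simp: K_def that)
  have m: "(\<lambda>y. y i) \<in> borel_measurable ?P" for i :: 'n
    using measurable_component_singleton[of i UNIV ?N] by simp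
  show ?thesis
  proof (cases "K = {}")
    case True
    then have "c = (\<lambda>_. 0)" by (auto simp: K_def)
    moreover have "distr ?P borel (\<lambda>x. 0 :: real) = return borel 0"
      by (rule P.distr_const) auto
    ultimately show ?thesis by (simp add: normal_law_def)
  next
    case False
    have comp: "distr ?P borel (\<lambda>y. y i) = std_normal_distribution" for i
    proof -
      have "distr ?P (?N i) (\<lambda>y. y i) = ?N i"
        by (rule distr_PiM_component) (auto intro: prob_space_std_normal)
      moreover have "distr ?P (?N i) (\<lambda>y. y i) = distr ?P borel (\<lambda>y. y i)"
        by (intro distr_cong) auto
      ultimately show ?thesis by simp
    qed
    have "P.indep_vars (\<lambda>_. borel) (\<lambda>i y. y i) UNIV"
    proof (subst P.indep_vars_iff_distr_eq_PiM')
      have "distr ?P (PiM UNIV (\<lambda>_. borel)) (\<lambda>x. \<lambda>i\<in>UNIV. x i) = distr ?P ?P (\<lambda>x. x)"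
        by (intro distr_cong) (auto cong: sets_PiM_cong)
      also have "\<dots> = ?P" by simp
      finally show "distr ?P (PiM UNIV (\<lambda>_. borel)) (\<lambda>x. \<lambda>i\<in>UNIV. x i) = (\<Pi>\<^sub>M i\<in>UNIV. distr ?P borel (\<lambda>y. y i))"
        by (simp add: comp)
    qed (use m in auto)
    then have "P.indep_vars (\<lambda>_. borel) (\<lambda>i y. y i) K"
      by (rule P.indep_vars_subset) auto
    then have ind: "P.indep_vars (\<lambda>_. borel) (\<lambda>i y. c i * y i) K"
      by (rule P.indep_vars_compose2) auto
    have "distributed ?P lborel (\<lambda>y. \<Sum>l\<in>K. c l * y l) (normal_density (\<Sum>l\<in>K. 0) (sqrt (\<Sum>l\<in>K. \<bar>c l\<bar>\<^sup>2)))"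
    proof (rule P.sum_indep_normal[OF _ False ind])
      fix i assume "i \<in> K"
      then have ci: "c i \<noteq> 0" by (simp add: K_def)
      have "distr ?P lborel (\<lambda>y. y i) = distr ?P borel (\<lambda>y. y i)" by (intro distr_cong) auto
      then have "distributed ?P lborel (\<lambda>y. y i) (normal_density 0 1)"
        using m unfolding distributed_def by (simp add: comp)
      from P.normal_density_affine[OF this _ ci, of 0]
      show "distributed ?P lborel (\<lambda>y. c i * y i) (normal_density 0 \<bar>c i\<bar>)" by simp
      show "0 < \<bar>c i\<bar>" using ci by simp
    qed simp
    then have "distr ?P lborel (\<lambda>y. \<Sum>l\<in>K. c l * y l) = density lborel (normal_density 0 (sqrt (\<Sum>l\<in>K. (c l)\<^sup>2)))"
      by (simp add: distributed_def)
    moreover have "distr ?P lborel (\<lambda>y. \<Sum>l\<in>K. c l * y l) = distr ?P borel (\<lambda>y. \<Sum>l\<in>K. c l * y l)"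
      by (intro distr_cong) auto
    moreover have "(\<Sum>l\<in>K. (c l)\<^sup>2) > 0"
      using False by (intro sum_pos) (auto simp: K_def)
    ultimately show ?thesis by (simp add: restr normal_law_def)
  qed
qed

lemma inner_matrix_vector_eq_sum:
  fixes S :: "real ^ 'n ^ 'n"
  shows "s \<bullet> (S *v t) = (\<Sum>i\<in>UNIV. \<Sum>j\<in>UNIV. s $ i * t $ j * S $ i $ j)"
  unfolding inner_vec_def
  by (simp add: matrix_vector_mult_def sum_distrib_left)
     (intro sum.cong refl, simp)

text \<open>
  If \<open>S = B ** transpose B\<close>, then the image under \<open>B\<close> of a vector of independent standard normal
  variables has the required law.
\<close>

lemma normal_law_with_covariance_exists:
  fixes S :: "real ^ 'n ^ 'n"
  assumes sym: "\<And>i j. S $ i $ j = S $ j $ i" and psd: "\<And>t. 0 \<le> t \<bullet> (S *v t)"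
  obtains L :: "(real ^ 'n) measure" where "prob_space L" "sets L = sets borel"
    "\<And>t. distr L borel (\<lambda>x. t \<bullet> x) = normal_law 0 (sqrt (t \<bullet> (S *v t)))"
proof -
  have "\<exists>B. \<forall>i\<in>UNIV. \<forall>j\<in>UNIV. S $ i $ j = (\<Sum>l\<in>(UNIV :: 'n set). B i l * B j l)"
  proof (rule positive_semidefinite_gram[where Q = "\<lambda>i j. S $ i $ j" and I = UNIV])
    fix x :: "'n \<Rightarrow> real"
    show "0 \<le> (\<Sum>i\<in>UNIV. \<Sum>j\<in>UNIV. x i * x j * S $ i $ j)"
      using psd[of "\<chi> i. x i"] by (simp add: inner_matrix_vector_eq_sum)
  qed (use sym in auto)
  then obtain B where B: "S $ i $ j = (\<Sum>l\<in>(UNIV :: 'n set). B i l * B j l)" for i j by blast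
  let ?P = "PiM UNIV (\<lambda>_::'n. std_normal_distribution)"
  let ?f = "\<lambda>y. \<chi> i. \<Sum>l\<in>UNIV. B i l * y l"
  interpret P: prob_space ?P by (rule prob_space_PiM) (rule prob_space_std_normal)
  have f [measurable]: "?f \<in> borel_measurable ?P"
    by (rule measurable_vec_lambda) simp
  show thesis
  proof
    show "prob_space (distr ?P borel ?f)" by (rule P.prob_space_distr[OF f])
    fix t :: "real ^ 'n"
    define c where "c l = (\<Sum>i\<in>UNIV. t $ i * B i l)" for l
    have tf: "t \<bullet> ?f y = (\<Sum>l\<in>UNIV. c l * y l)" for y
    proof -
      have "t \<bullet> ?f y = (\<Sum>i\<in>UNIV. \<Sum>l\<in>UNIV. t $ i * B i l * y l)"
        by (simp add: inner_vec_def sum_distrib_left mult.assoc)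
      also have "\<dots> = (\<Sum>l\<in>UNIV. \<Sum>i\<in>UNIV. t $ i * B i l * y l)" by (rule sum.swap)
      finally show ?thesis by (simp add: c_def sum_distrib_right)
    qed
    have tS: "t \<bullet> (S *v t) = (\<Sum>l\<in>UNIV. (c l)\<^sup>2)"
    proof -
      have "(c l)\<^sup>2 = (\<Sum>i\<in>UNIV. \<Sum>j\<in>UNIV. t $ i * t $ j * (B i l * B j l))" for l
        unfolding c_def power2_eq_square sum_product by (intro sum.cong refl) (simp add: mult_ac)
      then have "(\<Sum>l\<in>UNIV. (c l)\<^sup>2) = (\<Sum>l\<in>UNIV. \<Sum>i\<in>UNIV. \<Sum>j\<in>UNIV. t $ i * t $ j * (B i l * B j l))"
        by simp
      also have "\<dots> = (\<Sum>i\<in>UNIV. \<Sum>j\<in>UNIV. \<Sum>l\<in>UNIV. t $ i * t $ j * (B i l * B j l))"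
      proof -
        have "(\<Sum>l\<in>UNIV. \<Sum>i\<in>UNIV. \<Sum>j\<in>UNIV. t $ i * t $ j * (B i l * B j l))
          = (\<Sum>i\<in>UNIV. \<Sum>l\<in>UNIV. \<Sum>j\<in>UNIV. t $ i * t $ j * (B i l * B j l))" by (rule sum.swap)
        also have "\<dots> = (\<Sum>i\<in>UNIV. \<Sum>j\<in>UNIV. \<Sum>l\<in>UNIV. t $ i * t $ j * (B i l * B j l))"
          by (rule sum.cong[OF refl], rule sum.swap)
        finally show ?thesis .
      qed
      finally show ?thesis by (simp add: inner_matrix_vector_eq_sum B sum_distrib_left)
    qed
    have "distr (distr ?P borel ?f) borel (\<lambda>x. t \<bullet> x) = distr ?P borel ((\<lambda>x. t \<bullet> x) \<circ> ?f)"
      by (rule distr_distr[OF _ f]) measurable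
    also have "(\<lambda>x. t \<bullet> x) \<circ> ?f = (\<lambda>y. \<Sum>l\<in>UNIV. c l * y l)"
      unfolding o_def tf ..
    also have "distr ?P borel \<dots> = normal_law 0 (sqrt (t \<bullet> (S *v t)))"
      unfolding tS by (rule distr_std_normal_linear_combination)
    finally show "distr (distr ?P borel ?f) borel (\<lambda>x. t \<bullet> x) = normal_law 0 (sqrt (t \<bullet> (S *v t)))" .
  qed simp
qed

text \<open>
  The variances of all linear functionals determine the covariance matrix by polarization.
\<close>

lemma centered_normalI:
  fixes S :: "real ^ 'n ^ 'n"
  assumes sym: "\<And>i j. S $ i $ j = S $ j $ i" and psd: "\<And>t. 0 \<le> t \<bullet> (S *v t)"
    and L: "prob_space L" "sets L = sets borel"
    and nl: "\<And>t. distr L borel (\<lambda>x. t \<bullet> x) = normal_law 0 (sqrt (t \<bullet> (S *v t)))"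
  shows "centered_normal L S"
proof -
  note L(2) [measurable_cong]
  interpret prob_space L by fact
  have m [measurable]: "(\<lambda>x. t \<bullet> x) \<in> borel_measurable L" for t :: "real ^ 'n" by measurable
  note mom = normal_law_moments[OF real_sqrt_ge_zero[OF psd]]
  have i1: "integrable L (\<lambda>x. t \<bullet> x)" and e1: "(\<integral>x. t \<bullet> x \<partial>L) = 0"
    and i2: "integrable L (\<lambda>x. (t \<bullet> x)\<^sup>2)" and e2: "(\<integral>x. (t \<bullet> x)\<^sup>2 \<partial>L) = t \<bullet> (S *v t)" for t
    using mom[of t] psd[of t]
    by (simp_all flip: nl add: integrable_distr_eq integral_distr)
  have int: "integrable L (\<lambda>x. x)"
  proof -
    have "integrable L (\<lambda>x. \<Sum>b\<in>Basis. (b \<bullet> x) *\<^sub>R b)" using i1 by auto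
    then show ?thesis by (simp add: inner_commute[of _ "_ :: real ^ 'n"] euclidean_representation)
  qed
  have "(\<integral>x. x \<partial>L) = 0"
  proof (rule euclidean_eqI)
    fix b :: "real ^ 'n"
    show "(\<integral>x. x \<partial>L) \<bullet> b = 0 \<bullet> b"
      using e1[of b] int by (simp add: inner_commute)
  qed
  moreover have "cov_matrix L (\<lambda>x. x) = S"
  proof -
    have ax: "x $ i = axis i 1 \<bullet> x" for x :: "real ^ 'n" and i by (simp add: inner_axis')
    have mean: "(\<integral>y. y $ i \<partial>L) = 0" for i unfolding ax by (rule e1)
    have "(\<integral>x. x $ i * x $ j \<partial>L) = S $ i $ j" for i j
    proof -
      have pol: "x $ i * x $ j = (((axis i 1 + axis j 1) \<bullet> x)\<^sup>2 - (axis i 1 \<bullet> x)\<^sup>2 - (axis j 1 \<bullet> x)\<^sup>2) / 2" for x :: "real ^ 'n"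
        by (simp add: ax inner_add_left power2_eq_square algebra_simps)
      have "(\<integral>x. x $ i * x $ j \<partial>L) = ((axis i 1 + axis j 1) \<bullet> (S *v (axis i 1 + axis j 1))
          - axis i 1 \<bullet> (S *v axis i 1) - axis j 1 \<bullet> (S *v axis j 1)) / 2"
        unfolding pol using i2 by (simp add: e2)
      also have "\<dots> = S $ i $ j"
      proof -
        have "axis p 1 \<bullet> (S *v axis r 1) = S $ p $ r" for p r
          by (simp add: inner_axis' matrix_vector_mul_component inner_axis)
        then show ?thesis using sym[of i j]
          by (simp add: inner_add_left inner_add_right matrix_vector_right_distrib)
      qed
      finally show ?thesis .
    qed
    then show ?thesis by (simp add: cov_matrix_def mean vec_eq_iff)
  qed
  moreover have "\<exists>\<mu> \<sigma>. 0 \<le> \<sigma> \<and> distr L borel (\<lambda>x. t \<bullet> x) = normal_law \<mu> \<sigma>" for t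
    using nl[of t] psd[of t] real_sqrt_ge_zero by blast
  ultimately show ?thesis using L unfolding centered_normal_def by blast
qed

section \<open>Convergence in law by trigonometric polynomials\<close>

text \<open>
  The phase \<open>b\<close> makes sines and cosines special cases of one kind of generator, and it keeps the
  class closed under products by the product-to-sum formula.
\<close>

inductive trig_polynomial :: "('a::real_inner \<Rightarrow> real) \<Rightarrow> bool" where
  cos: "trig_polynomial (\<lambda>x. a * cos (t \<bullet> x + b))"
| add: "trig_polynomial f \<Longrightarrow> trig_polynomial g \<Longrightarrow> trig_polynomial (\<lambda>x. f x + g x)"

lemma trig_polynomial_const: "trig_polynomial (\<lambda>x. c)"
  using trig_polynomial.cos[of c 0 0] by simp

lemma trig_polynomial_sum:
  assumes "finite I" "\<And>i. i \<in> I \<Longrightarrow> trig_polynomial (f i)"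
  shows "trig_polynomial (\<lambda>x. \<Sum>i\<in>I. f i x)"
  using assms by (induction I rule: finite_induct) (auto intro: trig_polynomial_const trig_polynomial.add)

lemma trig_polynomial_mult:
  assumes "trig_polynomial f" "trig_polynomial g"
  shows "trig_polynomial (\<lambda>x. f x * g x)"
  using assms
proof (induction f)
  case (cos a t b)
  then show ?case
  proof (induction g)
    case (cos a' t' b')
    have "a * cos (t \<bullet> x + b) * (a' * cos (t' \<bullet> x + b'))
      = (a * a' / 2) * cos ((t - t') \<bullet> x + (b - b')) + (a * a' / 2) * cos ((t + t') \<bullet> x + (b + b'))" (is "_ = ?R x") for x
    proof -
      have arg: "(t - t') \<bullet> x + (b - b') = (t \<bullet> x + b) - (t' \<bullet> x + b')"
        "(t + t') \<bullet> x + (b + b') = (t \<bullet> x + b) + (t' \<bullet> x + b')"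
        by (simp_all add: inner_diff_left inner_add_left)
      show ?thesis
        unfolding arg cos_add[of "t \<bullet> x + b" "t' \<bullet> x + b'"] cos_diff[of "t \<bullet> x + b" "t' \<bullet> x + b'"]
        by (simp only: ring_distribs) (simp add: field_simps)
    qed
    moreover have "trig_polynomial ?R" by (intro trig_polynomial.intros)
    ultimately show ?case by simp
  next
    case (add g1 g2)
    then show ?case by (simp add: distrib_left trig_polynomial.add)
  qed
next
  case (add f1 f2)
  then show ?case by (simp add: distrib_right trig_polynomial.add)
qed

lemma trig_polynomial_sine_substitution:
  fixes p :: "real ^ 'n \<Rightarrow> real"
  assumes "real_polynomial_function p"
  shows "trig_polynomial (\<lambda>x. p (\<chi> i. sin (c * x $ i)))"
  using assms
proof (induction p rule: real_polynomial_function.induct)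
  case (linear f)
  then interpret bounded_linear f .
  have "f (\<chi> i. sin (c * x $ i)) = (\<Sum>i\<in>UNIV. f (axis i 1) * cos ((c *\<^sub>R axis i 1) \<bullet> x + (- pi / 2)))" for x :: "real ^ 'n"
  proof -
    have "(\<chi> i. sin (c * x $ i)) = (\<Sum>i\<in>UNIV. sin (c * x $ i) *\<^sub>R axis i 1)"
      by (simp add: vec_eq_iff axis_def if_distrib cong: if_cong)
    then have "f (\<chi> i. sin (c * x $ i)) = (\<Sum>i\<in>UNIV. sin (c * x $ i) * f (axis i 1))"
      by (simp add: sum scaleR)
    then show ?thesis
      by (simp add: inner_axis' cos_diff mult.commute flip: diff_conv_add_uminus)
  qed
  then show ?case by (simp only:) (intro trig_polynomial_sum trig_polynomial.cos finite)
qed (auto intro: trig_polynomial_const trig_polynomial.add trig_polynomial_mult)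

lemma trig_polynomial_bounded: "trig_polynomial f \<Longrightarrow> \<exists>B. \<forall>x. \<bar>f x\<bar> \<le> B"
proof (induction rule: trig_polynomial.induct)
  case (cos a t b)
  have "\<bar>a * cos (t \<bullet> x + b)\<bar> \<le> \<bar>a\<bar>" for x
    by (simp add: abs_mult mult_left_le)
  then show ?case by blast
next
  case (add f g)
  then obtain B C where "\<forall>x. \<bar>f x\<bar> \<le> B" "\<forall>x. \<bar>g x\<bar> \<le> C" by blast
  then have "\<bar>f x + g x\<bar> \<le> B + C" for x by (meson abs_triangle_ineq add_mono order_trans)
  then show ?case by blast
qed

lemma trig_polynomial_continuous: "trig_polynomial f \<Longrightarrow> continuous_on UNIV f"
  by (induction rule: trig_polynomial.induct) (auto intro!: continuous_intros)

lemma trig_polynomial_measurable: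
  fixes f :: "'a::euclidean_space \<Rightarrow> real"
  shows "trig_polynomial f \<Longrightarrow> f \<in> borel_measurable borel"
  by (intro borel_measurable_continuous_onI trig_polynomial_continuous)

lemma (in prob_space) integrable_trig_polynomial:
  fixes f :: "'b::euclidean_space \<Rightarrow> real"
  assumes f: "trig_polynomial f" and Z: "Z \<in> borel_measurable M"
  shows "integrable M (\<lambda>\<omega>. f (Z \<omega>))"
proof -
  obtain B where "\<forall>x. \<bar>f x\<bar> \<le> B" using trig_polynomial_bounded[OF f] by blast
  then show ?thesis
    using measurable_compose[OF Z trig_polynomial_measurable[OF f]]
    by (intro integrable_const_bound[of _ B]) auto
qed

lemma (in prob_space) integral_trig_polynomial_tendsto:
  fixes f :: "'b::euclidean_space \<Rightarrow> real"
  assumes f: "trig_polynomial f" and Y: "\<And>N. Y N \<in> borel_measurable M"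
    and L: "prob_space L" "sets L = sets borel"
    and conv: "\<And>t b. (\<lambda>N. \<integral>\<omega>. cos (t \<bullet> Y N \<omega> + b) \<partial>M) \<longlonglongrightarrow> (\<integral>x. cos (t \<bullet> x + b) \<partial>L)"
  shows "(\<lambda>N. \<integral>\<omega>. f (Y N \<omega>) \<partial>M) \<longlonglongrightarrow> (\<integral>x. f x \<partial>L)"
  using f
proof (induction rule: trig_polynomial.induct)
  case (cos a t b)
  show ?case using tendsto_mult_left[OF conv[of t b], of a] by simp
next
  case (add f g)
  note L(2)[measurable_cong]
  have "(\<lambda>x. x) \<in> borel_measurable L" by measurable
  with add show ?case
    using prob_space.integrable_trig_polynomial[OF L(1), of f "\<lambda>x. x"]
      prob_space.integrable_trig_polynomial[OF L(1), of g "\<lambda>x. x"]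
    by (simp add: integrable_trig_polynomial[OF _ Y] tendsto_add)
qed

text \<open>
  The substitution \<open>y $ i = sin (c * x $ i)\<close> with \<open>c = pi / (2 * K)\<close> maps the cube of half-width \<open>K\<close>
  onto the cube of half-width 1 and is inverted there by the arcsine. A polynomial close to the
  transported function on the latter cube therefore pulls back to a trigonometric polynomial close to \<open>f\<close> on the ball of radius \<open>K\<close>. Since
  sines never leave \<open>[-1, 1]\<close>, the bound of the polynomial on that cube holds on the whole space.
\<close>

lemma trig_polynomial_approximation:
  fixes f :: "real ^ 'n \<Rightarrow> real"
  assumes f: "continuous_on UNIV f" and B: "\<And>x. \<bar>f x\<bar> \<le> B" and K: "K > 0" and e: "e > 0"
  obtains p where "trig_polynomial p" "\<And>x. \<bar>p x\<bar> \<le> B + e" "\<And>x. norm x \<le> K \<Longrightarrow> \<bar>f x - p x\<bar> \<le> e"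
proof -
  define c where "c = pi / (2 * K)"
  have c: "c > 0" using K by (simp add: c_def)
  define S where "S = {y :: real ^ 'n. \<forall>i. y $ i \<in> {-1..1}}"
  have S: "S = cbox (\<chi> i. -1) (\<chi> i. 1)" by (auto simp: S_def mem_box_cart)
  have "continuous_on S (\<lambda>y. f (\<chi> i. arcsin (y $ i) / c))"
  proof (rule continuous_on_compose2[OF f])
    show "continuous_on S (\<lambda>y. \<chi> i. arcsin (y $ i) / c)"
      using c by (intro continuous_on_vec_lambda continuous_on_divide continuous_on_arcsin
          continuous_on_component continuous_on_id continuous_on_const) (auto simp: S_def)
  qed auto
  moreover have "compact S" unfolding S by (rule compact_cbox)
  ultimately obtain q where q: "real_polynomial_function q"
    and qe: "\<And>y. y \<in> S \<Longrightarrow> \<bar>f (\<chi> i. arcsin (y $ i) / c) - q y\<bar> < e"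
    using Stone_Weierstrass_real_polynomial_function e by blast
  define p where "p x = q (\<chi> i. sin (c * x $ i))" for x
  have sS: "(\<chi> i. sin (c * x $ i)) \<in> S" for x :: "real ^ 'n" by (simp add: S_def)
  show thesis
  proof
    show "trig_polynomial p" unfolding p_def by (rule trig_polynomial_sine_substitution[OF q])
    show "\<bar>p x\<bar> \<le> B + e" for x
      using qe[OF sS[of x]] B[of "\<chi> i. arcsin (sin (c * x $ i)) / c"] unfolding p_def by simp
    show "\<bar>f x - p x\<bar> \<le> e" if x: "norm x \<le> K" for x
    proof -
      have "arcsin (sin (c * x $ i)) = c * x $ i" for i
      proof (rule arcsin_sin)
        have "\<bar>x $ i\<bar> \<le> K" using component_le_norm_cart[of x i] x by simp
        then have "c * \<bar>x $ i\<bar> \<le> c * K" using c by (intro mult_left_mono) auto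
        also have "c * K = pi / 2" using K by (simp add: c_def)
        finally have "\<bar>c * x $ i\<bar> \<le> pi / 2" using c by (simp add: abs_mult)
        then show "- (pi / 2) \<le> c * x $ i" "c * x $ i \<le> pi / 2" by auto
      qed
      then show ?thesis using qe[OF sS[of x]] c unfolding p_def by simp
    qed
  qed
qed

lemma (in prob_space) integral_approximation_error:
  fixes Z :: "'a \<Rightarrow> real ^ 'n" and f p :: "real ^ 'n \<Rightarrow> real"
  assumes Z [measurable]: "Z \<in> borel_measurable M"
    and [measurable]: "f \<in> borel_measurable borel" "p \<in> borel_measurable borel"
    and f: "\<And>x. \<bar>f x\<bar> \<le> B" and p: "\<And>x. \<bar>p x\<bar> \<le> C"
    and fp: "\<And>x. norm x \<le> K \<Longrightarrow> \<bar>f x - p x\<bar> \<le> e" and e: "e \<ge> 0"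
  shows "\<bar>(\<integral>\<omega>. f (Z \<omega>) \<partial>M) - (\<integral>\<omega>. p (Z \<omega>) \<partial>M)\<bar> \<le> e + (B + C) * prob {\<omega> \<in> space M. K < norm (Z \<omega>)}"
proof -
  let ?A = "{\<omega> \<in> space M. K < norm (Z \<omega>)}"
  have [simp, measurable]: "?A \<in> sets M" by measurable
  have i: "integrable M (\<lambda>\<omega>. f (Z \<omega>))" "integrable M (\<lambda>\<omega>. p (Z \<omega>))"
    using f p by (auto intro: integrable_const_bound[of _ B] integrable_const_bound[of _ C])
  have ind: "integrable M (\<lambda>\<omega>. (B + C) * indicator ?A \<omega>)"
    by (intro integrable_mult_right integrable_real_indicator) (auto simp: emeasure_eq_measure)
  have "\<bar>(\<integral>\<omega>. f (Z \<omega>) \<partial>M) - (\<integral>\<omega>. p (Z \<omega>) \<partial>M)\<bar> = \<bar>\<integral>\<omega>. f (Z \<omega>) - p (Z \<omega>) \<partial>M\<bar>"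
    using i by simp
  also have "\<dots> \<le> (\<integral>\<omega>. \<bar>f (Z \<omega>) - p (Z \<omega>)\<bar> \<partial>M)" by (rule integral_abs_bound)
  also have "\<dots> \<le> (\<integral>\<omega>. e + (B + C) * indicator ?A \<omega> \<partial>M)"
  proof (rule integral_mono)
    fix \<omega> assume w: "\<omega> \<in> space M"
    have "\<bar>f (Z \<omega>) - p (Z \<omega>)\<bar> \<le> B + C" using f[of "Z \<omega>"] p[of "Z \<omega>"] by linarith
    then show "\<bar>f (Z \<omega>) - p (Z \<omega>)\<bar> \<le> e + (B + C) * indicator ?A \<omega>"
      using w fp[of "Z \<omega>"] e by (cases "norm (Z \<omega>) \<le> K") (auto simp: indicator_def)
  next
    show "integrable M (\<lambda>\<omega>. e + (B + C) * indicator ?A \<omega>)"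
      by (intro Bochner_Integration.integrable_add integrable_const ind)
  qed (use i in auto)
  also have "\<dots> = e + (B + C) * prob ?A"
    by (subst Bochner_Integration.integral_add[OF integrable_const ind]) (simp_all add: prob_space)
  finally show ?thesis .
qed

lemma (in prob_space) norm_tail_small:
  fixes Z :: "'a \<Rightarrow> 'b::euclidean_space"
  assumes [measurable]: "Z \<in> borel_measurable M" and e: "e > 0"
  shows "\<exists>K. prob {\<omega> \<in> space M. K < norm (Z \<omega>)} \<le> e"
proof -
  let ?A = "\<lambda>n::nat. {\<omega> \<in> space M. real n < norm (Z \<omega>)}"
  have "(\<lambda>n. prob (?A n)) \<longlonglongrightarrow> prob (\<Inter>n. ?A n)"
    by (intro finite_Lim_measure_decseq) (auto simp: decseq_def)
  moreover have "(\<Inter>n. ?A n) = {}"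
  proof -
    have "\<exists>n. norm (Z \<omega>) \<le> real n" for \<omega> by (rule real_arch_simple)
    then have "\<not> (\<forall>n. real n < norm (Z \<omega>))" for \<omega> by (meson not_less)
    then show ?thesis by auto
  qed
  ultimately have "(\<lambda>n. prob (?A n)) \<longlonglongrightarrow> 0" by simp
  then have "\<forall>\<^sub>F n in sequentially. prob (?A n) < e" using e by (rule order_tendstoD)
  then obtain n where "prob (?A n) < e" by (auto simp: eventually_sequentially)
  then show ?thesis by (intro exI[of _ "real n"]) simp
qed

text \<open>
  Tightness confines nearly all mass of the \<open>Y N\<close> and of \<open>L\<close> to one ball. There \<open>f\<close> may be replaced by a
  trigonometric polynomial, for which the convergence of the integrals follows from the hypothesis by
  linearity; outside of the ball the common bound of both functions suffices.
\<close>

lemma (in prob_space) converges_in_lawI: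
  fixes Y :: "nat \<Rightarrow> 'a \<Rightarrow> real ^ 'n"
  assumes Y [measurable]: "\<And>N. Y N \<in> borel_measurable M"
    and L: "prob_space L" "sets L = sets borel"
    and conv: "\<And>t b. (\<lambda>N. \<integral>\<omega>. cos (t \<bullet> Y N \<omega> + b) \<partial>M) \<longlonglongrightarrow> (\<integral>x. cos (t \<bullet> x + b) \<partial>L)"
    and tight: "\<And>e. e > 0 \<Longrightarrow> \<exists>K. \<forall>\<^sub>F N in sequentially. prob {\<omega> \<in> space M. K < norm (Y N \<omega>)} \<le> e"
  shows "converges_in_law M Y L"
  unfolding converges_in_law_def
proof (intro conjI allI impI)
  fix f :: "real ^ 'n \<Rightarrow> real"
  assume "continuous_on UNIV f \<and> bounded (range f)"
  then obtain B where f: "continuous_on UNIV f" and B: "\<And>x. \<bar>f x\<bar> \<le> B"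
    by (auto simp: bounded_iff)
  have B0: "B \<ge> 0" using B[of 0] by simp
  have fm: "f \<in> borel_measurable borel" using f by (rule borel_measurable_continuous_onI)
  interpret L: prob_space L by fact
  note L(2)[measurable_cong]
  have idm: "(\<lambda>x. x) \<in> borel_measurable L" by measurable
  show "(\<lambda>N. \<integral>\<omega>. f (Y N \<omega>) \<partial>M) \<longlonglongrightarrow> (\<integral>x. f x \<partial>L)"
  proof (rule tendstoI)
    fix \<epsilon> :: real assume \<epsilon>: "\<epsilon> > 0"
    (* The replacement costs at most e * (2 * B + 2) for Y N and for L, and the convergence of the
       integrals of the trigonometric polynomial another e: together e * (4 * B + 5). *)
    define e where "e = min 1 (\<epsilon> / (4 * B + 6))"
    have e: "e > 0" "e \<le> 1" "e \<le> \<epsilon> / (4 * B + 6)" using \<epsilon> B0 by (auto simp: e_def)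
    have "e * (4 * B + 5) < e * (4 * B + 6)" using e by simp
    also have "\<dots> \<le> \<epsilon>" using e(3) B0 by (simp add: pos_le_divide_eq)
    finally have eB: "e * (4 * B + 5) < \<epsilon>" .
    obtain K1 where K1: "\<forall>\<^sub>F N in sequentially. prob {\<omega> \<in> space M. K1 < norm (Y N \<omega>)} \<le> e"
      using tight[OF e(1)] by blast
    obtain K2 where K2: "L.prob {x \<in> space L. K2 < norm x} \<le> e"
      using L.norm_tail_small[OF idm e(1)] by blast
    define K where "K = max 1 (max K1 K2)"
    obtain p where p: "trig_polynomial p" and pB: "\<And>x. \<bar>p x\<bar> \<le> B + e"
      and pe: "\<And>x. norm x \<le> K \<Longrightarrow> \<bar>f x - p x\<bar> \<le> e"
    proof -
      have "K > 0" by (simp add: K_def)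
      from trig_polynomial_approximation[OF f B this e(1)] show thesis using that by blast
    qed
    note pm = trig_polynomial_measurable[OF p]
    have err: "e + (B + (B + e)) * q \<le> e * (2 * B + 2)" if "q \<le> e" "0 \<le> q" for q
    proof -
      have "(B + (B + e)) * q \<le> (2 * B + 1) * e" using that e B0 by (intro mult_mono) auto
      then show ?thesis by (simp add: algebra_simps)
    qed
    have "L.prob {x \<in> space L. K < norm x} \<le> L.prob {x \<in> space L. K2 < norm x}"
      by (intro L.finite_measure_mono) (auto simp: K_def)
    then have LK: "L.prob {x \<in> space L. K < norm x} \<le> e" using K2 by simp
    have Lerr: "\<bar>(\<integral>x. f x \<partial>L) - (\<integral>x. p x \<partial>L)\<bar> \<le> e * (2 * B + 2)"
      using L.integral_approximation_error[OF idm fm pm B pB pe] err[OF LK] e by fastforce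
    have "\<forall>\<^sub>F N in sequentially. dist (\<integral>\<omega>. p (Y N \<omega>) \<partial>M) (\<integral>x. p x \<partial>L) < e"
      using integral_trig_polynomial_tendsto[OF p Y L conv] e(1) by (rule tendstoD)
    with K1 show "\<forall>\<^sub>F N in sequentially. dist (\<integral>\<omega>. f (Y N \<omega>) \<partial>M) (\<integral>x. f x \<partial>L) < \<epsilon>"
    proof eventually_elim
      case (elim N)
      have "prob {\<omega> \<in> space M. K < norm (Y N \<omega>)} \<le> prob {\<omega> \<in> space M. K1 < norm (Y N \<omega>)}"
        by (intro finite_measure_mono) (auto simp: K_def)
      then have MK: "prob {\<omega> \<in> space M. K < norm (Y N \<omega>)} \<le> e" using elim(1) by simp
      have "\<bar>(\<integral>\<omega>. f (Y N \<omega>) \<partial>M) - (\<integral>\<omega>. p (Y N \<omega>) \<partial>M)\<bar> \<le> e * (2 * B + 2)"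
        using integral_approximation_error[OF Y[of N] fm pm B pB pe] err[OF MK] e by fastforce
      then have "\<bar>(\<integral>\<omega>. f (Y N \<omega>) \<partial>M) - (\<integral>x. f x \<partial>L)\<bar> < e * (2 * B + 2) + e + e * (2 * B + 2)"
        using Lerr elim(2) unfolding dist_real_def by linarith
      also have "\<dots> = e * (4 * B + 5)" by (simp add: algebra_simps)
      finally show ?case using eB by (simp add: dist_real_def)
    qed
  qed
qed (rule Y)

section \<open>Central limit theorem for linear functionals of a sample mean\<close>

lemma (in prob_space) indep_vars_comp_inj:
  assumes "indep_vars (\<lambda>_. N) X (f ` I)" "inj_on f I"
  shows "indep_vars (\<lambda>_. N) (\<lambda>i. X (f i)) I"
  unfolding indep_vars_def2
proof (intro conjI ballI)
  show "random_variable N (X (f i))" if "i \<in> I" for i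
    using assms(1) that by (auto simp: indep_vars_def2)
  show "indep_sets (\<lambda>i. {X (f i) -` A \<inter> space M |A. A \<in> sets N}) I"
  proof (rule indep_setsI)
    show "{X (f i) -` A \<inter> space M |A. A \<in> sets N} \<subseteq> events" if "i \<in> I" for i
      using assms(1) that by (auto simp: indep_vars_def2)
    fix A J assume J: "J \<noteq> {}" "J \<subseteq> I" "finite J"
      and A: "\<forall>j\<in>J. A j \<in> {X (f j) -` A \<inter> space M |A. A \<in> sets N}"
    then obtain B where B: "\<And>j. j \<in> J \<Longrightarrow> B j \<in> sets N \<and> A j = X (f j) -` B j \<inter> space M"
      by (simp add: subset_iff) metis
    have inj: "inj_on f J" using assms(2) J(2) by (rule inj_on_subset)
    have C: "the_inv_into J f (f j) = j" if "j \<in> J" for j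
      by (rule the_inv_into_f_f[OF inj that])
    define Q where "Q i = X i -` B (the_inv_into J f i) \<inter> space M" for i
    have "prob (\<Inter>i\<in>f ` J. Q i) = (\<Prod>i\<in>f ` J. prob (Q i))"
      unfolding Q_def using J B C by (intro indep_varsD[OF assms(1)]) auto
    moreover have QA: "Q (f j) = A j" if "j \<in> J" for j
      using B[OF that] C[OF that] by (simp add: Q_def)
    moreover have "(\<Inter>i\<in>f ` J. Q i) = (\<Inter>j\<in>J. A j)"
      using QA by auto
    ultimately show "prob (\<Inter>j\<in>J. A j) = (\<Prod>j\<in>J. prob (A j))"
      by (simp add: prod.reindex[OF inj])
  qed
qed

lemma (in prob_space) second_moment_indep_sum:
  fixes U :: "'i \<Rightarrow> 'a \<Rightarrow> real"
  assumes "finite I" and ind: "indep_vars (\<lambda>_. borel) U I"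
    and int: "\<And>i. i \<in> I \<Longrightarrow> integrable M (U i)" and mean: "\<And>i. i \<in> I \<Longrightarrow> expectation (U i) = 0"
    and sq: "\<And>i. i \<in> I \<Longrightarrow> integrable M (\<lambda>x. (U i x)\<^sup>2)"
  shows "integrable M (\<lambda>x. (\<Sum>i\<in>I. U i x)\<^sup>2) \<and>
    expectation (\<lambda>x. (\<Sum>i\<in>I. U i x)\<^sup>2) = (\<Sum>i\<in>I. expectation (\<lambda>x. (U i x)\<^sup>2))"
  using assms
proof (induction I rule: finite_induct)
  case empty
  then show ?case by simp
next
  case (insert i I)
  have IH: "integrable M (\<lambda>x. (\<Sum>i\<in>I. U i x)\<^sup>2)"
    "expectation (\<lambda>x. (\<Sum>i\<in>I. U i x)\<^sup>2) = (\<Sum>i\<in>I. expectation (\<lambda>x. (U i x)\<^sup>2))"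
    using insert by (auto intro: indep_vars_subset[OF insert.prems(1)])
  have iv: "indep_var borel (U i) borel (\<lambda>x. \<Sum>i\<in>I. U i x)"
    by (rule indep_vars_sum[OF insert.hyps insert.prems(1)])
  have iS: "integrable M (\<lambda>x. \<Sum>i\<in>I. U i x)" using insert.prems(2) by auto
  have ii: "integrable M (U i)" and mi: "expectation (U i) = 0" and si: "integrable M (\<lambda>x. (U i x)\<^sup>2)"
    using insert.prems by auto
  have c: "integrable M (\<lambda>x. U i x * (\<Sum>i\<in>I. U i x))" "expectation (\<lambda>x. U i x * (\<Sum>i\<in>I. U i x)) = 0"
    using indep_var_integrable[OF iv ii iS] indep_var_lebesgue_integral[OF iv ii iS] mi by auto
  have eq: "(\<Sum>i\<in>insert i I. U i x)\<^sup>2 = (U i x)\<^sup>2 + 2 * (U i x * (\<Sum>i\<in>I. U i x)) + (\<Sum>i\<in>I. U i x)\<^sup>2" for x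
    using insert.hyps by (simp add: power2_sum)
  show ?case unfolding eq using IH c si insert.hyps by simp
qed

text \<open>
  A cosine is a bounded continuous test function for the one-dimensional central limit theorem. If
  \<open>\<sigma> = 0\<close>, all \<open>U n\<close> vanish almost surely and the limit is the degenerate normal law.
\<close>

lemma (in prob_space) central_limit_cos:
  fixes U :: "nat \<Rightarrow> 'a \<Rightarrow> real"
  assumes ind: "indep_vars (\<lambda>_. borel) U {1..}"
    and distr: "\<And>n. n \<ge> 1 \<Longrightarrow> distr M borel (U n) = \<nu>"
    and int: "integrable \<nu> (\<lambda>x. x)" and mean: "(\<integral>x. x \<partial>\<nu>) = 0"
    and sq: "integrable \<nu> (\<lambda>x. x\<^sup>2)" and var: "(\<integral>x. x\<^sup>2 \<partial>\<nu>) = \<sigma>\<^sup>2" and \<sigma>: "\<sigma> \<ge> 0"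
  shows "(\<lambda>N. \<integral>\<omega>. cos ((\<Sum>n=1..N. U n \<omega>) / sqrt N + b) \<partial>M) \<longlonglongrightarrow> (\<integral>z. cos (z + b) \<partial>normal_law 0 \<sigma>)"
proof -
  have rv: "U n \<in> borel_measurable M" if "n \<ge> 1" for n
    using ind that by (auto simp: indep_vars_def2)
  have sets\<nu>: "sets \<nu> = sets borel" using distr[of 1] by (metis le_refl sets_distr)
  note sets\<nu> [measurable_cong]
  have tr: "integrable M (\<lambda>\<omega>. f (U n \<omega>))" "expectation (\<lambda>\<omega>. f (U n \<omega>)) = integral\<^sup>L \<nu> f"
    if "n \<ge> 1" "integrable \<nu> f" for n and f :: "real \<Rightarrow> real"
  proof -
    have f: "f \<in> borel_measurable borel"
      using borel_measurable_integrable[OF that(2)] by measurable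
    show "integrable M (\<lambda>\<omega>. f (U n \<omega>))"
      using that(2) integrable_distr_eq[OF rv[OF that(1)] f] unfolding distr[OF that(1)] by blast
    show "expectation (\<lambda>\<omega>. f (U n \<omega>)) = integral\<^sup>L \<nu> f"
      using integral_distr[OF rv[OF that(1)] f] unfolding distr[OF that(1)] by (rule sym)
  qed
  have I1: "expectation (U n) = 0" if "n \<ge> 1" for n
    using tr(2)[OF that int] unfolding mean .
  have I2: "integrable M (\<lambda>x. (U n x)\<^sup>2)" "expectation (\<lambda>x. (U n x)\<^sup>2) = \<sigma>\<^sup>2" if "n \<ge> 1" for n
    using tr[OF that sq] unfolding var .
  have lim: "(\<integral>z. cos (z + b) \<partial>normal_law 0 \<sigma>) = (\<integral>z. cos (\<sigma> * z + b) \<partial>std_normal_distribution)"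
    unfolding normal_law_eq_distr[OF \<sigma>] by (rule integral_distr) simp_all
  have shift: "(\<Sum>n=1..N. U n \<omega>) = (\<Sum>i<N. U (Suc i) \<omega>)" for N \<omega>
    by (rule sum.reindex_bij_witness[of _ Suc "\<lambda>n. n - 1"]) auto
  show ?thesis
  proof (cases "\<sigma> = 0")
    case True
    have "AE \<omega> in M. U n \<omega> = 0" if "n \<ge> 1" for n
      using integral_nonneg_eq_0_iff_AE[OF I2(1)[OF that]] I2(2)[OF that] True by simp
    then have "AE \<omega> in M. \<forall>n\<in>{1..}. U n \<omega> = 0"
      by (subst AE_ball_countable) auto
    then have "AE \<omega> in M. cos ((\<Sum>n=1..N. U n \<omega>) / sqrt N + b) = cos b" for N
      by eventually_elim simp
    then have "(\<integral>\<omega>. cos ((\<Sum>n=1..N. U n \<omega>) / sqrt N + b) \<partial>M) = (\<integral>\<omega>. cos b \<partial>M)" for N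
      using rv by (intro integral_cong_AE) auto
    moreover have "(\<integral>z. cos (z + b) \<partial>normal_law 0 \<sigma>) = cos b"
      using prob_space.prob_space[OF prob_space_std_normal] unfolding lim by (simp add: True)
    ultimately show ?thesis by (simp add: prob_space)
  next
    case False
    then have \<sigma>pos: "\<sigma> > 0" using \<sigma> by simp
    define U' where "U' n = U (Suc n)" for n
    have rv' [measurable]: "U' n \<in> borel_measurable M" for n unfolding U'_def by (rule rv) simp
    have "indep_vars (\<lambda>_. borel) U (Suc ` UNIV)"
      using ind by (rule indep_vars_subset) auto
    then have ind': "indep_vars (\<lambda>_. borel) U' UNIV"
      unfolding U'_def by (rule indep_vars_comp_inj) simp
    have "weak_conv_m (\<lambda>N. distr M borel (\<lambda>\<omega>. (\<Sum>i<N. U' i \<omega>) / sqrt (N * \<sigma>\<^sup>2))) std_normal_distribution"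
    proof (rule central_limit_theorem_zero_mean[OF ind' _ \<sigma>pos])
      show "expectation (U' n) = 0" for n unfolding U'_def by (rule I1) simp
      then show "variance (U' n) = \<sigma>\<^sup>2" for n using I2(2)[of "Suc n"] by (simp add: U'_def)
      show "integrable M (\<lambda>x. (U' n x)\<^sup>2)" for n unfolding U'_def by (rule I2) simp
      show "distr M borel (U' n) = \<nu>" for n unfolding U'_def by (rule distr) simp
    qed
    then have "(\<lambda>N. integral\<^sup>L (distr M borel (\<lambda>\<omega>. (\<Sum>i<N. U' i \<omega>) / sqrt (N * \<sigma>\<^sup>2))) (\<lambda>z. cos (\<sigma> * z + b)))
        \<longlonglongrightarrow> (\<integral>z. cos (\<sigma> * z + b) \<partial>std_normal_distribution)"
      by (intro weak_conv_imp_integral_bdd_continuous_conv[where B = 1] real_dist_normal_dist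
          real_distribution_distr) (auto intro!: continuous_intros)
    moreover have "integral\<^sup>L (distr M borel (\<lambda>\<omega>. (\<Sum>i<N. U' i \<omega>) / sqrt (N * \<sigma>\<^sup>2))) (\<lambda>z. cos (\<sigma> * z + b))
        = (\<integral>\<omega>. cos ((\<Sum>n=1..N. U n \<omega>) / sqrt N + b) \<partial>M)" for N
      unfolding shift U'_def[symmetric] using \<sigma>pos by (subst integral_distr) (simp_all add: real_sqrt_mult)
    ultimately show ?thesis unfolding lim by simp
  qed
qed

definition scaled_mean_error :: "(nat \<Rightarrow> 'w \<Rightarrow> real ^ 'n) \<Rightarrow> real ^ 'n \<Rightarrow> nat \<Rightarrow> 'w \<Rightarrow> real ^ 'n" where
  "scaled_mean_error Z \<mu> N \<omega> = sqrt (real N) *\<^sub>R (sample_mean N (\<lambda>n. Z n \<omega>) - \<mu>)"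

lemma inner_scaled_mean_error:
  "t \<bullet> scaled_mean_error Z \<mu> N \<omega> = (\<Sum>n=1..N. t \<bullet> (Z n \<omega> - \<mu>)) / sqrt N"
proof (cases "N = 0")
  case False
  have "(\<Sum>n=1..N. t \<bullet> (Z n \<omega> - \<mu>)) = t \<bullet> (\<Sum>n=1..N. Z n \<omega>) - real N * (t \<bullet> \<mu>)"
    by (simp add: inner_diff_right sum_subtractf inner_sum_right)
  moreover have "t \<bullet> scaled_mean_error Z \<mu> N \<omega> = sqrt N * ((1 / real N) * (t \<bullet> (\<Sum>n=1..N. Z n \<omega>)) - t \<bullet> \<mu>)"
    by (simp add: scaled_mean_error_def sample_mean_def inner_diff_right)
  moreover have "sqrt (real N) * (1 / real N) = 1 / sqrt N" "real N / sqrt N = sqrt N"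
    using False by (simp_all add: field_simps)
  ultimately show ?thesis
    by (simp add: diff_divide_distrib right_diff_distrib)
       (metis (no_types, lifting) mult.commute mult_cancel_right2 times_divide_eq_left times_divide_eq_right)
qed (simp add: scaled_mean_error_def)

context
  fixes D :: "(real ^ 'k) measure" and h :: "real ^ 'k \<Rightarrow> real ^ 'n"
  assumes D: "prob_space D" "sets D = sets borel"
    and h [measurable]: "h \<in> borel_measurable borel"
    and sq: "integrable D (\<lambda>x. (norm (h x))\<^sup>2)"
begin

interpretation D: prob_space D by (rule D(1))

lemma statistic_measurable_law: "h \<in> borel_measurable D"
  using h D(2) by (simp cong: measurable_cong_sets)

lemma integrable_of_square_integrable: "integrable D h"
  supply statistic_measurable_law [measurable]
proof -
  have "integrable D (\<lambda>x. norm (h x))"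
    by (rule D.square_integrable_imp_integrable) (use sq in auto)
  then show ?thesis by (simp add: integrable_norm_iff)
qed

lemma integrable_centered_square:
  "integrable D (\<lambda>x. (norm (h x - integral\<^sup>L D h))\<^sup>2)"
  supply statistic_measurable_law [measurable]
proof (rule Bochner_Integration.integrable_bound)
  show "integrable D (\<lambda>x. 2 * (norm (h x))\<^sup>2 + 2 * (norm (integral\<^sup>L D h))\<^sup>2)" using sq by simp
  have "(norm (a - b))\<^sup>2 \<le> 2 * (norm a)\<^sup>2 + 2 * (norm b)\<^sup>2" for a b :: "real ^ 'n"
  proof -
    have "(norm (a - b))\<^sup>2 \<le> (norm a + norm b)\<^sup>2" by (intro power_mono norm_triangle_ineq4) simp
    also have "\<dots> \<le> 2 * (norm a)\<^sup>2 + 2 * (norm b)\<^sup>2"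
      using zero_le_power2[of "norm a - norm b"] by (simp add: power2_sum power2_diff)
    finally show ?thesis .
  qed
  then show "AE x in D. norm ((norm (h x - integral\<^sup>L D h))\<^sup>2) \<le> norm (2 * (norm (h x))\<^sup>2 + 2 * (norm (integral\<^sup>L D h))\<^sup>2)"
    by simp
qed measurable

lemma cov_matrix_eq: "cov_matrix D h $ i $ j = (\<integral>x. (h x - integral\<^sup>L D h) $ i * (h x - integral\<^sup>L D h) $ j \<partial>D)"
proof -
  have "(\<integral>x. h x $ i \<partial>D) = integral\<^sup>L D h $ i" for i
    using integral_inner_left[of "axis i 1", OF integrable_of_square_integrable]
    by (simp add: inner_axis)
  then show ?thesis by (simp add: cov_matrix_def)
qed

lemma integrable_centered_product:
  "integrable D (\<lambda>x. (h x - integral\<^sup>L D h) $ i * (h x - integral\<^sup>L D h) $ j)"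
  supply statistic_measurable_law [measurable]
proof (rule Bochner_Integration.integrable_bound[OF integrable_centered_square])
  have "\<bar>v $ i * v $ j\<bar> \<le> (norm v)\<^sup>2" for v :: "real ^ 'n"
    unfolding abs_mult power2_eq_square by (intro mult_mono component_le_norm_cart) auto
  then show "AE x in D. norm ((h x - integral\<^sup>L D h) $ i * (h x - integral\<^sup>L D h) $ j) \<le> norm ((norm (h x - integral\<^sup>L D h))\<^sup>2)"
    by (simp del: vector_minus_component)
qed measurable

lemma linear_functional_moments:
  defines "u \<equiv> \<lambda>t x. t \<bullet> (h x - integral\<^sup>L D h)"
  shows "integrable D (u t)" "(\<integral>x. u t x \<partial>D) = 0"
    and "integrable D (\<lambda>x. (u t x)\<^sup>2)" "(\<integral>x. (u t x)\<^sup>2 \<partial>D) = t \<bullet> (cov_matrix D h *v t)"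
proof -
  have i: "integrable D (\<lambda>x. h x - integral\<^sup>L D h)"
    using integrable_of_square_integrable by simp
  show "integrable D (u t)" unfolding u_def using i by simp
  have "(\<integral>x. u t x \<partial>D) = t \<bullet> (\<integral>x. h x - integral\<^sup>L D h \<partial>D)"
    unfolding u_def using i by (intro integral_inner_right) simp
  also have "(\<integral>x. h x - integral\<^sup>L D h \<partial>D) = 0"
    using integrable_of_square_integrable D.prob_space by simp
  finally show "(\<integral>x. u t x \<partial>D) = 0" by simp
  have eq: "(u t x)\<^sup>2 = (\<Sum>i\<in>UNIV. \<Sum>j\<in>UNIV. t $ i * t $ j * ((h x - integral\<^sup>L D h) $ i * (h x - integral\<^sup>L D h) $ j))" for x
    unfolding u_def inner_vec_def power2_eq_square sum_product
    by (intro sum.cong refl) (simp add: mult_ac)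
  show "integrable D (\<lambda>x. (u t x)\<^sup>2)"
    unfolding eq by (intro Bochner_Integration.integrable_sum integrable_mult_right integrable_centered_product)
  have "(\<integral>x. (u t x)\<^sup>2 \<partial>D) = (\<Sum>i\<in>UNIV. \<Sum>j\<in>UNIV. t $ i * t $ j * cov_matrix D h $ i $ j)"
    unfolding eq cov_matrix_eq
    by (simp only: Bochner_Integration.integral_sum integrable_centered_product
        Bochner_Integration.integrable_sum integrable_mult_right integral_mult_right_zero)
  then show "(\<integral>x. (u t x)\<^sup>2 \<partial>D) = t \<bullet> (cov_matrix D h *v t)"
    by (simp only: inner_matrix_vector_eq_sum)
qed

lemma cov_matrix_symmetric: "cov_matrix D h $ i $ j = cov_matrix D h $ j $ i"
  unfolding cov_matrix_eq by (simp only: mult.commute)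

lemma cov_matrix_nonneg: "0 \<le> t \<bullet> (cov_matrix D h *v t)"
  unfolding linear_functional_moments(4)[symmetric] by simp

end

lemma random_sample_prob_space:
  assumes "random_sample M X D"
  shows "prob_space D" "sets D = sets borel"
proof -
  interpret prob_space M using assms by (simp add: random_sample_def)
  have D: "distr M borel (X 1) = D" and X: "X 1 \<in> borel_measurable M"
    using assms by (auto simp: random_sample_def indep_vars_def2)
  show "prob_space D" unfolding D[symmetric] by (rule prob_space_distr[OF X])
  show "sets D = sets borel" unfolding D[symmetric] by simp
qed

lemma sample_measurable: "random_sample M X D \<Longrightarrow> n \<ge> 1 \<Longrightarrow> X n \<in> borel_measurable M"
  by (auto simp: random_sample_def prob_space.indep_vars_def2)

context
  fixes M :: "'w measure" and X :: "nat \<Rightarrow> 'w \<Rightarrow> real ^ 'k" and D :: "(real ^ 'k) measure"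
    and h :: "real ^ 'k \<Rightarrow> real ^ 'n"
  assumes rs: "random_sample M X D" and h [measurable]: "h \<in> borel_measurable borel"
begin

interpretation prob_space M using rs by (simp add: random_sample_def)

private abbreviation "S \<equiv> scaled_mean_error (\<lambda>n \<omega>. h (X n \<omega>)) (integral\<^sup>L D h)"

lemma sample_mean_measurable: "(\<lambda>\<omega>. sample_mean N (\<lambda>n. h (X n \<omega>))) \<in> borel_measurable M"
proof -
  have "(\<lambda>\<omega>. h (X n \<omega>)) \<in> borel_measurable M" if "n \<in> {1..N}" for n
    using measurable_compose[OF sample_measurable[OF rs] h, of n] that by simp
  then show ?thesis unfolding sample_mean_def by (intro borel_measurable_scaleR borel_measurable_sum) auto
qed

lemma scaled_mean_error_measurable: "S N \<in> borel_measurable M"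
  unfolding scaled_mean_error_def using sample_mean_measurable by measurable

lemma functional_of_sample:
  defines "u \<equiv> \<lambda>t x. t \<bullet> (h x - integral\<^sup>L D h)"
  shows "indep_vars (\<lambda>_. borel) (\<lambda>n \<omega>. u t (X n \<omega>)) {1..}"
    and "\<And>n. n \<ge> 1 \<Longrightarrow> distr M borel (\<lambda>\<omega>. u t (X n \<omega>)) = distr D borel (u t)"
proof -
  have um: "u t \<in> borel_measurable borel" unfolding u_def by measurable
  have "indep_vars (\<lambda>_. borel) X {1..}" using rs by (simp add: random_sample_def)
  then show "indep_vars (\<lambda>_. borel) (\<lambda>n \<omega>. u t (X n \<omega>)) {1..}"
    by (rule indep_vars_compose2) (rule um)
  fix n :: nat assume n: "n \<ge> 1"
  have "D = distr M borel (X n)" using rs n by (simp add: random_sample_def)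
  then show "distr M borel (\<lambda>\<omega>. u t (X n \<omega>)) = distr D borel (u t)"
    using distr_distr[OF um sample_measurable[OF rs n]] by (simp add: o_def)
qed

lemma scaled_mean_error_cos_tendsto:
  assumes sq: "integrable D (\<lambda>x. (norm (h x))\<^sup>2)"
  shows "(\<lambda>N. \<integral>\<omega>. cos (t \<bullet> S N \<omega> + b) \<partial>M) \<longlonglongrightarrow>
     (\<integral>z. cos (z + b) \<partial>normal_law 0 (sqrt (t \<bullet> (cov_matrix D h *v t))))"
proof -
  note D = random_sample_prob_space[OF rs]
  note mom = linear_functional_moments[OF D h sq, of t]
  let ?u = "\<lambda>x. t \<bullet> (h x - integral\<^sup>L D h)"
  have "?u \<in> borel_measurable borel" by measurable
  then have um: "?u \<in> borel_measurable D" using D(2) by (simp cong: measurable_cong_sets)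
  have m: "(\<lambda>x::real. x) \<in> borel_measurable borel" "(\<lambda>x::real. x\<^sup>2) \<in> borel_measurable borel" by measurable
  note int = integrable_distr_eq[OF um m(1)] integrable_distr_eq[OF um m(2)]
    integral_distr[OF um m(1)] integral_distr[OF um m(2)]
  show ?thesis
    unfolding inner_scaled_mean_error
    by (rule central_limit_cos[OF functional_of_sample])
      (simp_all only: int mom cov_matrix_nonneg[OF D h sq] real_sqrt_ge_zero real_sqrt_pow2)
qed

text \<open>
  The bound does not depend on \<open>N\<close>; by Chebyshev's inequality it makes the scaled errors tight.
\<close>

lemma scaled_mean_error_second_moment:
  assumes sq: "integrable D (\<lambda>x. (norm (h x))\<^sup>2)"
  defines "C \<equiv> \<Sum>i\<in>UNIV. axis i 1 \<bullet> (cov_matrix D h *v axis i 1)"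
  shows "integrable M (\<lambda>\<omega>. (norm (S N \<omega>))\<^sup>2)" "expectation (\<lambda>\<omega>. (norm (S N \<omega>))\<^sup>2) \<le> C"
proof -
  note D = random_sample_prob_space[OF rs]
  note D(2)[measurable_cong]
  note mom = linear_functional_moments[OF D h sq]
  define u where "u t x = t \<bullet> (h x - integral\<^sup>L D h)" for t x
  have um: "u t \<in> borel_measurable borel" for t unfolding u_def by measurable
  have Q: "integrable M (\<lambda>\<omega>. (t \<bullet> S N \<omega>)\<^sup>2)"
    "expectation (\<lambda>\<omega>. (t \<bullet> S N \<omega>)\<^sup>2) \<le> t \<bullet> (cov_matrix D h *v t)" for t
  proof -
    have tr: "integrable M (\<lambda>\<omega>. f (u t (X n \<omega>)))" "expectation (\<lambda>\<omega>. f (u t (X n \<omega>))) = (\<integral>x. f (u t x) \<partial>D)"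
      if n: "n \<ge> 1" and f: "f \<in> borel_measurable borel" "integrable D (\<lambda>x. f (u t x))" for n and f :: "real \<Rightarrow> real"
    proof -
      have D': "D = distr M borel (X n)" using rs n by (simp add: random_sample_def)
      have fu: "(\<lambda>x. f (u t x)) \<in> borel_measurable borel" using measurable_compose[OF um f(1)] .
      show "integrable M (\<lambda>\<omega>. f (u t (X n \<omega>)))"
        using f(2) integrable_distr_eq[OF sample_measurable[OF rs n] fu] unfolding D' by blast
      show "expectation (\<lambda>\<omega>. f (u t (X n \<omega>))) = (\<integral>x. f (u t x) \<partial>D)"
        using integral_distr[OF sample_measurable[OF rs n] fu] unfolding D' by (rule sym)
    qed
    have m: "(\<lambda>x::real. x) \<in> borel_measurable borel" "(\<lambda>x::real. x\<^sup>2) \<in> borel_measurable borel" by measurable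
    have t1: "integrable M (\<lambda>\<omega>. u t (X n \<omega>))" "expectation (\<lambda>\<omega>. u t (X n \<omega>)) = 0"
      "integrable M (\<lambda>\<omega>. (u t (X n \<omega>))\<^sup>2)" "expectation (\<lambda>\<omega>. (u t (X n \<omega>))\<^sup>2) = t \<bullet> (cov_matrix D h *v t)" if "n \<ge> 1" for n
      using tr[OF that m(1)] tr[OF that m(2)] mom[of t] unfolding u_def by auto
    have ind: "indep_vars (\<lambda>_. borel) (\<lambda>n \<omega>. u t (X n \<omega>)) {1..N}"
      unfolding u_def by (rule indep_vars_subset[OF functional_of_sample(1)]) auto
    have s: "integrable M (\<lambda>x. (\<Sum>n=1..N. u t (X n x))\<^sup>2) \<and>
      expectation (\<lambda>x. (\<Sum>n=1..N. u t (X n x))\<^sup>2) = (\<Sum>n=1..N. expectation (\<lambda>x. (u t (X n x))\<^sup>2))"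
      by (rule second_moment_indep_sum[OF _ ind]) (auto simp: t1)
    have e: "(t \<bullet> S N \<omega>)\<^sup>2 = (\<Sum>n=1..N. u t (X n \<omega>))\<^sup>2 / real N" for \<omega>
      unfolding inner_scaled_mean_error u_def by (simp add: power_divide)
    show "integrable M (\<lambda>\<omega>. (t \<bullet> S N \<omega>)\<^sup>2)" unfolding e using s by (intro integrable_divide) auto
    have "expectation (\<lambda>\<omega>. (t \<bullet> S N \<omega>)\<^sup>2) = real N * (t \<bullet> (cov_matrix D h *v t)) / real N"
      unfolding e using s by (simp add: t1)
    also have "\<dots> \<le> t \<bullet> (cov_matrix D h *v t)"
      using cov_matrix_nonneg[OF D h sq, of t] by (cases "N = 0") auto
    finally show "expectation (\<lambda>\<omega>. (t \<bullet> S N \<omega>)\<^sup>2) \<le> t \<bullet> (cov_matrix D h *v t)" .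
  qed
  have n2: "(norm v)\<^sup>2 = (\<Sum>i\<in>UNIV. (axis i 1 \<bullet> v)\<^sup>2)" for v :: "real ^ 'n"
    unfolding power2_norm_eq_inner inner_vec_def[of v v] by (simp add: inner_axis' power2_eq_square)
  show "integrable M (\<lambda>\<omega>. (norm (S N \<omega>))\<^sup>2)" unfolding n2 using Q(1) by auto
  show "expectation (\<lambda>\<omega>. (norm (S N \<omega>))\<^sup>2) \<le> C"
    unfolding n2 C_def using Q by (simp add: sum_mono)
qed

end

section \<open>The multivariate delta method\<close>

lemma (in prob_space) second_moment_tail:
  fixes Z :: "'a \<Rightarrow> 'b::euclidean_space"
  assumes [measurable]: "Z \<in> borel_measurable M" and int: "integrable M (\<lambda>\<omega>. (norm (Z \<omega>))\<^sup>2)"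
    and C: "expectation (\<lambda>\<omega>. (norm (Z \<omega>))\<^sup>2) \<le> C" and K: "K > 0"
  shows "prob {\<omega> \<in> space M. K < norm (Z \<omega>)} \<le> C / K\<^sup>2"
proof -
  have "prob {\<omega> \<in> space M. K < norm (Z \<omega>)} \<le> prob {\<omega> \<in> space M. K\<^sup>2 \<le> (norm (Z \<omega>))\<^sup>2}"
    using K by (intro finite_measure_mono) (auto intro!: power_mono)
  also have "\<dots> \<le> expectation (\<lambda>\<omega>. (norm (Z \<omega>))\<^sup>2) / K\<^sup>2"
    by (rule integral_Markov_inequality_measure[OF int, of "{}"]) (use K in auto)
  also have "\<dots> \<le> C / K\<^sup>2" using C by (simp add: divide_right_mono)
  finally show ?thesis .
qed

text \<open>
  Where \<open>norm (S N) \<le> K\<close>, the argument of \<open>g\<close> is within \<open>K / sqrt N\<close> of \<open>\<mu>\<close>, so for large \<open>N\<close> the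
  differentiability of \<open>g\<close> bounds the linearization error by \<open>\<epsilon>\<close>. The complementary event has probability
  at most \<open>C / K\<^sup>2\<close>, uniformly in \<open>N\<close>.
\<close>

lemma (in prob_space) delta_method_remainder:
  fixes S :: "nat \<Rightarrow> 'a \<Rightarrow> 'b::euclidean_space" and g :: "'b \<Rightarrow> 'c::euclidean_space"
  assumes S [measurable]: "\<And>N. S N \<in> borel_measurable M"
    and int: "\<And>N. integrable M (\<lambda>\<omega>. (norm (S N \<omega>))\<^sup>2)"
    and C: "\<And>N. expectation (\<lambda>\<omega>. (norm (S N \<omega>))\<^sup>2) \<le> C"
    and g: "(g has_derivative A) (at \<mu>)"
    and T [measurable]: "\<And>N. T N \<in> borel_measurable M"
    and TS: "\<And>N \<omega>. N \<ge> 1 \<Longrightarrow> T N \<omega> = g (\<mu> + (1 / sqrt (real N)) *\<^sub>R S N \<omega>)"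
    and \<epsilon>: "\<epsilon> > 0"
  shows "(\<lambda>N. prob {\<omega> \<in> space M. \<epsilon> < norm (sqrt (real N) *\<^sub>R (T N \<omega> - g \<mu>) - A (S N \<omega>))}) \<longlonglongrightarrow> 0"
proof (rule tendstoI)
  fix e :: real assume e: "e > 0"
  interpret A: bounded_linear A using g by (rule has_derivative_bounded_linear)
  have [measurable]: "A \<in> borel_measurable borel"
    by (intro borel_measurable_continuous_onI linear_continuous_on A.bounded_linear_axioms)
  have C0: "C \<ge> 0"
  proof -
    have "0 \<le> expectation (\<lambda>\<omega>. (norm (S 0 \<omega>))\<^sup>2)" by simp
    then show ?thesis using C[of 0] by linarith
  qed
  define K where "K = sqrt ((C + 1) * 2 / e)"
  have K: "K > 0" "C / K\<^sup>2 < e"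
  proof -
    have pos: "(C + 1) * 2 / e > 0" using e C0 by simp
    then show "K > 0" by (simp add: K_def)
    have "C * e < (C + 1) * 2 * e" using e C0 by (intro mult_strict_right_mono) auto
    moreover have "K\<^sup>2 = (C + 1) * 2 / e" unfolding K_def using pos by (intro real_sqrt_pow2) simp
    ultimately show "C / K\<^sup>2 < e" using e C0 by (simp add: pos_divide_less_eq mult.commute)
  qed
  define \<eta> where "\<eta> = \<epsilon> / K"
  have \<eta>: "\<eta> > 0" using \<epsilon> K by (simp add: \<eta>_def)
  obtain \<delta> where \<delta>: "\<delta> > 0"
    and lin: "\<And>v. norm (v - \<mu>) < \<delta> \<Longrightarrow> norm (g v - g \<mu> - A (v - \<mu>)) \<le> \<eta> * norm (v - \<mu>)"
    using g \<eta> unfolding has_derivative_at_alt by blast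
  obtain N0 :: nat where N0: "K / \<delta> < real N0" using reals_Archimedean2 by blast
  define N1 where "N1 = Suc (N0\<^sup>2)"
  have "prob {\<omega> \<in> space M. \<epsilon> < norm (sqrt (real N) *\<^sub>R (T N \<omega> - g \<mu>) - A (S N \<omega>))} \<le> prob {\<omega> \<in> space M. K < norm (S N \<omega>)}"
    if N: "N \<ge> N1" for N
  proof (rule finite_measure_mono)
    have N': "N \<ge> 1" using N by (simp add: N1_def)
    have "real N0 = sqrt (real (N0\<^sup>2))" by simp
    also have "\<dots> \<le> sqrt (real N)" using N unfolding N1_def by (intro real_sqrt_le_mono) (simp only: of_nat_le_iff)
    finally have rN: "K / \<delta> < sqrt N" using N0 by simp
    have sN: "sqrt (real N) > 0" using N' by simp
    have "norm (sqrt (real N) *\<^sub>R (T N \<omega> - g \<mu>) - A (S N \<omega>)) \<le> \<epsilon>" if le: "norm (S N \<omega>) \<le> K" for \<omega>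
    proof -
      define v where "v = \<mu> + (1 / sqrt (real N)) *\<^sub>R S N \<omega>"
      have vm: "v - \<mu> = (1 / sqrt (real N)) *\<^sub>R S N \<omega>" by (simp add: v_def)
      have nv: "norm (v - \<mu>) = norm (S N \<omega>) / sqrt N" unfolding vm using sN by simp
      have "norm (v - \<mu>) \<le> K / sqrt N" unfolding nv using le sN by (simp add: divide_right_mono)
      also have "\<dots> < \<delta>" using rN \<delta> sN by (simp add: field_simps)
      finally have b: "norm (g v - g \<mu> - A (v - \<mu>)) \<le> \<eta> * norm (v - \<mu>)" by (rule lin)
      have "sqrt (real N) *\<^sub>R (T N \<omega> - g \<mu>) - A (S N \<omega>) = sqrt (real N) *\<^sub>R (g v - g \<mu> - A (v - \<mu>))"
        using sN unfolding TS[OF N'] v_def[symmetric] vm by (simp add: A.scaleR scaleR_right_diff_distrib)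
      then have "norm (sqrt (real N) *\<^sub>R (T N \<omega> - g \<mu>) - A (S N \<omega>)) = sqrt N * norm (g v - g \<mu> - A (v - \<mu>))"
        using sN by simp
      also have "\<dots> \<le> sqrt N * (\<eta> * norm (v - \<mu>))" using b sN by (intro mult_left_mono) auto
      also have "\<dots> = \<eta> * norm (S N \<omega>)" unfolding nv using sN by simp
      also have "\<dots> \<le> \<eta> * K" using le \<eta> by (intro mult_left_mono) auto
      also have "\<dots> = \<epsilon>" using K by (simp add: \<eta>_def)
      finally show ?thesis .
    qed
    then show "{\<omega> \<in> space M. \<epsilon> < norm (sqrt (real N) *\<^sub>R (T N \<omega> - g \<mu>) - A (S N \<omega>))} \<subseteq> {\<omega> \<in> space M. K < norm (S N \<omega>)}"
      by (force simp: not_le[symmetric])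
  qed measurable
  moreover have "prob {\<omega> \<in> space M. K < norm (S N \<omega>)} < e" for N
    using second_moment_tail[OF S int C K(1), of N] K(2) by linarith
  ultimately have "dist (prob {\<omega> \<in> space M. \<epsilon> < norm (sqrt (real N) *\<^sub>R (T N \<omega> - g \<mu>) - A (S N \<omega>))}) 0 < e"
    if "N \<ge> N1" for N
    using that by (simp add: dist_real_def) (meson order_le_less_trans)
  then show "\<forall>\<^sub>F N in sequentially. dist (prob {\<omega> \<in> space M. \<epsilon> < norm (sqrt (real N) *\<^sub>R (T N \<omega> - g \<mu>) - A (S N \<omega>))}) 0 < e"
    by (auto simp: eventually_sequentially)
qed

lemma abs_cos_diff_le: "\<bar>cos a - cos b\<bar> \<le> \<bar>a - b\<bar>" for a b :: real
proof -
  have "\<bar>cos a - cos b\<bar> = 2 * \<bar>sin ((a + b) / 2)\<bar> * \<bar>sin ((b - a) / 2)\<bar>"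
    by (simp add: cos_diff_cos abs_mult)
  also have "\<dots> \<le> 2 * 1 * \<bar>(b - a) / 2\<bar>"
    by (intro mult_mono abs_sin_x_le_abs_x) auto
  finally show ?thesis by simp
qed

text \<open>
  This is Slutsky's lemma for the test functions in use: the cosine is bounded and has Lipschitz
  constant 1, so a perturbation that tends to 0 in probability does not change the limit.
\<close>

lemma (in prob_space) integral_cos_perturbation:
  fixes P R :: "nat \<Rightarrow> 'a \<Rightarrow> 'b::euclidean_space"
  assumes P [measurable]: "\<And>N. P N \<in> borel_measurable M" and R [measurable]: "\<And>N. R N \<in> borel_measurable M"
    and lim: "(\<lambda>N. \<integral>\<omega>. cos (t \<bullet> P N \<omega> + b) \<partial>M) \<longlonglongrightarrow> l"
    and R0: "\<And>\<epsilon>. \<epsilon> > 0 \<Longrightarrow> (\<lambda>N. prob {\<omega> \<in> space M. \<epsilon> < norm (R N \<omega>)}) \<longlonglongrightarrow> 0"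
  shows "(\<lambda>N. \<integral>\<omega>. cos (t \<bullet> (P N \<omega> + R N \<omega>) + b) \<partial>M) \<longlonglongrightarrow> l"
proof -
  have ic: "integrable M (\<lambda>\<omega>. cos (t \<bullet> Z \<omega> + b))" if [measurable]: "Z \<in> borel_measurable M" for Z
    by (rule integrable_const_bound[of _ 1]) auto
  have "(\<lambda>N. (\<integral>\<omega>. cos (t \<bullet> (P N \<omega> + R N \<omega>) + b) \<partial>M) - (\<integral>\<omega>. cos (t \<bullet> P N \<omega> + b) \<partial>M)) \<longlonglongrightarrow> 0"
  proof (rule tendstoI)
    fix e :: real assume e: "e > 0"
    define \<tau> where "\<tau> = norm t + 1"
    define \<epsilon> where "\<epsilon> = e / (2 * \<tau>)"
    have t1: "\<tau> > 0" "norm t \<le> \<tau>" using norm_ge_zero[of t] unfolding \<tau>_def by linarith+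
    have \<epsilon>: "\<epsilon> > 0" using e t1 by (simp add: \<epsilon>_def)
    have "norm t * \<epsilon> \<le> \<tau> * \<epsilon>" using \<epsilon> t1 by (intro mult_right_mono) auto
    also have "\<dots> = e / 2" using t1 by (simp add: \<epsilon>_def)
    finally have te: "norm t * \<epsilon> \<le> e / 2" .
    have "\<forall>\<^sub>F N in sequentially. prob {\<omega> \<in> space M. \<epsilon> < norm (R N \<omega>)} < e / 4"
      using R0[OF \<epsilon>] e by (intro order_tendstoD) auto
    then show "\<forall>\<^sub>F N in sequentially. dist ((\<integral>\<omega>. cos (t \<bullet> (P N \<omega> + R N \<omega>) + b) \<partial>M) - (\<integral>\<omega>. cos (t \<bullet> P N \<omega> + b) \<partial>M)) 0 < e"
    proof eventually_elim
      case (elim N)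
      let ?E = "{\<omega> \<in> space M. \<epsilon> < norm (R N \<omega>)}"
      have E [measurable]: "?E \<in> sets M" by measurable
      have ind: "integrable M (\<lambda>\<omega>. 2 * indicator ?E \<omega> :: real)"
        by (intro integrable_mult_right integrable_real_indicator) (auto simp: emeasure_eq_measure)
      have i: "integrable M (\<lambda>\<omega>. cos (t \<bullet> (P N \<omega> + R N \<omega>) + b))" "integrable M (\<lambda>\<omega>. cos (t \<bullet> P N \<omega> + b))"
        by (rule ic, measurable)+
      have "\<bar>(\<integral>\<omega>. cos (t \<bullet> (P N \<omega> + R N \<omega>) + b) \<partial>M) - (\<integral>\<omega>. cos (t \<bullet> P N \<omega> + b) \<partial>M)\<bar>
          = \<bar>\<integral>\<omega>. cos (t \<bullet> (P N \<omega> + R N \<omega>) + b) - cos (t \<bullet> P N \<omega> + b) \<partial>M\<bar>"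
        by (subst Bochner_Integration.integral_diff[OF i]) (rule refl)
      also have "\<dots> \<le> (\<integral>\<omega>. \<bar>cos (t \<bullet> (P N \<omega> + R N \<omega>) + b) - cos (t \<bullet> P N \<omega> + b)\<bar> \<partial>M)"
        by (rule integral_abs_bound)
      also have "\<dots> \<le> (\<integral>\<omega>. norm t * \<epsilon> + 2 * indicator ?E \<omega> \<partial>M)"
      proof (rule integral_mono)
        fix \<omega> assume w: "\<omega> \<in> space M"
        have c2: "\<bar>cos x - cos y\<bar> \<le> 2" for x y :: real
          using cos_le_one[of x] cos_le_one[of y] cos_ge_minus_one[of x] cos_ge_minus_one[of y] by linarith
        show "\<bar>cos (t \<bullet> (P N \<omega> + R N \<omega>) + b) - cos (t \<bullet> P N \<omega> + b)\<bar> \<le> norm t * \<epsilon> + 2 * indicator ?E \<omega>"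
        proof (cases "\<epsilon> < norm (R N \<omega>)")
          case True
          then show ?thesis using w \<epsilon> c2 by (simp add: add_increasing)
        next
          case False
          have "\<bar>cos (t \<bullet> (P N \<omega> + R N \<omega>) + b) - cos (t \<bullet> P N \<omega> + b)\<bar> \<le> \<bar>t \<bullet> R N \<omega>\<bar>"
            using abs_cos_diff_le[of "t \<bullet> (P N \<omega> + R N \<omega>) + b" "t \<bullet> P N \<omega> + b"] by (simp add: inner_add_right)
          also have "\<dots> \<le> norm t * norm (R N \<omega>)" by (rule Cauchy_Schwarz_ineq2)
          also have "\<dots> \<le> norm t * \<epsilon>" using False by (intro mult_left_mono) auto
          finally show ?thesis using False by simp
        qed
      next
        show "integrable M (\<lambda>\<omega>. norm t * \<epsilon> + 2 * indicator ?E \<omega>)"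
          by (intro Bochner_Integration.integrable_add integrable_const ind)
      qed (use i in auto)
      also have "\<dots> = norm t * \<epsilon> + 2 * prob ?E"
        by (subst Bochner_Integration.integral_add[OF integrable_const ind]) (simp_all add: prob_space)
      also have "\<dots> < e" using te elim by linarith
      finally show ?case by (simp add: dist_real_def)
    qed
  qed
  from tendsto_add[OF this lim] show ?thesis by simp
qed

lemma quadratic_form_congruence:
  fixes A :: "real ^ 'n ^ 'd" and V :: "real ^ 'n ^ 'n"
  shows "t \<bullet> ((A ** V ** transpose A) *v t) = (transpose A *v t) \<bullet> (V *v (transpose A *v t))"
  by (simp add: matrix_vector_mul_assoc[symmetric] dot_lmul_matrix[symmetric] transpose_matrix_vector)

text \<open>
  The scaled error of \<open>T N\<close> is the linear image under \<open>A\<close> of the scaled error of the sample mean, plus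
  a remainder that tends to 0 in probability. Hence its functional along \<open>t\<close> behaves like the functional
  of the sample mean along \<open>transpose A *v t\<close>, whose limiting variance is the quadratic form of
  \<open>A ** cov_matrix D h ** transpose A\<close> at \<open>t\<close>. Tightness also shows that \<open>T N\<close> approaches an interior
  point of \<open>\<Theta>\<close>, so that the estimator exists with probability tending to 1.
\<close>

lemma delta_method:
  fixes M :: "'w measure" and X :: "nat \<Rightarrow> 'w \<Rightarrow> real ^ 'k" and D :: "(real ^ 'k) measure"
    and h :: "real ^ 'k \<Rightarrow> real ^ 'n" and g :: "real ^ 'n \<Rightarrow> real ^ 'd" and A :: "real ^ 'n ^ 'd"
  assumes rs: "random_sample M X D" and h [measurable]: "h \<in> borel_measurable borel"
    and sq: "integrable D (\<lambda>x. (norm (h x))\<^sup>2)"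
    and g [measurable]: "g \<in> borel_measurable borel"
    and deriv: "(g has_derivative (\<lambda>v. A *v v)) (at (integral\<^sup>L D h))"
    and \<Theta>: "open \<Theta>" "g (integral\<^sup>L D h) \<in> \<Theta>"
    and T: "\<And>N \<omega>. T N \<omega> = g (sample_mean N (\<lambda>n. h (X n \<omega>)))"
  shows "has_asymptotic_cov M \<Theta> T (g (integral\<^sup>L D h)) (A ** cov_matrix D h ** transpose A)"
proof -
  interpret prob_space M using rs by (simp add: random_sample_def)
  note D = random_sample_prob_space[OF rs]
  define \<mu> where "\<mu> = integral\<^sup>L D h"
  define V where "V = cov_matrix D h"
  define \<Sigma> where "\<Sigma> = A ** V ** transpose A"
  define S where "S = scaled_mean_error (\<lambda>n \<omega>. h (X n \<omega>)) \<mu>"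
  define C where "C = (\<Sum>i\<in>UNIV. axis i 1 \<bullet> (V *v axis i 1))"
  define Y where "Y N \<omega> = sqrt (real N) *\<^sub>R (T N \<omega> - g \<mu>)" for N \<omega>
  define R where "R N \<omega> = Y N \<omega> - A *v S N \<omega>" for N \<omega>
  note deriv = deriv[folded \<mu>_def]
  have S [measurable]: "S N \<in> borel_measurable M" for N
    unfolding S_def \<mu>_def by (rule scaled_mean_error_measurable[OF rs h])
  have S2: "integrable M (\<lambda>\<omega>. (norm (S N \<omega>))\<^sup>2)" "expectation (\<lambda>\<omega>. (norm (S N \<omega>))\<^sup>2) \<le> C" for N
    unfolding S_def \<mu>_def C_def V_def using scaled_mean_error_second_moment[OF rs h sq] by auto
  have T_meas [measurable]: "T N \<in> borel_measurable M" for N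
    unfolding T[abs_def] using sample_mean_measurable[OF rs h] by measurable
  have Y [measurable]: "Y N \<in> borel_measurable M" for N unfolding Y_def by measurable
  have lin: "bounded_linear (\<lambda>v. A *v v)" using deriv by (rule has_derivative_bounded_linear)
  have AS [measurable]: "(\<lambda>\<omega>. A *v S N \<omega>) \<in> borel_measurable M" for N
    by (rule measurable_compose[OF S borel_measurable_continuous_onI[OF linear_continuous_on[OF lin]]])
  have R_meas [measurable]: "R N \<in> borel_measurable M" for N unfolding R_def by measurable
  have TS: "T N \<omega> = g (\<mu> + (1 / sqrt (real N)) *\<^sub>R S N \<omega>)" if "N \<ge> 1" for N \<omega>
    using that unfolding T S_def scaled_mean_error_def by simp
  have R0: "(\<lambda>N. prob {\<omega> \<in> space M. \<epsilon> < norm (R N \<omega>)}) \<longlonglongrightarrow> 0" if "\<epsilon> > 0" for \<epsilon>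
    unfolding R_def Y_def by (rule delta_method_remainder[OF S S2 deriv T_meas TS that])
  have tight: "\<exists>K. \<forall>\<^sub>F N in sequentially. prob {\<omega> \<in> space M. K < norm (Y N \<omega>)} \<le> e" if e: "e > 0" for e
  proof -
    obtain B where B: "B > 0" "\<And>v. norm (A *v v) \<le> norm v * B"
      using bounded_linear.pos_bounded[OF lin] by blast
    have C0: "C \<ge> 0"
      unfolding C_def V_def by (intro sum_nonneg cov_matrix_nonneg[OF D h sq])
    define \<kappa> where "\<kappa> = sqrt (2 * (C + 1) / e)"
    have pos: "2 * (C + 1) / e > 0" using e C0 by simp
    have \<kappa>: "\<kappa> > 0" using pos by (simp add: \<kappa>_def)
    have \<kappa>2: "\<kappa>\<^sup>2 = 2 * (C + 1) / e" unfolding \<kappa>_def using pos by (intro real_sqrt_pow2) simp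
    have "C * e \<le> (C + 1) * e" using e by simp
    then have Ck: "C / \<kappa>\<^sup>2 \<le> e / 2" unfolding \<kappa>2 using e C0 by (simp add: field_simps)
    have "\<forall>\<^sub>F N in sequentially. prob {\<omega> \<in> space M. B * \<kappa> < norm (R N \<omega>)} < e / 2"
      using R0[of "B * \<kappa>"] B \<kappa> e by (intro order_tendstoD) auto
    then have "\<forall>\<^sub>F N in sequentially. prob {\<omega> \<in> space M. 2 * (B * \<kappa>) < norm (Y N \<omega>)} \<le> e"
    proof eventually_elim
      case (elim N)
      have "{\<omega> \<in> space M. 2 * (B * \<kappa>) < norm (Y N \<omega>)}
          \<subseteq> {\<omega> \<in> space M. \<kappa> < norm (S N \<omega>)} \<union> {\<omega> \<in> space M. B * \<kappa> < norm (R N \<omega>)}"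
      proof safe
        fix \<omega> assume Yb: "2 * (B * \<kappa>) < norm (Y N \<omega>)" and Rb: "\<not> B * \<kappa> < norm (R N \<omega>)"
        have "norm (Y N \<omega>) \<le> norm (A *v S N \<omega>) + norm (R N \<omega>)"
          using norm_triangle_ineq[of "A *v S N \<omega>" "R N \<omega>"] by (simp add: R_def)
        also have "norm (A *v S N \<omega>) \<le> norm (S N \<omega>) * B" by (rule B)
        finally have "\<kappa> * B < norm (S N \<omega>) * B" using Yb Rb by (simp add: mult.commute)
        then show "\<kappa> < norm (S N \<omega>)" using B by simp
      qed
      then have "prob {\<omega> \<in> space M. 2 * (B * \<kappa>) < norm (Y N \<omega>)}
          \<le> prob ({\<omega> \<in> space M. \<kappa> < norm (S N \<omega>)} \<union> {\<omega> \<in> space M. B * \<kappa> < norm (R N \<omega>)})"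
        by (intro finite_measure_mono) auto
      also have "\<dots> \<le> prob {\<omega> \<in> space M. \<kappa> < norm (S N \<omega>)} + prob {\<omega> \<in> space M. B * \<kappa> < norm (R N \<omega>)}"
        by (intro measure_Un_le) auto
      also have "\<dots> \<le> e"
        using second_moment_tail[OF S S2 \<kappa>, of N] Ck elim by linarith
      finally show ?case .
    qed
    then show ?thesis by blast
  qed
  have sym: "\<Sigma> $ i $ j = \<Sigma> $ j $ i" for i j
  proof -
    have "transpose V = V"
      using cov_matrix_symmetric[OF D h sq] by (simp add: V_def transpose_def vec_eq_iff)
    then have "transpose \<Sigma> = \<Sigma>"
      by (simp add: \<Sigma>_def matrix_transpose_mul matrix_mul_assoc)
    then show ?thesis by (metis transpose_def vec_lambda_beta)
  qed
  have q: "t \<bullet> (\<Sigma> *v t) = (transpose A *v t) \<bullet> (V *v (transpose A *v t))" for t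
    unfolding \<Sigma>_def by (rule quadratic_form_congruence)
  have psd: "0 \<le> t \<bullet> (\<Sigma> *v t)" for t
    unfolding q V_def by (rule cov_matrix_nonneg[OF D h sq])
  obtain L where L: "prob_space L" "sets L = sets borel"
    and nl: "\<And>t. distr L borel (\<lambda>x. t \<bullet> x) = normal_law 0 (sqrt (t \<bullet> (\<Sigma> *v t)))"
    using normal_law_with_covariance_exists[OF sym psd] by blast
  have "converges_in_law M Y L"
  proof (rule converges_in_lawI[OF Y L _ tight])
    fix t :: "real ^ 'd" and b :: real
    have "(\<lambda>N. \<integral>\<omega>. cos (t \<bullet> (A *v S N \<omega>) + b) \<partial>M) \<longlonglongrightarrow> (\<integral>z. cos (z + b) \<partial>normal_law 0 (sqrt (t \<bullet> (\<Sigma> *v t))))"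
      using scaled_mean_error_cos_tendsto[OF rs h sq, of "transpose A *v t" b]
      unfolding q V_def S_def \<mu>_def by (simp add: dot_lmul_matrix transpose_matrix_vector)
    from integral_cos_perturbation[OF AS R_meas this R0]
    have "(\<lambda>N. \<integral>\<omega>. cos (t \<bullet> Y N \<omega> + b) \<partial>M) \<longlonglongrightarrow> (\<integral>z. cos (z + b) \<partial>normal_law 0 (sqrt (t \<bullet> (\<Sigma> *v t))))"
      by (simp add: R_def)
    also have "(\<integral>z. cos (z + b) \<partial>normal_law 0 (sqrt (t \<bullet> (\<Sigma> *v t)))) = (\<integral>x. cos (t \<bullet> x + b) \<partial>L)"
    proof -
      have "(\<lambda>x. t \<bullet> x) \<in> borel_measurable L" using L(2) by (simp cong: measurable_cong_sets)
      then show ?thesis unfolding nl[symmetric] by (rule integral_distr) measurable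
    qed
    finally show "(\<lambda>N. \<integral>\<omega>. cos (t \<bullet> Y N \<omega> + b) \<partial>M) \<longlonglongrightarrow> (\<integral>x. cos (t \<bullet> x + b) \<partial>L)" .
  qed
  moreover have "centered_normal L \<Sigma>"
    by (rule centered_normalI[OF sym psd L nl])
  moreover have "(\<lambda>N. measure M {\<omega> \<in> space M. T N \<omega> \<in> \<Theta>}) \<longlonglongrightarrow> 1"
  proof (rule tendstoI)
    fix e :: real assume e: "e > 0"
    obtain \<delta> where \<delta>: "\<delta> > 0" "ball (g \<mu>) \<delta> \<subseteq> \<Theta>"
      using \<Theta> unfolding \<mu>_def open_contains_ball by blast
    have [measurable]: "\<Theta> \<in> sets borel" using \<Theta>(1) by simp
    obtain K where K: "\<forall>\<^sub>F N in sequentially. prob {\<omega> \<in> space M. K < norm (Y N \<omega>)} \<le> e / 2"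
      using tight[of "e / 2"] e by auto
    have "filterlim (\<lambda>N. sqrt (real N)) at_top sequentially"
      by (rule filterlim_compose[OF sqrt_at_top filterlim_real_sequentially])
    then have "\<forall>\<^sub>F N in sequentially. max 1 (K / \<delta>) < sqrt (real N)"
      unfolding filterlim_at_top_dense by blast
    with K show "\<forall>\<^sub>F N in sequentially. dist (measure M {\<omega> \<in> space M. T N \<omega> \<in> \<Theta>}) 1 < e"
    proof eventually_elim
      case (elim N)
      have sN: "sqrt (real N) > 0" "K < \<delta> * sqrt (real N)" using elim(2) \<delta> by (auto simp: pos_divide_less_eq mult.commute)
      have "space M - {\<omega> \<in> space M. T N \<omega> \<in> \<Theta>} \<subseteq> {\<omega> \<in> space M. K < norm (Y N \<omega>)}"
      proof safe
        fix \<omega> assume "T N \<omega> \<notin> \<Theta>"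
        then have "\<delta> \<le> norm (T N \<omega> - g \<mu>)"
          using \<delta>(2) by (auto simp: dist_norm norm_minus_commute subset_iff not_less[symmetric])
        then have "\<delta> * sqrt (real N) \<le> norm (Y N \<omega>)"
          using sN by (simp add: Y_def mult.commute)
        then show "K < norm (Y N \<omega>)" using sN by linarith
      qed
      then have "prob (space M - {\<omega> \<in> space M. T N \<omega> \<in> \<Theta>}) \<le> prob {\<omega> \<in> space M. K < norm (Y N \<omega>)}"
        by (intro finite_measure_mono) auto
      also have "prob (space M - {\<omega> \<in> space M. T N \<omega> \<in> \<Theta>}) = 1 - prob {\<omega> \<in> space M. T N \<omega> \<in> \<Theta>}"
        by (intro prob_compl) measurable
      finally show ?case using elim(1) e prob_le_1[of "{\<omega> \<in> space M. T N \<omega> \<in> \<Theta>}"]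
        by (simp add: dist_real_def)
    qed
  qed
  ultimately show ?thesis
    unfolding has_asymptotic_cov_def Y_def[abs_def] \<Sigma>_def V_def \<mu>_def by blast
qed

section \<open>Augmenting a Dirichlet estimator by the total\<close>

lemma snoc_vec_nth [simp]: "snoc_vec a b $ Inl i = a $ i" "snoc_vec a b $ Inr j = b"
  by (simp_all add: snoc_vec_def)

definition init_vec :: "real ^ ('k + 1) \<Rightarrow> real ^ 'k" where
  "init_vec v = (\<chi> i. v $ Inl i)"

lemma init_vec_nth [simp]: "init_vec v $ i = v $ Inl i"
  by (simp add: init_vec_def)

lemma snoc_vec_init_vec: "snoc_vec (init_vec v) (v $ Inr 1) = v"
proof -
  have "snoc_vec (init_vec v) (v $ Inr 1) $ i = v $ i" for i
  proof (cases i)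
    case (Inr j)
    have "j = 1" by (rule num1_eqI)
    then show ?thesis unfolding Inr by (simp only: snoc_vec_nth)
  qed simp
  then show ?thesis by (simp add: vec_eq_iff)
qed

lemma init_vec_snoc_vec [simp]: "init_vec (snoc_vec a b) = a"
  by (simp add: vec_eq_iff)

lemma sum_UNIV_Plus:
  "(\<Sum>i\<in>(UNIV :: ('a::finite + 'b::finite) set). f i) = (\<Sum>i\<in>UNIV. f (Inl i)) + (\<Sum>j\<in>UNIV. f (Inr j))"
  using sum.Plus[of UNIV UNIV f] by (simp add: o_def)

lemma init_vec_sample_mean: "init_vec (sample_mean N y) = sample_mean N (\<lambda>n. init_vec (y n))"
  by (simp add: sample_mean_def vec_eq_iff)

lemma bounded_linear_init_vec: "bounded_linear (init_vec :: real ^ ('k + 1) \<Rightarrow> real ^ 'k)"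
  by (rule linear_conv_bounded_linear[THEN iffD1]) (auto intro!: linearI simp: vec_eq_iff)

lemma init_vec_measurable [measurable]: "(init_vec :: real ^ ('k + 1) \<Rightarrow> real ^ 'k) \<in> borel_measurable borel"
  unfolding init_vec_def by (rule measurable_vec_lambda) measurable

lemma measurable_snoc_vec [measurable (raw)]:
  fixes a :: "'a \<Rightarrow> real ^ 'k"
  assumes [measurable]: "a \<in> borel_measurable M" "b \<in> borel_measurable M"
  shows "(\<lambda>x. snoc_vec (a x) (b x)) \<in> borel_measurable M"
  unfolding snoc_vec_def
proof (rule measurable_vec_lambda)
  fix i :: "'k + 1"
  show "(\<lambda>x. case i of Inl j \<Rightarrow> a x $ j | Inr _ \<Rightarrow> b x) \<in> borel_measurable M"
    by (cases i) simp_all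
qed

lemma norm_snoc_vec: "(norm (snoc_vec a b))\<^sup>2 = (norm a)\<^sup>2 + b\<^sup>2"
  unfolding power2_norm_eq_inner inner_vec_def sum_UNIV_Plus by (simp add: power2_eq_square)

lemma integrable_vec_nth:
  fixes f :: "'a \<Rightarrow> real ^ 'n"
  shows "integrable M f \<longleftrightarrow> (\<forall>i. integrable M (\<lambda>x. f x $ i))"
proof
  assume f: "integrable M f"
  show "\<forall>i. integrable M (\<lambda>x. f x $ i)"
  proof
    fix i
    show "integrable M (\<lambda>x. f x $ i)"
      using integrable_inner_left[of "axis i 1" M f] f by (simp add: inner_axis)
  qed
next
  assume f: "\<forall>i. integrable M (\<lambda>x. f x $ i)"
  have "integrable M (\<lambda>x. \<Sum>i\<in>UNIV. f x $ i *\<^sub>R axis i (1::real))"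
    using f by (intro Bochner_Integration.integrable_sum integrable_scaleR_left) auto
  moreover have "(\<lambda>x. \<Sum>i\<in>UNIV. f x $ i *\<^sub>R axis i (1::real)) = f"
    by (simp add: fun_eq_iff vec_eq_iff axis_def if_distrib cong: if_cong)
  ultimately show "integrable M f" by simp
qed

lemma integral_vec_nth:
  fixes f :: "'a \<Rightarrow> real ^ 'n"
  assumes "integrable M f"
  shows "integral\<^sup>L M f $ i = (\<integral>x. f x $ i \<partial>M)"
  using integral_inner_left[of "axis i 1" M f] assms by (simp add: inner_axis)

lemma integral_snoc_vec:
  assumes "integrable M a" "integrable M b"
  shows "integrable M (\<lambda>x. snoc_vec (a x) (b x))"
    and "(\<integral>x. snoc_vec (a x) (b x) \<partial>M) = snoc_vec (integral\<^sup>L M a) (integral\<^sup>L M b)"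
proof -
  show i: "integrable M (\<lambda>x. snoc_vec (a x) (b x))"
    unfolding integrable_vec_nth
  proof
    fix i
    show "integrable M (\<lambda>x. snoc_vec (a x) (b x) $ i)"
      using assms unfolding integrable_vec_nth by (cases i) simp_all
  qed
  have "(\<integral>x. snoc_vec (a x) (b x) \<partial>M) $ i = snoc_vec (integral\<^sup>L M a) (integral\<^sup>L M b) $ i" for i
    unfolding integral_vec_nth[OF i] by (cases i) (simp_all add: integral_vec_nth[OF assms(1)])
  then show "(\<integral>x. snoc_vec (a x) (b x) \<partial>M) = snoc_vec (integral\<^sup>L M a) (integral\<^sup>L M b)"
    by (simp add: vec_eq_iff)
qed

lemma snoc_vec_mem_pos_orthant: "snoc_vec a b \<in> pos_orthant \<longleftrightarrow> a \<in> pos_orthant \<and> b > 0"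
proof -
  have "(\<forall>i. P i) \<longleftrightarrow> (\<forall>i. P (Inl i)) \<and> (\<forall>j. P (Inr j))" for P :: "'a + 1 \<Rightarrow> bool"
    by (metis sum.exhaust)
  then show ?thesis by (simp add: pos_orthant_def)
qed

lemma open_pos_orthant: "open (pos_orthant :: (real ^ 'd) set)"
proof -
  have eq: "pos_orthant = (\<Inter>i. {x :: real ^ 'd. 0 < x $ i})" by (auto simp: pos_orthant_def)
  show ?thesis
    unfolding eq by (intro open_INT ballI open_Collect_less continuous_intros) simp_all
qed

lemma mgamma_family_snoc_vec: "mgamma_family (snoc_vec \<alpha> \<beta>) = mgamma \<alpha> \<beta>"
  by (simp add: mgamma_family_def)

definition augmented_statistic ::
  "(real ^ 'k::{finite,linorder} \<Rightarrow> real ^ 'm) \<Rightarrow> real ^ 'k::{finite,linorder} \<Rightarrow> real ^ ('m + 1)" where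
  "augmented_statistic h x = snoc_vec (h (proportions x)) (x $ last_ix)"

text \<open>
  The total has mean \<open>\<alpha>\<^sub>0 * \<beta>\<close>, so dividing it by the sum of the recovered shapes recovers the scale.
\<close>

definition augmented_inverse ::
  "(real ^ 'm \<Rightarrow> real ^ 'k) \<Rightarrow> real ^ ('m + 1) \<Rightarrow> real ^ ('k + 1)" where
  "augmented_inverse g v =
     snoc_vec (g (init_vec v)) (v $ Inr 1 / (\<Sum>i\<in>UNIV. g (init_vec v) $ i))"

lemma augmented_statistic_measurable [measurable]:
  assumes [measurable]: "h \<in> borel_measurable borel"
  shows "augmented_statistic h \<in> borel_measurable borel"
  unfolding augmented_statistic_def by measurable

lemma augmented_inverse_measurable [measurable]:
  assumes [measurable]: "g \<in> borel_measurable borel"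
  shows "augmented_inverse g \<in> borel_measurable borel"
  unfolding augmented_inverse_def by measurable

context
  fixes \<alpha> :: "real ^ 'k::{finite,linorder}" and \<beta> \<alpha>\<^sub>0 :: real
    and h :: "real ^ 'k::{finite,linorder} \<Rightarrow> real ^ 'm"
  assumes card: "CARD('k) \<ge> 2" and \<alpha>: "\<alpha> \<in> pos_orthant" and \<beta>: "\<beta> > 0"
    and \<alpha>\<^sub>0: "\<alpha>\<^sub>0 = (\<Sum>i\<in>UNIV. \<alpha> $ i)"
    and h [measurable]: "h \<in> borel_measurable borel"
begin

lemma augmented_statistic_mean:
  assumes "integrable (dirichlet \<alpha>) h"
  shows "integrable (mgamma \<alpha> \<beta>) (augmented_statistic h)"
    and "integral\<^sup>L (mgamma \<alpha> \<beta>) (augmented_statistic h) = snoc_vec (integral\<^sup>L (dirichlet \<alpha>) h) (\<alpha>\<^sub>0 * \<beta>)"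
  unfolding augmented_statistic_def
  using integral_snoc_vec[of "mgamma \<alpha> \<beta>" "\<lambda>x. h (proportions x)" "\<lambda>x. x $ last_ix"] assms
  by (simp_all add: integral_proportions[OF card \<alpha> \<beta> \<alpha>\<^sub>0 h] total_moments[OF card \<alpha> \<beta> \<alpha>\<^sub>0])

lemma augmented_statistic_square_integrable:
  assumes "integrable (dirichlet \<alpha>) (\<lambda>w. (norm (h w))\<^sup>2)"
  shows "integrable (mgamma \<alpha> \<beta>) (\<lambda>x. (norm (augmented_statistic h x))\<^sup>2)"
  unfolding augmented_statistic_def norm_snoc_vec
  using assms integral_proportions(1)[OF card \<alpha> \<beta> \<alpha>\<^sub>0, of "\<lambda>w. (norm (h w))\<^sup>2"] total_moments(3)[OF card \<alpha> \<beta> \<alpha>\<^sub>0]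
  by (intro Bochner_Integration.integrable_add) auto

text \<open>
  The off-diagonal blocks vanish because the total is independent of the proportions; the lower right
  block is the variance of the gamma law of the total.
\<close>

lemma augmented_statistic_cov:
  assumes int: "integrable (dirichlet \<alpha>) h"
  shows "cov_matrix (mgamma \<alpha> \<beta>) (augmented_statistic h)
       = block_matrix (cov_matrix (dirichlet \<alpha>) h) 0 0 (\<chi> i j. \<alpha>\<^sub>0 * \<beta>\<^sup>2)"
proof -
  interpret prob_space "mgamma \<alpha> \<beta>" by (rule prob_space_mgamma[OF \<alpha> \<beta>])
  have l: "augmented_statistic h x $ Inl p = h (proportions x) $ p" and
    r: "augmented_statistic h x $ Inr q = x $ last_ix" for x p q
    by (simp_all add: augmented_statistic_def)
  define e where "e p = (\<integral>y. h y $ p \<partial>dirichlet \<alpha>)" for p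
  have El: "(\<integral>x. h (proportions x) $ p \<partial>mgamma \<alpha> \<beta>) = e p" for p
    unfolding e_def by (rule integral_proportions(2)[OF card \<alpha> \<beta> \<alpha>\<^sub>0]) measurable
  have cross: "(\<integral>x. (h (proportions x) $ p - e p) * (x $ last_ix - \<alpha>\<^sub>0 * \<beta>) \<partial>mgamma \<alpha> \<beta>) = 0" for p
  proof -
    have ind: "indep_var borel (\<lambda>x. h (proportions x) $ p) borel (\<lambda>x. x $ last_ix)"
      by (rule indep_proportions_total[OF card \<alpha> \<beta> \<alpha>\<^sub>0]) measurable
    have ind': "indep_var borel (\<lambda>x. h (proportions x) $ p - e p) borel (\<lambda>x. x $ last_ix - \<alpha>\<^sub>0 * \<beta>)"
      using indep_var_compose[OF ind, of "\<lambda>y. y - e p" borel "\<lambda>y. y - \<alpha>\<^sub>0 * \<beta>" borel] by (simp add: o_def)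
    have i: "integrable (mgamma \<alpha> \<beta>) (\<lambda>x. h (proportions x) $ p)"
      using int integral_proportions(1)[OF card \<alpha> \<beta> \<alpha>\<^sub>0, of "\<lambda>w. h w $ p"] unfolding integrable_vec_nth by simp
    have "(\<integral>x. (h (proportions x) $ p - e p) * (x $ last_ix - \<alpha>\<^sub>0 * \<beta>) \<partial>mgamma \<alpha> \<beta>)
      = (\<integral>x. h (proportions x) $ p - e p \<partial>mgamma \<alpha> \<beta>) * (\<integral>x. x $ last_ix - \<alpha>\<^sub>0 * \<beta> \<partial>mgamma \<alpha> \<beta>)"
      by (rule indep_var_lebesgue_integral[OF ind']) (use i total_moments(1)[OF card \<alpha> \<beta> \<alpha>\<^sub>0] in auto)
    also have "(\<integral>x. h (proportions x) $ p - e p \<partial>mgamma \<alpha> \<beta>) = 0"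
      using i prob_space by (simp add: El)
    finally show ?thesis by simp
  qed
  have ll: "(\<integral>x. (h (proportions x) $ p - e p) * (h (proportions x) $ q - e q) \<partial>mgamma \<alpha> \<beta>)
     = cov_matrix (dirichlet \<alpha>) h $ p $ q" for p q
    using integral_proportions(2)[OF card \<alpha> \<beta> \<alpha>\<^sub>0, of "\<lambda>w. (h w $ p - e p) * (h w $ q - e q)"]
    by (simp add: cov_matrix_def e_def)
  have "cov_matrix (mgamma \<alpha> \<beta>) (augmented_statistic h) $ i $ j
       = block_matrix (cov_matrix (dirichlet \<alpha>) h) 0 0 (\<chi> i j. \<alpha>\<^sub>0 * \<beta>\<^sup>2) $ i $ j" for i j
    using cross total_moments(4)[OF card \<alpha> \<beta> \<alpha>\<^sub>0]
    by (cases i; cases j)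
      (simp_all add: cov_matrix_def[of "mgamma \<alpha> \<beta>"] block_matrix_def l r El total_moments(2)[OF card \<alpha> \<beta> \<alpha>\<^sub>0] ll
        power2_eq_square mult.commute[of "_ - \<alpha>\<^sub>0 * \<beta>" "h _ $ _ - e _"])
  then show ?thesis by (simp add: vec_eq_iff)
qed

end

lemma augmented_inverse_snoc_vec:
  assumes "g y = \<alpha>" "\<alpha> \<in> pos_orthant"
  shows "augmented_inverse g (snoc_vec y ((\<Sum>i\<in>UNIV. \<alpha> $ i) * \<beta>)) = snoc_vec \<alpha> \<beta>"
proof -
  have "(\<Sum>i\<in>UNIV. \<alpha> $ i) > 0" by (rule sum_pos_orthant_pos[OF assms(2)])
  then show ?thesis using assms(1) by (simp add: augmented_inverse_def)
qed

text \<open>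
  The lower row of blocks is the quotient rule for \<open>z / s\<close> at \<open>z = \<alpha>\<^sub>0 * \<beta>\<close> and \<open>s = \<alpha>\<^sub>0\<close>, where \<open>s\<close> is the sum
  of the coordinates of \<open>g y\<close>: its partial derivatives are \<open>1 / \<alpha>\<^sub>0\<close> and \<open>- \<beta> / \<alpha>\<^sub>0\<close>.
\<close>

lemma augmented_inverse_has_derivative:
  fixes g :: "real ^ 'm \<Rightarrow> real ^ 'k" and G\<^sub>D :: "real ^ 'm ^ 'k"
  assumes deriv: "(g has_derivative (\<lambda>v. G\<^sub>D *v v)) (at y)" and gy: "g y = \<alpha>"
    and \<alpha>\<^sub>0: "\<alpha>\<^sub>0 = (\<Sum>i\<in>UNIV. \<alpha> $ i)" "\<alpha>\<^sub>0 > 0"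
    and G: "G = block_matrix G\<^sub>D 0 ((- \<beta> / \<alpha>\<^sub>0) *\<^sub>R ((\<chi> i j. 1) ** G\<^sub>D)) (\<chi> i j. 1 / \<alpha>\<^sub>0)"
  shows "(augmented_inverse g has_derivative (\<lambda>v. G *v v)) (at (snoc_vec y (\<alpha>\<^sub>0 * \<beta>)))"
proof -
  let ?\<mu> = "snoc_vec y (\<alpha>\<^sub>0 * \<beta>)"
  have gi: "((\<lambda>v. g (init_vec v)) has_derivative (\<lambda>v. G\<^sub>D *v init_vec v)) (at ?\<mu>)"
  proof (rule has_derivative_compose[where f = init_vec and g = g])
    show "(init_vec has_derivative init_vec) (at ?\<mu>)"
      by (rule bounded_linear_imp_has_derivative[OF bounded_linear_init_vec])
    show "(g has_derivative (\<lambda>v. G\<^sub>D *v v)) (at (init_vec ?\<mu>))" using deriv by simp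
  qed
  have comp: "((\<lambda>v. g (init_vec v) $ p) has_derivative (\<lambda>v. (G\<^sub>D *v init_vec v) $ p)) (at ?\<mu>)" for p
    by (rule bounded_linear.has_derivative[OF bounded_linear_vec_nth gi])
  have tot: "((\<lambda>v. \<Sum>p\<in>UNIV. g (init_vec v) $ p) has_derivative (\<lambda>v. \<Sum>p\<in>UNIV. (G\<^sub>D *v init_vec v) $ p)) (at ?\<mu>)"
    by (rule has_derivative_sum) (rule comp)
  have last: "((\<lambda>v. v $ Inr 1) has_derivative (\<lambda>v. v $ Inr 1)) (at ?\<mu>)"
    by (rule bounded_linear_imp_has_derivative[OF bounded_linear_vec_nth])
  have quot: "((\<lambda>v. v $ Inr 1 / (\<Sum>p\<in>UNIV. g (init_vec v) $ p)) has_derivative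
     (\<lambda>v. (v $ Inr 1 * \<alpha>\<^sub>0 - \<alpha>\<^sub>0 * \<beta> * (\<Sum>p\<in>UNIV. (G\<^sub>D *v init_vec v) $ p)) / (\<alpha>\<^sub>0 * \<alpha>\<^sub>0))) (at ?\<mu>)"
    using has_derivative_divide'[OF last tot] \<alpha>\<^sub>0 by (simp add: gy)
  have Gl: "(G *v v) $ Inl p = (G\<^sub>D *v init_vec v) $ p" for v p
    by (simp add: G matrix_vector_mult_def block_matrix_def sum_UNIV_Plus)
  have Gr: "(G *v v) $ Inr q = (v $ Inr 1 * \<alpha>\<^sub>0 - \<alpha>\<^sub>0 * \<beta> * (\<Sum>p\<in>UNIV. (G\<^sub>D *v init_vec v) $ p)) / (\<alpha>\<^sub>0 * \<alpha>\<^sub>0)" for v q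
  proof -
    have "(\<Sum>p\<in>UNIV. (G\<^sub>D *v init_vec v) $ p) = (\<Sum>j\<in>UNIV. (\<Sum>p\<in>UNIV. G\<^sub>D $ p $ j) * v $ Inl j)"
      unfolding matrix_vector_mult_def sum_distrib_right by simp (rule sum.swap)
    moreover have "(G *v v) $ Inr q = (- \<beta> / \<alpha>\<^sub>0) * (\<Sum>j\<in>UNIV. (\<Sum>p\<in>UNIV. G\<^sub>D $ p $ j) * v $ Inl j) + (1 / \<alpha>\<^sub>0) * v $ Inr 1"
    proof -
      have col: "((- \<beta> / \<alpha>\<^sub>0) *\<^sub>R ((\<chi> i j. 1) ** G\<^sub>D)) $ r $ j = (- \<beta> / \<alpha>\<^sub>0) * (\<Sum>p\<in>UNIV. G\<^sub>D $ p $ j)"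
        for r :: 1 and j
        by (simp add: matrix_matrix_mult_def)
      have "(G *v v) $ Inr q = (\<Sum>j\<in>UNIV. ((- \<beta> / \<alpha>\<^sub>0) *\<^sub>R ((\<chi> i j. 1) ** G\<^sub>D)) $ q $ j * v $ Inl j) + (1 / \<alpha>\<^sub>0) * v $ Inr 1"
        by (simp add: G matrix_vector_mult_def block_matrix_def sum_UNIV_Plus)
      then show ?thesis by (simp only: col mult.assoc sum_distrib_left[symmetric])
    qed
    moreover have "(- \<beta> / \<alpha>\<^sub>0) * s + (1 / \<alpha>\<^sub>0) * w = (w * \<alpha>\<^sub>0 - \<alpha>\<^sub>0 * \<beta> * s) / (\<alpha>\<^sub>0 * \<alpha>\<^sub>0)" for s w
      using \<alpha>\<^sub>0(2) by (simp add: field_simps)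
    ultimately show ?thesis by (simp only:)
  qed
  show ?thesis
    unfolding has_derivative_componentwise_within[of "augmented_inverse g"]
  proof
    fix b :: "real ^ ('k + 1)" assume "b \<in> Basis"
    then obtain i where b: "b = axis i 1" by (auto simp: Basis_vec_def)
    show "((\<lambda>v. augmented_inverse g v \<bullet> b) has_derivative (\<lambda>v. (G *v v) \<bullet> b)) (at ?\<mu>)"
    proof (cases i)
      case (Inl p)
      then show ?thesis using comp[of p] by (simp add: b inner_axis augmented_inverse_def Gl)
    next
      case (Inr q)
      then show ?thesis using quot by (simp add: b inner_axis augmented_inverse_def Gr)
    qed
  qed
qed

theorem theorem4p9:
  fixes M :: "'w measure"
    and X W :: "nat \<Rightarrow> 'w \<Rightarrow> real ^ 'k::{finite,linorder}"
    and \<alpha> :: "real ^ 'k::{finite,linorder}" and \<beta> \<alpha>\<^sub>0 :: real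
    and h\<^sub>D :: "real ^ 'k::{finite,linorder} \<Rightarrow> real ^ 'm" and g\<^sub>D :: "real ^ 'm \<Rightarrow> real ^ 'k::{finite,linorder}"
    and alpha_est :: "nat \<Rightarrow> 'w \<Rightarrow> real ^ 'k::{finite,linorder}" and beta_est :: "nat \<Rightarrow> 'w \<Rightarrow> real"
    and theta_est :: "nat \<Rightarrow> 'w \<Rightarrow> real ^ ('k::{finite,linorder} + 1)"
    and G\<^sub>D :: "real ^ 'm ^ 'k::{finite,linorder}" and V\<^sub>D :: "real ^ 'm ^ 'm"
    and G :: "real ^ ('m + 1) ^ ('k::{finite,linorder} + 1)" and V :: "real ^ ('m + 1) ^ ('m + 1)"
  assumes "CARD('k) \<ge> 2"
    and "\<alpha> \<in> pos_orthant" and "\<beta> > 0" and "\<alpha>\<^sub>0 = (\<Sum>i\<in>UNIV. \<alpha> $ i)"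
    and "random_sample M X (mgamma \<alpha> \<beta>)"
    and "\<And>n \<omega>. W n \<omega> = (1 / X n \<omega> $ last_ix) *\<^sub>R delta (X n \<omega>)"
    and "moment_type_estimator pos_orthant dirichlet h\<^sub>D g\<^sub>D W alpha_est"
    and "integrable (dirichlet \<alpha>) (\<lambda>w. (norm (h\<^sub>D w))\<^sup>2)"
    and "continuously_differentiable_at g\<^sub>D (moment_map dirichlet h\<^sub>D \<alpha>)"
    and "\<And>N \<omega>. beta_est N \<omega> =
           sample_mean N (\<lambda>n. X n \<omega> $ last_ix) / (\<Sum>i\<in>UNIV. alpha_est N \<omega> $ i)"
    and "\<And>N \<omega>. theta_est N \<omega> = snoc_vec (alpha_est N \<omega>) (beta_est N \<omega>)"
    and "G\<^sub>D = jacobian g\<^sub>D (at (moment_map dirichlet h\<^sub>D \<alpha>))"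
    and "V\<^sub>D = cov_matrix (dirichlet \<alpha>) h\<^sub>D"
    and "G = block_matrix G\<^sub>D 0
               ((- \<beta> / \<alpha>\<^sub>0) *\<^sub>R ((\<chi> i j. 1) ** G\<^sub>D)) (\<chi> i j. 1 / \<alpha>\<^sub>0)"
    and "V = block_matrix V\<^sub>D 0 0 (\<chi> i j. \<alpha>\<^sub>0 * \<beta>\<^sup>2)"
  shows "(\<exists>(h :: real ^ 'k::{finite,linorder} \<Rightarrow> real ^ ('m + 1)) (g :: real ^ ('m + 1) \<Rightarrow> real ^ ('k::{finite,linorder} + 1)).
            moment_type_estimator pos_orthant mgamma_family h g X theta_est)
       \<and> has_asymptotic_cov M pos_orthant theta_est (snoc_vec \<alpha> \<beta>) (G ** V ** transpose G)"
proof -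
  note card = assms(1) and \<alpha> = assms(2) and \<beta> = assms(3) and \<alpha>\<^sub>0 = assms(4) and rs = assms(5)
  let ?h = "augmented_statistic h\<^sub>D" and ?g = "augmented_inverse g\<^sub>D"
  have mte: "h\<^sub>D \<in> borel_measurable borel" "g\<^sub>D \<in> borel_measurable borel"
    "\<And>a. a \<in> pos_orthant \<Longrightarrow> integrable (dirichlet a) h\<^sub>D"
    "\<And>a. a \<in> pos_orthant \<Longrightarrow> g\<^sub>D (moment_map dirichlet h\<^sub>D a) = a"
    "\<And>N \<omega>. alpha_est N \<omega> = g\<^sub>D (sample_mean N (\<lambda>n. h\<^sub>D (W n \<omega>)))"
    using assms(7) unfolding moment_type_estimator_def by blast+
  note [measurable] = mte(1,2)
  have \<alpha>\<^sub>0_pos: "\<alpha>\<^sub>0 > 0" by (rule sum_pos_orthant_pos[OF \<alpha>, folded \<alpha>\<^sub>0])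
  have est: "theta_est N \<omega> = ?g (sample_mean N (\<lambda>n. ?h (X n \<omega>)))" for N \<omega>
  proof -
    have "init_vec (sample_mean N (\<lambda>n. ?h (X n \<omega>))) = sample_mean N (\<lambda>n. h\<^sub>D (W n \<omega>))"
      by (simp add: init_vec_sample_mean augmented_statistic_def assms(6) proportions_def)
    moreover have "sample_mean N (\<lambda>n. ?h (X n \<omega>)) $ Inr 1 = sample_mean N (\<lambda>n. X n \<omega> $ last_ix)"
      by (simp add: sample_mean_def augmented_statistic_def)
    ultimately show ?thesis
      by (simp add: augmented_inverse_def assms(10,11) mte(5))
  qed
  have moments: "integrable (mgamma_family \<theta>) ?h" "?g (moment_map mgamma_family ?h \<theta>) = \<theta>"
    if \<theta>: "\<theta> \<in> pos_orthant" for \<theta> :: "real ^ ('k::{finite,linorder} + 1)"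
  proof -
    define a b where "a = init_vec \<theta>" and "b = \<theta> $ Inr 1"
    have \<theta>_eq: "\<theta> = snoc_vec a b" unfolding a_def b_def by (rule snoc_vec_init_vec[symmetric])
    have ab: "a \<in> pos_orthant" "b > 0" using \<theta> unfolding \<theta>_eq snoc_vec_mem_pos_orthant by auto
    note mean = augmented_statistic_mean[OF card ab refl mte(1) mte(3)[OF ab(1)]]
    show "integrable (mgamma_family \<theta>) ?h"
      unfolding \<theta>_eq mgamma_family_snoc_vec by (rule mean(1))
    show "?g (moment_map mgamma_family ?h \<theta>) = \<theta>"
      unfolding \<theta>_eq moment_map_def mgamma_family_snoc_vec mean(2)
      by (rule augmented_inverse_snoc_vec[where g = g\<^sub>D and \<alpha> = a, OF mte(4)[OF ab(1), unfolded moment_map_def] ab(1)])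
  qed
  have "moment_type_estimator pos_orthant mgamma_family ?h ?g X theta_est"
    unfolding moment_type_estimator_def
    using moments est by (auto intro!: inj_on_inverseI[where g = ?g])
  moreover have "has_asymptotic_cov M pos_orthant theta_est (snoc_vec \<alpha> \<beta>) (G ** V ** transpose G)"
  proof -
    let ?e = "moment_map dirichlet h\<^sub>D \<alpha>"
    note int = mte(3)[OF \<alpha>]
    have mean: "integral\<^sup>L (mgamma \<alpha> \<beta>) ?h = snoc_vec ?e (\<alpha>\<^sub>0 * \<beta>)"
      unfolding moment_map_def by (rule augmented_statistic_mean(2)[OF card \<alpha> \<beta> \<alpha>\<^sub>0 mte(1) int])
    have "g\<^sub>D differentiable (at ?e)"
      using assms(9) unfolding continuously_differentiable_at_def by blast
    then have "(g\<^sub>D has_derivative (\<lambda>v. G\<^sub>D *v v)) (at ?e)"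
      unfolding assms(12) jacobian_works[symmetric] .
    from augmented_inverse_has_derivative[OF this mte(4)[OF \<alpha>] \<alpha>\<^sub>0 \<alpha>\<^sub>0_pos assms(14)]
    have deriv: "(?g has_derivative (\<lambda>v. G *v v)) (at (integral\<^sup>L (mgamma \<alpha> \<beta>) ?h))"
      unfolding mean .
    have val: "?g (integral\<^sup>L (mgamma \<alpha> \<beta>) ?h) = snoc_vec \<alpha> \<beta>"
      unfolding mean \<alpha>\<^sub>0 by (rule augmented_inverse_snoc_vec[where g = g\<^sub>D and \<alpha> = \<alpha>, OF mte(4)[OF \<alpha>] \<alpha>])
    have V: "V = cov_matrix (mgamma \<alpha> \<beta>) ?h"
      unfolding assms(13,15) by (rule augmented_statistic_cov[OF card \<alpha> \<beta> \<alpha>\<^sub>0 mte(1) int, symmetric])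
    show ?thesis
      unfolding V val[symmetric]
      by (rule delta_method[OF rs _ _ _ deriv open_pos_orthant _ est])
        (use augmented_statistic_square_integrable[OF card \<alpha> \<beta> \<alpha>\<^sub>0 mte(1) assms(8)] \<alpha> \<beta>
          in \<open>simp_all add: val snoc_vec_mem_pos_orthant\<close>)
  qed
  ultimately show ?thesis by blast
qed

end
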